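(* Let $h_+\in(0,\infty)$, $k>0$, $U_+\in C^l([0,h_+])$ real valued with $l\ge4$, and let $c_*\in\mathbb{R}$ be a regular value of $U_+$ on $[0,h_+]$ with $c_*\notin\{U_+(0),U_+(h_+)\}$ and $U_+^{-1}(\{c_*\})=\{s_1,\dots,s_m\}\subset(0,h_+)$, $m\ge1$ (so $U_+'(s_j)\ne0$ for all $j$). For $c=c_*+ic_I\in\mathbb{C}\setminus\mathbb{R}$ sufficiently close to $c_*$, let $y$ be the solution of $$-y''+\Big(\frac{U_+''}{U_+-c}+k^2\Big)y=0\ \text{ on }(0,h_+),\qquad y(h_+)=0,\quad y'(h_+)=1 .$$ Then: (1) There exists a unique solution $y_*$ of $$-y_*''+\Big(\frac{U_+''}{U_+-c_*}+k^2\Big)y_*=0\ \text{ on }(0,h_+)\setminus U_+^{-1}(\{c_*\}),\qquad y_*(h_+)=0,\quad y_*'(h_+)=1,$$ which at every $s\in U_+^{-1}(\{c_*\})$ satisfies $$y_*(s)=y_*(s\pm)\quad\text{and}\quad \lim_{x_2\to0+}\big(y_*'(s+x_2)-y_*'(s-x_2)\big)=i\,\operatorname{sgn}(c_I)\,\frac{\pi U_+''(s)}{|U_+'(s)|}\,y_*(s).$$ (2) For every $s\in U_+^{-1}(\{c_*\})$, $|y_*'(s+x_2)|=O(|\log|x_2||)$ as $x_2\to0$. Moreover $y_*$ is $C^{l-3}$ in $c_*$ for $x_2\notin U_+^{-1}(\{c_*\})$. (3) For any $\delta>0$ and $\alpha\in(0,1)$, $$|y(x_2)-y_*(x_2)|=O(|c_I|^\alpha)\quad\text{for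 all }x_2\in[0,h_+]\setminus\bigcup_{j=1}^m(s_j-\delta,s_j+\delta).$$ These estimates are uniform in $k$ for $k$ in any compact subset of $\mathbb{R}^+$.
   Context: Primes denote $d/dx_2$. $f(s\pm)$ denotes one-sided limits. The function $y_*$ depends on the sign of $c_I$ but not on its magnitude. *)

theory Defs
  imports "HOL-Analysis.Analysis"
begin

text \<open>Derivative relative to a set: the usual derivative at interior points, the one-sided
  derivative at the end points of a closed interval.\<close>

definition deriv_within :: "real set \<Rightarrow> (real \<Rightarrow> 'a::real_normed_vector) \<Rightarrow> real \<Rightarrow> 'a" where
  "deriv_within A f x = vector_derivative f (at x within A)"

definition Ck_on :: "nat \<Rightarrow> real set \<Rightarrow> (real \<Rightarrow> 'a::real_normed_vector) \<Rightarrow> bool" where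
  "Ck_on n A f \<longleftrightarrow>
     (\<forall>j<n. \<forall>x\<in>A. ((deriv_within A ^^ j) f) differentiable (at x within A)) \<and>
     continuous_on A ((deriv_within A ^^ n) f)"

definition regular_value_on :: "real \<Rightarrow> (real \<Rightarrow> real) \<Rightarrow> real \<Rightarrow> bool" where
  "regular_value_on h U c \<longleftrightarrow> (\<forall>x\<in>{0..h}. U x = c \<longrightarrow> deriv_within {0..h} U x \<noteq> 0)"

definition critical_layers :: "real \<Rightarrow> (real \<Rightarrow> real) \<Rightarrow> real \<Rightarrow> real set" where
  "critical_layers h U c = {x\<in>{0..h}. U x = c}"

definition rayleigh_coeff ::
  "real \<Rightarrow> (real \<Rightarrow> real) \<Rightarrow> real \<Rightarrow> complex \<Rightarrow> real \<Rightarrow> complex" where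
  "rayleigh_coeff h U k c x =
     of_real (deriv_within {0..h} (deriv_within {0..h} U) x) / (of_real (U x) - c)
     + of_real (k\<^sup>2)"

text \<open>Classical solutions of the Rayleigh equation on \<open>(0,h) - S\<close> with data \<open>y(h) = 0\<close>,
  \<open>y'(h) = 1\<close>.  They are required to be \<open>C\<^sup>1\<close> up to those end points of \<open>[0,h]\<close> that are not
  in the closed exceptional set \<open>S\<close>, so that the data at \<open>h\<close> and the value at \<open>0\<close> make sense.
  Nothing is required at the points of \<open>S\<close>.\<close>

definition rayleigh_solution ::
  "real \<Rightarrow> (real \<Rightarrow> real) \<Rightarrow> real \<Rightarrow> complex \<Rightarrow> real set \<Rightarrow> (real \<Rightarrow> complex) \<Rightarrow> bool" where
  "rayleigh_solution h U k c S y \<longleftrightarrow>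
     (let y' = deriv_within {0..h} y; y'' = deriv_within {0..h} y' in
       (\<forall>x\<in>{0..h} - S. y differentiable (at x within {0..h})) \<and>
       continuous_on ({0..h} - S) y' \<and>
       (\<forall>x\<in>{0<..<h} - S. y' differentiable (at x) \<and>
          - y'' x + rayleigh_coeff h U k c x * y x = 0) \<and>
       y h = 0 \<and> y' h = 1)"

text \<open>The limiting problem at real \<open>c\<close>; \<open>\<sigma> = \<plusminus>1\<close> is the sign of the imaginary part
  of the wave speeds that approach \<open>c\<close>.\<close>

definition limit_solution ::
  "real \<Rightarrow> (real \<Rightarrow> real) \<Rightarrow> real \<Rightarrow> real \<Rightarrow> real \<Rightarrow> (real \<Rightarrow> complex) \<Rightarrow> bool" where
  "limit_solution h U k c \<sigma> y \<longleftrightarrow>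
     rayleigh_solution h U k (of_real c) (critical_layers h U c) y \<and>
     (\<forall>s\<in>critical_layers h U c.
        (y \<longlongrightarrow> y s) (at_left s) \<and> (y \<longlongrightarrow> y s) (at_right s) \<and>
        ((\<lambda>t. deriv_within {0..h} y (s + t) - deriv_within {0..h} y (s - t)) \<longlongrightarrow>
           \<i> * of_real \<sigma> *
           of_real (pi * deriv_within {0..h} (deriv_within {0..h} U) s
                    / \<bar>deriv_within {0..h} U s\<bar>) * y s) (at_right 0))"

text \<open>A solution of the limiting problem is a function on all of \<open>\<real>\<close> here, so it is unique only
  as a function on \<open>[0,h]\<close>; \<open>ystar\<close> must be evaluated there only.\<close>

definition ystar :: "real \<Rightarrow> (real \<Rightarrow> real) \<Rightarrow> real \<Rightarrow> real \<Rightarrow> real \<Rightarrow> real \<Rightarrow> complex" where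
  "ystar h U k c \<sigma> = (SOME y. limit_solution h U k c \<sigma> y)"

end

theory Submission imports Defs begin

text \<open>Let \<open>L\<close> be a branch of \<open>log (U - c)\<close>. In the unknowns \<open>y\<close> and \<open>v = y' - (U''/U') L y\<close> the Rayleigh equation
  becomes a first-order system with only logarithmic singularities, and for real \<open>c\<close> and the branch with
  \<open>log (-1) = - i \<sigma> \<pi>\<close> the jump condition says exactly that \<open>v\<close> is continuous. Near a critical layer
  choose a coordinate \<open>t\<close> in which \<open>U - c\<close> is \<open>t\<^sup>2\<^sup>q\<^sup>+\<^sup>1\<close> times a nonvanishing function: the zero of order \<open>2 q\<close>
  of \<open>dx/dt\<close> absorbs the logarithms, so the system becomes continuous in \<open>t\<close> and \<open>C\<^sup>l\<^sup>-\<^sup>3\<close> in \<open>c\<close>.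
  Integrating from \<open>h\<close> down to \<open>0\<close>, layer by layer, ordinary linear theory yields existence,
  uniqueness, the logarithmic bound on \<open>y'\<close> and smoothness in \<open>c\<close>. For \<open>c = c\<^sub>* + i c\<^sub>I\<close> the same coordinate
  turns the difference of the two logarithms into an \<open>O(\<bar>c\<^sub>I\<bar>\<^sup>\<alpha>)\<close> perturbation of the coefficients, where
  \<open>\<alpha>\<close> can be brought arbitrarily close to \<open>1\<close> by increasing \<open>q\<close>.\<close>

section \<open>Linear differential equations\<close>

text \<open>Two obstacles shape the proof. At a layer the coefficient U''/(U - c) in general has a
  simple pole and y' a logarithmic singularity, so y' cannot be carried across; y and v can. And the
  layers move with c, so smoothness in c at a fixed x is tracked only at points away from them,
  among these the chart ends, which do not move. Between charts the plain system for (y, y') is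
  used; at a chart end y' and v are exchanged by adding or subtracting (U''/U') L y. The order l - 3
  comes from the derivative of U''/U' in the regularised coefficients. For the rate: with w = U - cs
  the two logarithms differ by Ln (1 - i c_I / w), which is O((|c_I| / |w|)^\<alpha>) for each
  \<alpha> in (0,1). In the chart |w| has size |t|^(2q+1), and dx/dt has size |t|^(2q), so q must be
  so large that \<alpha> (2q+1) stays below 2q with room for one more logarithm, the coefficients
  being quadratic in L. Uniformity in k is inherited from Gronwall constants, since k enters as k^2
  in a single matrix entry.\<close>

lemma exp_weighted_mono:
  fixes f :: "real \<Rightarrow> real"
  assumes le: "a \<le> b" and cont: "continuous_on {a..b} f"
    and d: "\<And>x. x \<in> {a<..<b} \<Longrightarrow> (f has_real_derivative f' x) (at x)"
    and bd: "\<And>x. x \<in> {a<..<b} \<Longrightarrow> \<bar>f' x\<bar> \<le> K * f x"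
  shows "f a \<le> exp (K * (b - a)) * f b" "f b \<le> exp (K * (b - a)) * f a"
proof -
  \<comment> \<open>The bound on \<open>f'\<close> makes \<open>exp (K x) f\<close> nondecreasing;
    the opposite weight \<open>exp (- K x)\<close> below makes the product nonincreasing. These are
    the two directions.\<close>
  have "(\<lambda>x. exp (K * x) * f x) a \<le> (\<lambda>x. exp (K * x) * f x) b"
  proof (rule DERIV_nonneg_imp_increasing_open[OF le])
    fix x assume x: "a < x" "x < b"
    have "((\<lambda>x. exp (K * x) * f x) has_real_derivative exp (K * x) * (K * f x + f' x)) (at x)"
      using x by (auto intro!: derivative_eq_intros d simp: algebra_simps)
    moreover have "exp (K * x) * (K * f x + f' x) \<ge> 0"
      using bd[of x] x by (intro mult_nonneg_nonneg) auto
    ultimately show "\<exists>y. ((\<lambda>x. exp (K * x) * f x) has_real_derivative y) (at x) \<and> 0 \<le> y" by blast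
  qed (intro continuous_intros cont)
  then show "f a \<le> exp (K * (b - a)) * f b"
    by (simp add: right_diff_distrib exp_diff field_simps)
  have "(\<lambda>x. - exp (- K * x) * f x) a \<le> (\<lambda>x. - exp (- K * x) * f x) b"
  proof (rule DERIV_nonneg_imp_increasing_open[OF le])
    fix x assume x: "a < x" "x < b"
    have "((\<lambda>x. - exp (- K * x) * f x) has_real_derivative exp (- K * x) * (K * f x - f' x)) (at x)"
      using x by (auto intro!: derivative_eq_intros d simp: algebra_simps)
    moreover have "exp (- K * x) * (K * f x - f' x) \<ge> 0"
      using bd[of x] x by (intro mult_nonneg_nonneg) auto
    ultimately show "\<exists>y. ((\<lambda>x. - exp (- K * x) * f x) has_real_derivative y) (at x) \<and> 0 \<le> y" by blast
  qed (intro continuous_intros cont)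
  then show "f b \<le> exp (K * (b - a)) * f a"
    by (simp add: right_diff_distrib exp_diff exp_minus field_simps)
qed

text \<open>The norm itself need not be differentiable at zeros of \<open>Y\<close>, so the estimate
  runs on \<open>|Y|^2 + D^2\<close>. The cross term \<open>|Y| D\<close> is at most
  \<open>|Y|^2 + D^2\<close>, hence \<open>C + 1\<close> in the exponent; the factor 2 is the price
  of returning from \<open>sqrt (p^2 + D^2)\<close> to \<open>p + D\<close>.\<close>

lemma gronwall_ends:
  fixes Y :: "real \<Rightarrow> 'a::real_inner"
  assumes le: "a \<le> b" and cont: "continuous_on {a..b} Y"
    and d: "\<And>x. x \<in> {a<..<b} \<Longrightarrow> (Y has_vector_derivative Y' x) (at x)"
    and bd: "\<And>x. x \<in> {a<..<b} \<Longrightarrow> norm (Y' x) \<le> C * norm (Y x) + D"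
    and nn: "C \<ge> 0" "D \<ge> 0"
  shows "norm (Y a) + D \<le> 2 * exp ((C + 1) * (b - a)) * (norm (Y b) + D)"
        "norm (Y b) + D \<le> 2 * exp ((C + 1) * (b - a)) * (norm (Y a) + D)"
proof -
  define f where "f x = Y x \<bullet> Y x + D\<^sup>2" for x
  have d': "(f has_real_derivative 2 * (Y x \<bullet> Y' x)) (at x)" if "x \<in> {a<..<b}" for x
    unfolding f_def has_real_derivative_iff_has_vector_derivative
    by (auto intro!: derivative_eq_intros d that
        bounded_bilinear.has_vector_derivative[OF bounded_bilinear_inner] simp: inner_commute)
  have bd': "\<bar>2 * (Y x \<bullet> Y' x)\<bar> \<le> (2 * (C + 1)) * f x" if "x \<in> {a<..<b}" for x
  proof -
    have "\<bar>Y x \<bullet> Y' x\<bar> \<le> norm (Y x) * (C * norm (Y x) + D)"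
      using Cauchy_Schwarz_ineq2[of "Y x" "Y' x"] bd[OF that]
      by (meson mult_left_mono norm_ge_zero order_trans)
    moreover have "norm (Y x) * D \<le> (norm (Y x))\<^sup>2 + D\<^sup>2"
    proof -
      have "2 * (norm (Y x) * D) \<le> (norm (Y x))\<^sup>2 + D\<^sup>2"
        using sum_squares_bound[of "norm (Y x)" D] by (simp add: power2_eq_square)
      moreover have "0 \<le> norm (Y x) * D" using nn by simp
      ultimately show ?thesis by linarith
    qed
    moreover have "C * D\<^sup>2 \<ge> 0" using nn by simp
    ultimately show ?thesis
      by (simp add: f_def dot_square_norm algebra_simps power2_eq_square)
  qed
  have cf: "continuous_on {a..b} f"
    unfolding f_def by (intro continuous_intros cont)
  note g = exp_weighted_mono[OF le cf d' bd']
  have conv: "p + D \<le> 2 * exp ((C + 1) * (b - a)) * (r + D)"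
    if h: "p\<^sup>2 + D\<^sup>2 \<le> exp (2 * (C + 1) * (b - a)) * (r\<^sup>2 + D\<^sup>2)" "p \<ge> 0" "r \<ge> 0" for p r
  proof -
    define E where "E = exp ((C + 1) * (b - a))"
    have E: "E > 0" "E\<^sup>2 = exp (2 * (C + 1) * (b - a))"
      by (auto simp: E_def power2_eq_square simp flip: exp_add)
    have "(p + D)\<^sup>2 \<le> 2 * (p\<^sup>2 + D\<^sup>2)"
      using sum_squares_bound[of p D] by (simp add: power2_eq_square algebra_simps)
    also have "\<dots> \<le> 2 * (E\<^sup>2 * (r\<^sup>2 + D\<^sup>2))" using h E by simp
    also have "\<dots> \<le> (2 * E * (r + D))\<^sup>2"
    proof -
      have "E\<^sup>2 * (r\<^sup>2 + D\<^sup>2) \<le> E\<^sup>2 * (r + D)\<^sup>2"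
        using h nn by (intro mult_left_mono) (auto simp: power2_sum)
      moreover have "0 \<le> E\<^sup>2 * (r + D)\<^sup>2" by simp
      moreover have "(2 * E * (r + D))\<^sup>2 = 4 * (E\<^sup>2 * (r + D)\<^sup>2)"
        by (simp add: power_mult_distrib)
      ultimately show ?thesis by linarith
    qed
    finally show ?thesis
      using h nn E unfolding E_def[symmetric] by (intro power2_le_imp_le[of "p + D"]) auto
  qed
  show "norm (Y a) + D \<le> 2 * exp ((C + 1) * (b - a)) * (norm (Y b) + D)"
    by (rule conv) (use g(1) in \<open>auto simp: f_def dot_square_norm mult_ac\<close>)
  show "norm (Y b) + D \<le> 2 * exp ((C + 1) * (b - a)) * (norm (Y a) + D)"
    by (rule conv) (use g(2) in \<open>auto simp: f_def dot_square_norm mult_ac\<close>)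
qed

text \<open>The exceptional point \<open>z\<close> is meant for a chart, where the equation is
  available only off the layer \<open>t = 0\<close> while \<open>Y\<close> is continuous across it.
  The interval is split at \<open>z\<close> and the previous estimate used twice, which squares both
  the factor 2 and the exponential. The data sit at the right end because integration runs downwards
  from \<open>h\<close>.\<close>

lemma gronwall:
  fixes Y :: "real \<Rightarrow> 'a::real_inner"
  assumes cont: "continuous_on {a..b} Y" and t: "t \<in> {a..b}"
    and d: "\<And>x. x \<in> {a<..<b} - {z} \<Longrightarrow> (Y has_vector_derivative Y' x) (at x)"
    and bd: "\<And>x. x \<in> {a<..<b} - {z} \<Longrightarrow> norm (Y' x) \<le> C * norm (Y x) + D"
    and nn: "C \<ge> 0" "D \<ge> 0"
  shows "norm (Y t) \<le> 4 * exp (2 * (C + 1) * (b - a)) * (norm (Y b) + D)"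
proof -
  define E where "E = exp ((C + 1) * (b - a))"
  have E1: "E \<ge> 1" using t nn by (auto simp: E_def)
  have step: "norm (Y u) + D \<le> 2 * E * (norm (Y v) + D)"
    if "a \<le> u" "u \<le> v" "v \<le> b" "z \<notin> {u<..<v}" for u v
  proof -
    have "norm (Y u) + D \<le> 2 * exp ((C + 1) * (v - u)) * (norm (Y v) + D)"
      by (rule gronwall_ends(1)[where Y' = Y'])
        (use that d bd nn in \<open>auto intro: continuous_on_subset[OF cont]\<close>)
    also have "\<dots> \<le> 2 * E * (norm (Y v) + D)"
      unfolding E_def using that nn by (intro mult_right_mono mult_left_mono) (auto intro!: mult_left_mono)
    finally show ?thesis .
  qed
  have E2: "E * E = exp (2 * (C + 1) * (b - a))" by (simp add: E_def algebra_simps flip: exp_add)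
  have "norm (Y t) + D \<le> 4 * (E * E) * (norm (Y b) + D)"
  proof (cases "z \<in> {t<..<b}")
    case True
    then have "norm (Y t) + D \<le> 2 * E * (norm (Y z) + D)" "norm (Y z) + D \<le> 2 * E * (norm (Y b) + D)"
      using step[of t z] step[of z b] t by auto
    then have "norm (Y t) + D \<le> 2 * E * (2 * E * (norm (Y b) + D))"
      using E1 by (meson mult_left_mono order_trans zero_le_mult_iff zero_le_numeral zero_le_one)
    then show ?thesis by (simp add: mult_ac)
  next
    case False
    then have "norm (Y t) + D \<le> 2 * E * (norm (Y b) + D)" using step[of t b] t by auto
    also have "\<dots> \<le> 4 * (E * E) * (norm (Y b) + D)"
    proof (rule mult_right_mono)
      have "1 * E \<le> E * E" using E1 by (intro mult_right_mono) auto
      then show "2 * E \<le> 4 * (E * E)" using E1 by linarith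
    qed (use nn in auto)
    finally show ?thesis .
  qed
  then show ?thesis using nn by (simp add: E2)
qed

text \<open>A contraction for the integral equation in the sup norm of
  \<open>exp (- lam (b - t)) Y t\<close>; this weight lets a single application of Banach's theorem
  cover the whole interval, whatever the size of \<open>B\<close>.\<close>

lemma linear_ode_exists:
  fixes B :: "real \<Rightarrow> 'a::banach \<Rightarrow>\<^sub>L 'a" and F :: "real \<Rightarrow> 'a"
  assumes le: "a \<le> b" and cB: "continuous_on {a..b} B" and cF: "continuous_on {a..b} F"
  obtains Y where "Y b = y0"
    "\<And>x. x \<in> {a..b} \<Longrightarrow> (Y has_vector_derivative B x (Y x) + F x) (at x within {a..b})"
proof -
  obtain C where C: "C > 0" "\<And>x. x \<in> {a..b} \<Longrightarrow> norm (B x) \<le> C"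
  proof -
    have "bounded (B ` {a..b})"
      by (intro compact_imp_bounded compact_continuous_image cB) auto
    then show ?thesis using that by (auto simp: bounded_pos)
  qed
  \<comment> \<open>The contraction factor comes out as \<open>C / lam\<close>, so this choice makes
    it 1/2.\<close>
  define lam where "lam = 2 * C"
  define G where "G (W :: real \<Rightarrow>\<^sub>C 'a) t = B t (exp (lam * (b - t)) *\<^sub>R W t) + F t" for W t
  have cG: "continuous_on {a..b} (G W)" for W
    unfolding G_def
    by (intro continuous_intros cB cF continuous_on_apply_bcontfun)
  \<comment> \<open>The data are at \<open>b\<close>, but the integrals start at \<open>a\<close>,
    so that differentiation is that of an indefinite integral.\<close>
  define I where "I W t = y0 - (integral {a..b} (G W) - integral {a..t} (G W))" for W t
  have cI: "continuous_on {a..b} (I W)" for W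
    unfolding I_def
    by (intro continuous_intros indefinite_integral_continuous_1 integrable_continuous_real cG)
  have I_alt: "I W t = y0 - integral {t..b} (G W)" if "t \<in> {a..b}" for W t
    using Henstock_Kurzweil_Integration.integral_combine[of a t b "G W"]
      integrable_continuous_real[OF cG[of W]] that
    by (auto simp: I_def algebra_simps)
  \<comment> \<open>\<open>bcontfun\<close> needs functions on the whole line: outside
    \<open>{a..b}\<close> they take the value at the nearest end.\<close>
  define cl where "cl t = max a (min b t)" for t
  have cl: "cl t \<in> {a..b}" "t \<in> {a..b} \<Longrightarrow> cl t = t" for t
    using le by (auto simp: cl_def)
  have ccl: "continuous_on UNIV cl" unfolding cl_def by (intro continuous_intros)
  define H where "H W t = exp (- lam * (b - cl t)) *\<^sub>R I W (cl t)" for W t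
  have H: "H W \<in> bcontfun" for W
    unfolding bcontfun_def
  proof (intro CollectI conjI)
    have "continuous_on UNIV (\<lambda>t. I W (cl t))"
      by (rule continuous_on_compose2[OF cI ccl]) (use cl in auto)
    then show "continuous_on UNIV (H W)"
      unfolding H_def by (intro continuous_intros ccl)
    have "compact ((\<lambda>t. exp (- lam * (b - t)) *\<^sub>R I W t) ` {a..b})"
      by (intro compact_continuous_image continuous_intros cI) auto
    moreover have "range (H W) \<subseteq> (\<lambda>t. exp (- lam * (b - t)) *\<^sub>R I W t) ` {a..b}"
      using cl by (auto simp: H_def)
    ultimately show "bounded (range (H W))"
      using bounded_subset compact_imp_bounded by blast
  qed
  define Phi where "Phi W = Bcontfun (H W)" for W
  have Phi: "apply_bcontfun (Phi W) = H W" for W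
    unfolding Phi_def by (rule Bcontfun_inverse[OF H])
  have "\<exists>!W. Phi W = W"
  proof (rule banach_fix_type[of "1/2"]; (intro allI)?)
    fix V W
    show "dist (Phi V) (Phi W) \<le> 1/2 * dist V W"
    proof (rule dist_bound)
      fix t0
      define t where "t = cl t0"
      have t: "t \<in> {a..b}" using cl by (simp add: t_def)
      have ct: "continuous_on {t..b} (G W)" for W
        using cG by (rule continuous_on_subset) (use t in auto)
      have int: "G W integrable_on {t..b}" for W
        by (intro integrable_continuous_real ct)
      define K where "K = C * dist V W"
      have hi: "((\<lambda>x. K * exp (lam * (b - x))) has_integral
          (- (K / lam) * exp (lam * (b - b))) - (- (K / lam) * exp (lam * (b - t)))) {t..b}"
        by (rule fundamental_theorem_of_calculus)
          (use t C in \<open>auto intro!: derivative_eq_intros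
             simp: lam_def simp flip: has_real_derivative_iff_has_vector_derivative\<close>)
      have "norm (integral {t..b} (\<lambda>x. G V x - G W x)) \<le> integral {t..b} (\<lambda>x. K * exp (lam * (b - x)))"
      proof (rule integral_norm_bound_integral)
        fix x assume x: "x \<in> {t..b}"
        have "G V x - G W x = B x (exp (lam * (b - x)) *\<^sub>R (V x - W x))"
          by (simp add: G_def blinfun.diff_right blinfun.scaleR_right scaleR_diff_right)
        also have "norm \<dots> \<le> norm (B x) * norm (exp (lam * (b - x)) *\<^sub>R (V x - W x))"
          by (rule norm_blinfun)
        also have "\<dots> \<le> C * (exp (lam * (b - x)) * dist V W)"
          using C x t dist_bounded[of V x W] by (intro mult_mono) (auto simp: dist_norm)
        finally show "norm (G V x - G W x) \<le> K * exp (lam * (b - x))" by (simp add: K_def mult_ac)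
      qed (use hi int in \<open>auto intro: integrable_diff\<close>)
      also have "\<dots> = K / lam * (exp (lam * (b - t)) - 1)"
        unfolding integral_unique[OF hi] by (simp add: algebra_simps)
      also have "\<dots> \<le> K / lam * exp (lam * (b - t))"
        using C by (intro mult_left_mono) (auto simp: K_def lam_def)
      finally have le1: "norm (I V t - I W t) \<le> K / lam * exp (lam * (b - t))"
        using t int by (simp add: I_alt integral_diff norm_minus_commute)
      have "dist (Phi V t0) (Phi W t0) = exp (- lam * (b - t)) * norm (I V t - I W t)"
        by (simp add: Phi H_def t_def dist_norm flip: scaleR_diff_right)
      also have "\<dots> \<le> exp (- lam * (b - t)) * (K / lam * exp (lam * (b - t)))"
        using le1 by (intro mult_left_mono) auto
      also have "\<dots> = K / lam" by (simp add: exp_minus)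
      also have "\<dots> = 1/2 * dist V W" using C by (simp add: K_def lam_def)
      finally show "dist (Phi V t0) (Phi W t0) \<le> 1/2 * dist V W" .
    qed
  qed auto
  then obtain W where W: "Phi W = W" by blast
  have GW: "G W t = B t (I W t) + F t" if "t \<in> {a..b}" for t
  proof -
    have "exp (lam * (b - t)) *\<^sub>R W t = I W t"
      by (subst W[symmetric]) (use that cl in \<open>simp add: Phi H_def flip: exp_add\<close>)
    then show ?thesis by (simp add: G_def)
  qed
  show ?thesis
  proof
    show "I W b = y0" by (simp add: I_def)
    fix x assume x: "x \<in> {a..b}"
    have "((\<lambda>u. integral {a..u} (G W)) has_vector_derivative G W x) (at x within {a..b})"
      by (rule integral_has_vector_derivative[OF cG x])
    then show "(I W has_vector_derivative B x (I W x) + F x) (at x within {a..b})"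
      unfolding I_def[abs_def] GW[OF x, symmetric, unfolded I_def]
      by (auto intro!: derivative_eq_intros)
  qed
qed

section \<open>Smooth dependence on a parameter\<close>

text \<open>The parameter is the second argument of \<open>F\<close>: all its derivatives up to order \<open>n\<close> in \<open>d\<close> are jointly
  continuous in \<open>(t, d)\<close>.\<close>

primrec Ck_param :: "nat \<Rightarrow> real set \<Rightarrow> real set \<Rightarrow> (real \<Rightarrow> real \<Rightarrow> 'a::real_normed_vector) \<Rightarrow> bool" where
  "Ck_param 0 T D F \<longleftrightarrow> continuous_on (D \<times> T) (\<lambda>(d, t). F t d)"
| "Ck_param (Suc n) T D F \<longleftrightarrow> continuous_on (D \<times> T) (\<lambda>(d, t). F t d) \<and>
     (\<exists>F'. (\<forall>t\<in>T. \<forall>d\<in>D. (F t has_vector_derivative F' t d) (at d)) \<and> Ck_param n T D F')"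

lemma Ck_param_cont: "Ck_param n T D F \<Longrightarrow> continuous_on (D \<times> T) (\<lambda>(d, t). F t d)"
  by (cases n) auto

lemma Ck_param_SucI:
  assumes "continuous_on (D \<times> T) (\<lambda>(d, t). F t d)"
    "\<And>t d. t \<in> T \<Longrightarrow> d \<in> D \<Longrightarrow> (F t has_vector_derivative F' t d) (at d)" "Ck_param n T D F'"
  shows "Ck_param (Suc n) T D F"
  unfolding Ck_param.simps using assms by (intro conjI exI[of _ F'] ballI)

lemma Ck_param_Suc_imp: "Ck_param (Suc n) T D F \<Longrightarrow> Ck_param n T D F"
proof (induction n arbitrary: F)
  case (Suc n)
  then obtain F' where F': "\<forall>t\<in>T. \<forall>d\<in>D. (F t has_vector_derivative F' t d) (at d)" "Ck_param (Suc n) T D F'"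
    by (subst (asm) (2) Ck_param.simps(2)) blast
  show ?case
    by (rule Ck_param_SucI[where F' = F']) (use F' Suc.IH Ck_param_cont[OF Suc.prems] in blast)+
qed (simp only: Ck_param.simps)

lemma Ck_param_subset: "Ck_param n T D F \<Longrightarrow> T' \<subseteq> T \<Longrightarrow> D' \<subseteq> D \<Longrightarrow> Ck_param n T' D' F"
proof (induction n arbitrary: F)
  case 0
  then show ?case by (auto intro: continuous_on_subset)
next
  case (Suc n)
  from Suc.prems obtain F' where F': "\<forall>t\<in>T. \<forall>d\<in>D. (F t has_vector_derivative F' t d) (at d)" "Ck_param n T D F'"
    by auto
  show ?case
  proof (rule Ck_param_SucI[where F' = F'])
    show "continuous_on (D' \<times> T') (\<lambda>(d, t). F t d)"
      using Ck_param_cont[OF Suc.prems(1)] Suc.prems by (auto intro: continuous_on_subset)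
  qed (use F' Suc.IH Suc.prems in blast)+
qed

lemma Ck_param_cong:
  assumes "open D" "\<And>t d. t \<in> T \<Longrightarrow> d \<in> D \<Longrightarrow> F t d = G t d" "Ck_param n T D F"
  shows "Ck_param n T D G"
proof (cases n)
  case 0
  then show ?thesis
    using assms by (auto intro: continuous_on_eq[of "D \<times> T" "\<lambda>(d, t). F t d" "\<lambda>(d, t). G t d"])
next
  case (Suc m)
  then obtain F' where F': "\<forall>t\<in>T. \<forall>d\<in>D. (F t has_vector_derivative F' t d) (at d)" "Ck_param m T D F'"
    using assms by auto
  show ?thesis unfolding Suc
  proof (rule Ck_param_SucI[where F' = F'])
    show "continuous_on (D \<times> T) (\<lambda>(d, t). G t d)"
      using Ck_param_cont[OF assms(3)] by (rule continuous_on_eq) (use assms(2) in auto)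
    show "(G t has_vector_derivative F' t d) (at d)" if "t \<in> T" "d \<in> D" for t d
      by (rule has_vector_derivative_transform_within_open[where f = "F t" and S = D])
        (use that F' assms in auto)
  qed (rule F'(2))
qed

lemma Ck_param_const: "Ck_param n T D (\<lambda>t d. c)"
proof (induction n arbitrary: c)
  case (Suc n)
  show ?case by (rule Ck_param_SucI[where F' = "\<lambda>t d. 0"]) (auto simp: split_def Suc)
qed (simp add: split_def)

text \<open>With a constant \<open>p\<close> this moves a statement about one point \<open>t\<close>
  to any dummy index set, which is how data at a chart end are handed over.\<close>

lemma Ck_param_reparam:
  assumes "continuous_on S p" "p ` S \<subseteq> T"
  shows "Ck_param n T D F \<Longrightarrow> Ck_param n S D (\<lambda>t d. F (p t) d)"
proof (induction n arbitrary: F)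
  case 0
  have "continuous_on (D \<times> S) (\<lambda>z. (\<lambda>(d, t). F t d) (fst z, p (snd z)))"
    by (rule continuous_on_compose2[OF 0[unfolded Ck_param.simps]])
      (use assms in \<open>auto intro!: continuous_intros continuous_on_compose2[OF assms(1)]\<close>)
  then show ?case by (simp add: split_def)
next
  case (Suc n)
  from Suc.prems obtain F' where F': "\<forall>t\<in>T. \<forall>d\<in>D. (F t has_vector_derivative F' t d) (at d)" "Ck_param n T D F'"
    by auto
  show ?case
    by (rule Ck_param_SucI[where F' = "\<lambda>t d. F' (p t) d"])
      (use Ck_param_cont[OF Suc.IH[OF Ck_param_Suc_imp[OF Suc.prems]]] F' Suc.IH[OF F'(2)] assms(2) in blast)+
qed

lemma Ck_param_fst: "continuous_on T f \<Longrightarrow> Ck_param n T D (\<lambda>t d. f t)"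
proof (cases n)
  case 0
  assume "continuous_on T f"
  then show ?thesis using 0
    by (auto simp: split_def intro!: continuous_on_compose2[of T f] continuous_intros)
next
  case (Suc m)
  assume f: "continuous_on T f"
  show ?thesis unfolding Suc
    by (rule Ck_param_SucI[where F' = "\<lambda>t d. 0"])
      (use f in \<open>auto simp: split_def intro!: Ck_param_const continuous_on_compose2[of T f] continuous_intros\<close>)
qed

lemma Ck_param_snd: "Ck_param n T D (\<lambda>t d. d)"
proof (cases n)
  case 0
  then show ?thesis by (auto simp: split_def intro!: continuous_intros)
next
  case (Suc m)
  show ?thesis unfolding Suc
    by (rule Ck_param_SucI[where F' = "\<lambda>t d. 1"])
      (auto simp: split_def intro!: Ck_param_const continuous_intros)
qed

lemma Ck_param_linear:
  assumes "bounded_linear L"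
  shows "Ck_param n T D F \<Longrightarrow> Ck_param n T D (\<lambda>t d. L (F t d))"
proof (induction n arbitrary: F)
  case 0
  then show ?case
    by (auto simp: split_def intro!: bounded_linear.continuous_on[OF assms])
next
  case (Suc n)
  from Suc.prems obtain F' where F': "\<forall>t\<in>T. \<forall>d\<in>D. (F t has_vector_derivative F' t d) (at d)" "Ck_param n T D F'"
    by auto
  show ?case
    by (rule Ck_param_SucI[where F' = "\<lambda>t d. L (F' t d)"])
      (use F' Suc Ck_param_cont[OF Suc.prems] in \<open>auto simp: split_def
        intro!: bounded_linear.continuous_on[OF assms] bounded_linear.has_vector_derivative[OF assms]\<close>)
qed

lemma Ck_param_add:
  "Ck_param n T D F \<Longrightarrow> Ck_param n T D G \<Longrightarrow> Ck_param n T D (\<lambda>t d. F t d + G t d)"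
proof (induction n arbitrary: F G)
  case 0
  then show ?case by (auto simp: split_def intro!: continuous_intros)
next
  case (Suc n)
  from Suc.prems obtain F' G' where F': "\<forall>t\<in>T. \<forall>d\<in>D. (F t has_vector_derivative F' t d) (at d)" "Ck_param n T D F'"
    "\<forall>t\<in>T. \<forall>d\<in>D. (G t has_vector_derivative G' t d) (at d)" "Ck_param n T D G'"
    by auto
  show ?case
    by (rule Ck_param_SucI[where F' = "\<lambda>t d. F' t d + G' t d"])
      (use F' Suc Ck_param_cont[OF Suc.prems(1)] Ck_param_cont[OF Suc.prems(2)] in \<open>auto simp: split_def
        intro!: continuous_intros has_vector_derivative_add\<close>)
qed

lemma Ck_param_bilinear:
  assumes "bounded_bilinear pr"
  shows "Ck_param n T D F \<Longrightarrow> Ck_param n T D G \<Longrightarrow> Ck_param n T D (\<lambda>t d. pr (F t d) (G t d))"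
proof (induction n arbitrary: F G)
  case 0
  then show ?case by (auto simp: split_def intro!: bounded_bilinear.continuous_on[OF assms])
next
  case (Suc n)
  from Suc.prems obtain F' G' where F': "\<forall>t\<in>T. \<forall>d\<in>D. (F t has_vector_derivative F' t d) (at d)" "Ck_param n T D F'"
    "\<forall>t\<in>T. \<forall>d\<in>D. (G t has_vector_derivative G' t d) (at d)" "Ck_param n T D G'"
    by auto
  show ?case
  proof (rule Ck_param_SucI[where F' = "\<lambda>t d. pr (F t d) (G' t d) + pr (F' t d) (G t d)"])
    show "continuous_on (D \<times> T) (\<lambda>(d, t). pr (F t d) (G t d))"
      using Ck_param_cont[OF Suc.prems(1)] Ck_param_cont[OF Suc.prems(2)]
      by (auto simp: split_def intro!: bounded_bilinear.continuous_on[OF assms])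
    show "((\<lambda>d. pr (F t d) (G t d)) has_vector_derivative
        pr (F t d) (G' t d) + pr (F' t d) (G t d)) (at d)" if "t \<in> T" "d \<in> D" for t d
      using bounded_bilinear.has_vector_derivative[OF assms, of "F t" _ d UNIV "G t"] F' that by auto
    show "Ck_param n T D (\<lambda>t d. pr (F t d) (G' t d) + pr (F' t d) (G t d))"
      by (rule Ck_param_add[OF Suc.IH[OF Ck_param_Suc_imp[OF Suc.prems(1)] F'(4)]
            Suc.IH[OF F'(2) Ck_param_Suc_imp[OF Suc.prems(2)]]])
  qed
qed

lemmas Ck_param_mult = Ck_param_bilinear[OF bounded_bilinear_mult]
lemmas Ck_param_scaleR = Ck_param_bilinear[OF bounded_bilinear_scaleR]
lemmas Ck_param_blinfun = Ck_param_bilinear[OF bounded_bilinear_blinfun_apply]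
lemmas Ck_param_of_real = Ck_param_linear[OF bounded_linear_of_real]
lemmas Ck_param_minus = Ck_param_linear[OF bounded_linear_minus[OF bounded_linear_ident]]

lemma Ck_param_diff: "Ck_param n T D F \<Longrightarrow> Ck_param n T D G \<Longrightarrow> Ck_param n T D (\<lambda>t d. F t d - G t d)"
  using Ck_param_add[of n T D F "\<lambda>t d. - G t d"] Ck_param_minus[of n T D G] by simp

lemma Ck_param_power:
  fixes F :: "real \<Rightarrow> real \<Rightarrow> 'a::{real_normed_algebra_1}"
  shows "Ck_param n T D F \<Longrightarrow> Ck_param n T D (\<lambda>t d. F t d ^ m)"
proof (induction m)
  case 0
  show ?case by (simp add: Ck_param_const)
next
  case (Suc m)
  show ?case using Ck_param_mult[OF Suc.prems Suc.IH[OF Suc.prems]] by simp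
qed

lemma Ck_param_Pair:
  assumes "Ck_param n T D F" "Ck_param n T D G"
  shows "Ck_param n T D (\<lambda>t d. (F t d, G t d))"
proof -
  have "Ck_param n T D (\<lambda>t d. (F t d, 0) + (0, G t d))"
    by (rule Ck_param_add[OF Ck_param_linear[where L = "\<lambda>x. (x, 0)", OF _ assms(1)]
          Ck_param_linear[where L = "\<lambda>x. (0, x)", OF _ assms(2)]])
      (auto intro: bounded_linear_Pair bounded_linear_ident bounded_linear_zero)
  then show ?thesis by simp
qed

text \<open>A function of one variable is encoded as a family over the one-point set
  \<open>{0}\<close> that ignores its first argument. The derivative is \<open>F'\<close> times
  \<open>G'\<close> at \<open>F\<close>, so the induction rests on closure under products.\<close>

lemma Ck_param_compose:
  fixes F :: "real \<Rightarrow> real \<Rightarrow> real"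
  assumes "\<And>t d. t \<in> T \<Longrightarrow> d \<in> D \<Longrightarrow> F t d \<in> I"
  shows "Ck_param n {0} I (\<lambda>_. G) \<Longrightarrow> Ck_param n T D F \<Longrightarrow> Ck_param n T D (\<lambda>t d. G (F t d))"
proof (induction n arbitrary: G)
  case 0
  have "continuous_on I (\<lambda>x. (\<lambda>(d, _). G d) (x, 0::real))"
    by (rule continuous_on_compose2[of "I \<times> {0}" "\<lambda>(d, _). G d" I "\<lambda>x. (x, 0::real)"])
      (use 0 in \<open>auto intro!: continuous_intros\<close>)
  then have "continuous_on I G" by simp
  then have "continuous_on (D \<times> T) (\<lambda>p. G ((\<lambda>(d, t). F t d) p))"
    by (rule continuous_on_compose2) (use 0 assms in auto)
  then show ?case by (simp add: split_def)
next
  case (Suc n)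
  from Suc.prems obtain F' G' where F': "\<forall>t\<in>T. \<forall>d\<in>D. (F t has_vector_derivative F' t d) (at d)" "Ck_param n T D F'"
    "\<forall>d\<in>I. (G has_vector_derivative G' (0::real) d) (at d)" "Ck_param n {0} I G'"
    by auto
  \<comment> \<open>The derivative supplied by the definition may depend on the dummy argument; it
    is frozen at 0.\<close>
  have G0: "Ck_param n {0} I (\<lambda>_. G' 0)"
    using Ck_param_reparam[OF _ _ F'(4), of "{0}" "\<lambda>_. 0"] by simp
  show ?case
  proof (rule Ck_param_SucI[where F' = "\<lambda>t d. F' t d *\<^sub>R G' 0 (F t d)"])
    show "continuous_on (D \<times> T) (\<lambda>(d, t). G (F t d))"
      using Ck_param_cont[OF Suc.IH[OF Ck_param_Suc_imp[OF Suc.prems(1)] Ck_param_Suc_imp[OF Suc.prems(2)]]] .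
    show "((\<lambda>d. G (F t d)) has_vector_derivative F' t d *\<^sub>R G' 0 (F t d)) (at d)"
      if "t \<in> T" "d \<in> D" for t d
      using vector_diff_chain_at[of "F t" "F' t d" d G "G' 0 (F t d)"] F' that assms
      by (auto simp: o_def)
    show "Ck_param n T D (\<lambda>t d. F' t d *\<^sub>R G' 0 (F t d))"
      by (rule Ck_param_scaleR[OF F'(2) Suc.IH[OF G0 Ck_param_Suc_imp[OF Suc.prems(2)]]])
  qed
qed

text \<open>The tube lemma: compactness of \<open>T\<close> turns joint continuity into continuity
  in \<open>d\<close> that is uniform over \<open>t\<close>.\<close>

lemma Ck_param_uniform:
  assumes "compact T" "open D" "d \<in> D" "Ck_param n T D F" "e > 0"
  obtains r where "r > 0" "\<And>d'. \<bar>d' - d\<bar> < r \<Longrightarrow> d' \<in> D"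
    "\<And>t d'. t \<in> T \<Longrightarrow> \<bar>d' - d\<bar> < r \<Longrightarrow> norm (F t d' - F t d) \<le> e"
proof -
  obtain X where X: "d \<in> X" "open X"
    "\<forall>x\<in>X \<inter> D. \<forall>t\<in>T. dist ((\<lambda>(d, t). F t d) (x, t)) ((\<lambda>(d, t). F t d) (d, t)) \<le> e"
    by (rule continuous_on_prod_compactE[OF Ck_param_cont[OF assms(4)] assms(1,3,5)])
  have "open (X \<inter> D)" "d \<in> X \<inter> D" using X assms by auto
  then obtain r where "r > 0" "\<forall>y. dist y d < r \<longrightarrow> y \<in> X \<inter> D"
    unfolding open_dist by blast
  then show ?thesis using X by (intro that[of r]) (auto simp: dist_norm)
qed

text \<open>Mean value inequality on the segment from \<open>d\<close> to \<open>d'\<close>, with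
  the preceding uniform continuity applied to \<open>F'\<close>.\<close>

lemma Ck_param_uniform_diff:
  assumes "compact T" "open D" "d \<in> D" "Ck_param n T D F'" "e > 0"
    and "\<And>t d. t \<in> T \<Longrightarrow> d \<in> D \<Longrightarrow> (F t has_vector_derivative F' t d) (at d)"
  obtains r where "r > 0" "\<And>d'. \<bar>d' - d\<bar> < r \<Longrightarrow> d' \<in> D"
    "\<And>t d'. t \<in> T \<Longrightarrow> \<bar>d' - d\<bar> < r \<Longrightarrow> norm (F t d' - F t d - (d' - d) *\<^sub>R F' t d) \<le> e * \<bar>d' - d\<bar>"
proof -
  obtain r where r: "r > 0" "\<And>d'. \<bar>d' - d\<bar> < r \<Longrightarrow> d' \<in> D"
    "\<And>t d'. t \<in> T \<Longrightarrow> \<bar>d' - d\<bar> < r \<Longrightarrow> norm (F' t d' - F' t d) \<le> e"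
    using Ck_param_uniform[OF assms(1-5)] by blast
  show ?thesis
  proof (rule that[OF r(1,2)])
    fix t d' assume t: "t \<in> T" and d': "\<bar>d' - d\<bar> < r"
    have "norm (F t d' - F t d - (d' - d) *\<^sub>R F' t d) \<le> norm (d' - d) * e"
    proof (rule vector_differentiable_bound_linearization[where S = "ball d r" and f' = "F' t"])
      show "closed_segment d d' \<subseteq> ball d r"
        using d' r(1) by (intro closed_segment_subset) (auto simp: dist_real_def)
      show "(F t has_vector_derivative F' t x) (at x within ball d r)" if "x \<in> ball d r" for x
        using that r(2)[of x] assms(6)[OF t, of x]
        by (auto simp: dist_real_def abs_minus_commute intro: has_vector_derivative_at_within)
      show "norm (F' t x - F' t d) \<le> e" if "x \<in> ball d r" for x
        using that r(3)[OF t, of x] by (auto simp: dist_real_def abs_minus_commute)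
    qed (use r in auto)
    then show "norm (F t d' - F t d - (d' - d) *\<^sub>R F' t d) \<le> e * \<bar>d' - d\<bar>" by (simp add: mult.commute)
  qed auto
qed

lemma Ck_param_bounded:
  assumes "compact T" "d \<in> D" "Ck_param n T D F"
  obtains M where "M > 0" "\<And>t. t \<in> T \<Longrightarrow> norm (F t d) \<le> M"
proof -
  have "continuous_on T (\<lambda>t. (\<lambda>(d, t). F t d) (d, t))"
    by (rule continuous_on_compose2[OF Ck_param_cont[OF assms(3)]]) (use assms in \<open>auto intro!: continuous_intros\<close>)
  then have "bounded ((\<lambda>t. F t d) ` T)"
    using assms(1) by (auto intro: compact_imp_bounded compact_continuous_image)
  then show ?thesis using that by (auto simp: bounded_pos)
qed

lemma Ck_param_cont_fst:
  assumes "Ck_param n T D F" "d \<in> D"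
  shows "continuous_on T (\<lambda>t. F t d)"
proof -
  have "continuous_on T (\<lambda>t. (\<lambda>(d, t). F t d) (d, t))"
    by (rule continuous_on_compose2[OF Ck_param_cont[OF assms(1)]]) (use assms in \<open>auto intro!: continuous_intros\<close>)
  then show ?thesis by simp
qed

text \<open>Formal differentiation in \<open>d\<close> gives \<open>Z' = B Z + (B' Y + F')\<close>,
  a system of the same kind with one order of smoothness less; this is why an inhomogeneity
  \<open>F\<close> is carried along and why induction on \<open>n\<close> works. \<open>Z\<close> is
  constructed as the solution of that system and then identified with the derivative by Gronwall.
  The point \<open>z\<close> admits solutions known to satisfy the equation only off a
  layer.\<close>

theorem Ck_param_linear_ode:
  fixes Y :: "real \<Rightarrow> real \<Rightarrow> 'a::{real_inner, banach}"
  assumes ab: "a \<le> b" and D: "open D" and B: "Ck_param n {a..b} D B"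
  shows "Ck_param n {a..b} D F \<Longrightarrow> Ck_param n {b} D Y
    \<Longrightarrow> (\<And>d. d \<in> D \<Longrightarrow> continuous_on {a..b} (\<lambda>t. Y t d))
    \<Longrightarrow> (\<And>t d. t \<in> {a<..<b} - {z} \<Longrightarrow> d \<in> D \<Longrightarrow>
          ((\<lambda>t. Y t d) has_vector_derivative blinfun_apply (B t d) (Y t d) + F t d) (at t))
    \<Longrightarrow> Ck_param n {a..b} D Y"
  using B
proof (induction n arbitrary: F Y)
  have T: "compact {a..b}" "compact {b}" by auto
  \<comment> \<open>The difference of the solutions for \<open>d'\<close> and \<open>d\<close>
    solves a linear system whose inhomogeneity and data are small uniformly in
    \<open>t\<close>.\<close>
  have equi: "\<exists>r>0. \<forall>d'. \<bar>d' - d\<bar> < r \<longrightarrow> d' \<in> D \<and> (\<forall>t\<in>{a..b}. norm (Y t d' - Y t d) \<le> e)"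
    if F: "Ck_param m {a..b} D F" and Y0: "Ck_param m {b} D Y" and B: "Ck_param m {a..b} D B"
    and cY: "\<And>d. d \<in> D \<Longrightarrow> continuous_on {a..b} (\<lambda>t. Y t d)"
    and dY: "\<And>t d. t \<in> {a<..<b} - {z} \<Longrightarrow> d \<in> D \<Longrightarrow>
          ((\<lambda>t. Y t d) has_vector_derivative blinfun_apply (B t d) (Y t d) + F t d) (at t)"
    and d: "d \<in> D" and e: "e > 0"
    for m d e and F Y :: "real \<Rightarrow> real \<Rightarrow> 'a"
  proof -
    obtain C where C: "C > 0" "\<And>t. t \<in> {a..b} \<Longrightarrow> norm (B t d) \<le> C"
      using Ck_param_bounded[OF T(1) d B] by metis
    obtain M where M: "M > 0" "\<And>t. t \<in> {a..b} \<Longrightarrow> norm (Y t d) \<le> M"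
    proof -
      have "bounded ((\<lambda>t. Y t d) ` {a..b})"
        using cY[OF d] by (auto intro: compact_imp_bounded compact_continuous_image)
      then show ?thesis using that by (auto simp: bounded_pos)
    qed
    define K where "K = 4 * exp (2 * (C + 1 + 1) * (b - a))"
    have K: "K > 0" by (simp add: K_def)
    \<comment> \<open>\<open>M + 2\<close> collects the error in the data, the error in
      \<open>B\<close> acting on \<open>Y\<close>, and the error in \<open>F\<close>; the cap 1
      keeps \<open>norm (B x d')\<close> below \<open>C + 1\<close>.\<close>
    define e1 where "e1 = min 1 (e / (K * (M + 2)))"
    have e1: "e1 > 0" "e1 \<le> 1" "K * (e1 + (e1 * M + e1)) \<le> e"
    proof -
      have "0 < K * (M + 2)" using K M by simp
      then show "e1 > 0" "e1 \<le> 1" using e by (auto simp: e1_def)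
      have "e1 * (K * (M + 2)) \<le> e / (K * (M + 2)) * (K * (M + 2))"
        using \<open>0 < K * (M + 2)\<close> by (intro mult_right_mono) (auto simp: e1_def)
      also have "\<dots> = e" using \<open>0 < K * (M + 2)\<close> by (intro nonzero_eq_divide_eq[THEN iffD1, OF _ refl] less_imp_neq[THEN not_sym])
      finally show "K * (e1 + (e1 * M + e1)) \<le> e" by (simp add: algebra_simps)
    qed
    obtain r1 where r1: "r1 > 0" "\<And>d'. \<bar>d' - d\<bar> < r1 \<Longrightarrow> d' \<in> D"
      "\<And>t d'. t \<in> {a..b} \<Longrightarrow> \<bar>d' - d\<bar> < r1 \<Longrightarrow> norm (B t d' - B t d) \<le> e1"
      by (rule Ck_param_uniform[OF T(1) D d B e1(1)], rule that)
    obtain r2 where r2: "r2 > 0" "\<And>d'. \<bar>d' - d\<bar> < r2 \<Longrightarrow> d' \<in> D"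
      "\<And>t d'. t \<in> {a..b} \<Longrightarrow> \<bar>d' - d\<bar> < r2 \<Longrightarrow> norm (F t d' - F t d) \<le> e1"
      by (rule Ck_param_uniform[OF T(1) D d F e1(1)], rule that)
    obtain r3 where r3: "r3 > 0"
      "\<And>d'. \<bar>d' - d\<bar> < r3 \<Longrightarrow> d' \<in> D"
      "\<And>t d'. t \<in> {b} \<Longrightarrow> \<bar>d' - d\<bar> < r3 \<Longrightarrow> norm (Y t d' - Y t d) \<le> e1"
      by (rule Ck_param_uniform[OF T(2) D d Y0 e1(1)], rule that)
    show ?thesis
    proof (intro exI[of _ "min r1 (min r2 r3)"] conjI allI impI ballI)
      fix d' assume d': "\<bar>d' - d\<bar> < min r1 (min r2 r3)"
      show D': "d' \<in> D" using d' r1 by auto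
      fix t assume t: "t \<in> {a..b}"
      have "norm ((\<lambda>t. Y t d' - Y t d) t) \<le>
          4 * exp (2 * (C + 1 + 1) * (b - a)) * (norm ((\<lambda>t. Y t d' - Y t d) b) + (e1 * M + e1))"
      proof (rule gronwall[OF _ t, where z = z])
        fix x assume x: "x \<in> {a<..<b} - {z}"
        then have x': "x \<in> {a..b}" by auto
        show "((\<lambda>t. Y t d' - Y t d) has_vector_derivative
            (B x d' (Y x d') + F x d') - (B x d (Y x d) + F x d)) (at x)"
          by (intro has_vector_derivative_diff dY x d D')
        have eq: "(B x d' (Y x d') + F x d') - (B x d (Y x d) + F x d) =
            B x d' (Y x d' - Y x d) + ((B x d' - B x d) (Y x d) + (F x d' - F x d))"
          by (simp add: blinfun.diff_left blinfun.diff_right)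
        have nB: "norm (B x d') \<le> C + 1"
          using C(2)[OF x'] r1(3)[OF x', of d'] d' e1 norm_triangle_ineq2[of "B x d'" "B x d"] by simp
        have "norm (B x d' (Y x d' - Y x d)) \<le> (C + 1) * norm (Y x d' - Y x d)"
          by (rule order_trans[OF norm_blinfun mult_right_mono[OF nB]]) simp
        moreover have "norm ((B x d' - B x d) (Y x d)) \<le> e1 * M"
          by (rule order_trans[OF norm_blinfun mult_mono])
            (use r1(3)[OF x', of d'] d' M(2)[OF x'] e1 in auto)
        moreover have "norm (F x d' - F x d) \<le> e1" using r2(3)[OF x', of d'] d' by simp
        ultimately show "norm ((B x d' (Y x d') + F x d') - (B x d (Y x d) + F x d))
            \<le> (C + 1) * norm (Y x d' - Y x d) + (e1 * M + e1)"
          unfolding eq by (intro order_trans[OF norm_triangle_ineq] add_mono) auto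
      qed (use C M e1 in \<open>auto intro!: continuous_intros cY d D'\<close>)
      also have "\<dots> \<le> K * (e1 + (e1 * M + e1))"
        unfolding K_def using r3(3)[of b d'] d' by (intro mult_left_mono add_right_mono) auto
      finally show "norm (Y t d' - Y t d) \<le> e" using e1(3) by simp
    qed (use r1 r2 r3 in auto)
  qed
  have cont: "continuous_on (D \<times> {a..b}) (\<lambda>(d, t). Y t d)"
    if F: "Ck_param m {a..b} D F" and Y0: "Ck_param m {b} D Y" and B: "Ck_param m {a..b} D B"
    and cY: "\<And>d. d \<in> D \<Longrightarrow> continuous_on {a..b} (\<lambda>t. Y t d)"
    and dY: "\<And>t d. t \<in> {a<..<b} - {z} \<Longrightarrow> d \<in> D \<Longrightarrow>
          ((\<lambda>t. Y t d) has_vector_derivative blinfun_apply (B t d) (Y t d) + F t d) (at t)"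
    for m and F Y :: "real \<Rightarrow> real \<Rightarrow> 'a"
    unfolding continuous_on_iff
  proof (intro ballI allI impI)
    fix p and e :: real assume p: "p \<in> D \<times> {a..b}" and e: "e > 0"
    obtain d t where dt: "p = (d, t)" by (cases p)
    have "e/3 > 0" using e by simp
    then obtain r where r: "r > 0" "\<And>d' t. \<bar>d' - d\<bar> < r \<Longrightarrow> t \<in> {a..b} \<Longrightarrow> norm (Y t d' - Y t d) \<le> e/3"
      using equi[OF F Y0 B cY dY, of d "e/3"] p dt by blast
    obtain r' where r': "r' > 0" "\<And>t'. t' \<in> {a..b} \<Longrightarrow> dist t' t < r' \<Longrightarrow> dist (Y t' d) (Y t d) < e/3"
      using cY[of d] p dt \<open>e/3 > 0\<close> unfolding continuous_on_iff by (metis SigmaE2)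
    show "\<exists>s>0. \<forall>p'\<in>D \<times> {a..b}. dist p' p < s \<longrightarrow>
        dist (case p' of (d, t) \<Rightarrow> Y t d) (case p of (d, t) \<Rightarrow> Y t d) < e"
    proof (intro exI[of _ "min r r'"] conjI ballI impI)
      fix p' assume p': "p' \<in> D \<times> {a..b}" "dist p' p < min r r'"
      obtain d' t' where dt': "p' = (d', t')" by (cases p')
      have "dist d' d < r" "dist t' t < r'"
        using p'(2) dist_fst_le[of p' p] dist_snd_le[of p' p] by (auto simp: dt dt')
      then have "norm (Y t' d' - Y t' d) \<le> e/3" "dist (Y t' d) (Y t d) < e/3"
        using r(2)[of d' t'] r'(2)[of t'] p' by (auto simp: dt' dist_real_def)
      then show "dist (case p' of (d, t) \<Rightarrow> Y t d) (case p of (d, t) \<Rightarrow> Y t d) < e"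
        using dist_triangle[of "Y t' d'" "Y t d" "Y t' d"] e by (simp add: dt dt' dist_norm)
    qed (use r r' in auto)
  qed
  {
    case 0
    then show ?case unfolding Ck_param.simps(1) by (intro cont[of 0 F Y]) simp_all
  next
    case (Suc n)
    from Suc.prems(1) obtain F' where F': "Ck_param n {a..b} D F'"
      "\<And>t d. t \<in> {a..b} \<Longrightarrow> d \<in> D \<Longrightarrow> (F t has_vector_derivative F' t d) (at d)" by auto
    from Suc.prems(5) obtain B' where B': "Ck_param n {a..b} D B'"
      "\<And>t d. t \<in> {a..b} \<Longrightarrow> d \<in> D \<Longrightarrow> (B t has_vector_derivative B' t d) (at d)" by auto
    from Suc.prems(2) obtain Z0 where Z0: "Ck_param n {b} D Z0"
      "\<And>d. d \<in> D \<Longrightarrow> (Y b has_vector_derivative Z0 b d) (at d)" by auto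
    note low = Ck_param_Suc_imp[OF Suc.prems(1)] Ck_param_Suc_imp[OF Suc.prems(2)] Ck_param_Suc_imp[OF Suc.prems(5)]
    have Yn: "Ck_param n {a..b} D Y"
      by (rule Suc.IH[of F Y]) (fact low Suc.prems)+
    \<comment> \<open>The inhomogeneity of the differentiated equation; it has order
      \<open>n\<close> because \<open>Y\<close> already has, by the induction hypothesis.\<close>
    define G where "G t d = B' t d (Y t d) + F' t d" for t d
    have G: "Ck_param n {a..b} D G"
      unfolding G_def by (rule Ck_param_add[OF Ck_param_blinfun[OF B'(1) Yn] F'(1)])
    define ZP where "ZP d Z \<longleftrightarrow> Z b = Z0 b d \<and>
      (\<forall>t\<in>{a..b}. (Z has_vector_derivative B t d (Z t) + G t d) (at t within {a..b}))" for d Z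
    have ex: "\<exists>Z. ZP d Z" if d: "d \<in> D" for d
    proof (rule linear_ode_exists[OF ab Ck_param_cont_fst[OF low(3) d] Ck_param_cont_fst[OF G d], of "Z0 b d"])
      fix Z assume "Z b = Z0 b d"
        "\<And>x. x \<in> {a..b} \<Longrightarrow> (Z has_vector_derivative B x d (Z x) + G x d) (at x within {a..b})"
      then show ?thesis unfolding ZP_def by (intro exI[of _ Z] conjI ballI)
    qed
    define Zd where "Zd d = (SOME Z. ZP d Z)" for d
    have ZP: "ZP d (Zd d)" if "d \<in> D" for d
      unfolding Zd_def by (rule someI_ex[OF ex[OF that]])
    have Zd: "\<And>d. d \<in> D \<Longrightarrow> Zd d b = Z0 b d"
      "\<And>d t. d \<in> D \<Longrightarrow> t \<in> {a..b} \<Longrightarrow> (Zd d has_vector_derivative blinfun_apply (B t d) (Zd d t) + G t d) (at t within {a..b})"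
      using ZP unfolding ZP_def by blast+
    define Z where "Z t d = Zd d t" for t d
    have cZ: "continuous_on {a..b} (\<lambda>t. Z t d)" if "d \<in> D" for d
      unfolding Z_def by (rule continuous_on_vector_derivative[OF Zd(2)[OF that]])
    have dZ: "((\<lambda>t. Z t d) has_vector_derivative B t d (Z t d) + G t d) (at t)"
      if "t \<in> {a<..<b} - {z}" "d \<in> D" for t d
      using Zd(2)[of d t] that at_within_interior[of t "{a..b}"] by (auto simp: Z_def)
    have Zb: "Ck_param n {b} D Z"
      by (rule Ck_param_cong[OF D _ Z0(1)]) (auto simp: Z_def Zd)
    have Zn: "Ck_param n {a..b} D Z"
      by (rule Suc.IH[of G Z]) (fact G Zb cZ dZ low)+
    show ?case
    proof (rule Ck_param_SucI[OF _ _ Zn])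
      show "continuous_on (D \<times> {a..b}) (\<lambda>(d, t). Y t d)" by (rule Ck_param_cont[OF Yn])
      fix t d assume t: "t \<in> {a..b}" and d: "d \<in> D"
      obtain C where C: "C > 0" "\<And>t. t \<in> {a..b} \<Longrightarrow> norm (B t d) \<le> C"
        using Ck_param_bounded[OF T(1) d low(3)] by metis
      obtain M where M: "M > 0" "\<And>t. t \<in> {a..b} \<Longrightarrow> norm (Y t d) \<le> M"
        using Ck_param_bounded[OF T(1) d Yn] by metis
      obtain M1 where M1: "M1 > 0" "\<And>t. t \<in> {a..b} \<Longrightarrow> norm (B' t d) \<le> M1"
        using Ck_param_bounded[OF T(1) d B'(1)] by metis
      define K where "K = 4 * exp (2 * (C + 1) * (b - a))"
      have K: "K > 0" by (simp add: K_def)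
      have "\<exists>r>0. \<forall>d'. norm (d' - d) < r \<longrightarrow> norm (Y t d' - Y t d - (d' - d) *\<^sub>R Z t d) \<le> e * norm (d' - d)"
        if e: "e > 0" for e
      proof -
        \<comment> \<open>In \<open>M + M1 + 3\<close>, the part \<open>M + 1\<close> comes from the
          linearisation error of \<open>B\<close> acting on \<open>Y\<close> at \<open>d'\<close>,
          \<open>M1\<close> from \<open>B'\<close> acting on the change of \<open>Y\<close>, and 1
          each from \<open>F\<close> and from the data.\<close>
        define e1 where "e1 = min 1 (e / (K * (M + M1 + 3)))"
        have KM: "0 < K * (M + M1 + 3)" using K M M1 by simp
        have e1: "e1 > 0" "e1 \<le> 1" using KM e by (auto simp: e1_def)
        have e1K: "K * (e1 * (M + M1 + 3)) \<le> e"
        proof -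
          have "e1 * (K * (M + M1 + 3)) \<le> e / (K * (M + M1 + 3)) * (K * (M + M1 + 3))"
            using KM by (intro mult_right_mono) (auto simp: e1_def)
          also have "\<dots> = e" using KM by (intro nonzero_eq_divide_eq[THEN iffD1, OF _ refl] less_imp_neq[THEN not_sym])
          finally show ?thesis by (simp add: mult_ac)
        qed
        obtain r1 where r1: "r1 > 0" "\<And>d'. \<bar>d' - d\<bar> < r1 \<Longrightarrow> d' \<in> D" "\<And>t d'. t \<in> {a..b} \<Longrightarrow> \<bar>d' - d\<bar> < r1 \<Longrightarrow>
            norm (B t d' - B t d - (d' - d) *\<^sub>R B' t d) \<le> e1 * \<bar>d' - d\<bar>"
          by (rule Ck_param_uniform_diff[where F = B, OF T(1) D d B'(1) e1(1)], erule B'(2), assumption, rule that)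
        obtain r2 where r2: "r2 > 0" "\<And>d'. \<bar>d' - d\<bar> < r2 \<Longrightarrow> d' \<in> D" "\<And>t d'. t \<in> {a..b} \<Longrightarrow> \<bar>d' - d\<bar> < r2 \<Longrightarrow>
            norm (F t d' - F t d - (d' - d) *\<^sub>R F' t d) \<le> e1 * \<bar>d' - d\<bar>"
          by (rule Ck_param_uniform_diff[where F = F, OF T(1) D d F'(1) e1(1)], erule F'(2), assumption, rule that)
        obtain r3 where r3: "r3 > 0" "\<And>d'. \<bar>d' - d\<bar> < r3 \<Longrightarrow> d' \<in> D" "\<And>t d'. t \<in> {b} \<Longrightarrow> \<bar>d' - d\<bar> < r3 \<Longrightarrow>
            norm (Y t d' - Y t d - (d' - d) *\<^sub>R Z0 t d) \<le> e1 * \<bar>d' - d\<bar>"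
          by (rule Ck_param_uniform_diff[where F = Y, OF T(2) D d Z0(1) e1(1)], (use Z0(2) in auto)[1], rule that)
        obtain r4 where r4: "r4 > 0" "\<And>d'. \<bar>d' - d\<bar> < r4 \<Longrightarrow> d' \<in> D" "\<And>t d'. t \<in> {a..b} \<Longrightarrow> \<bar>d' - d\<bar> < r4 \<Longrightarrow> norm (Y t d' - Y t d) \<le> e1"
          by (rule Ck_param_uniform[OF T(1) D d Yn e1(1)], rule that)
        show ?thesis
        proof (intro exI[of _ "min (min r1 r2) (min r3 r4)"] conjI allI impI)
          fix d' assume d': "norm (d' - d) < min (min r1 r2) (min r3 r4)"
          then have D': "d' \<in> D" using r1 by auto
          define E where "E t = Y t d' - Y t d - (d' - d) *\<^sub>R Z t d" for t
          have "norm (E t) \<le> 4 * exp (2 * (C + 1) * (b - a)) * (norm (E b) + e1 * (M + M1 + 2) * \<bar>d' - d\<bar>)"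
          proof (rule gronwall[OF _ t, where z = z])
            show "continuous_on {a..b} E"
              unfolding E_def by (intro continuous_intros Suc.prems(3) cZ d D')
            fix x assume x: "x \<in> {a<..<b} - {z}"
            then have x': "x \<in> {a..b}" by auto
            show "(E has_vector_derivative (B x d' (Y x d') + F x d') - (B x d (Y x d) + F x d)
                - (d' - d) *\<^sub>R (B x d (Z x d) + G x d)) (at x)"
              unfolding E_def
              by (intro has_vector_derivative_diff Suc.prems(4) x d D' dZ
                  bounded_linear.has_vector_derivative[OF bounded_linear_scaleR_right])
            have eq: "(B x d' (Y x d') + F x d') - (B x d (Y x d) + F x d)
                - (d' - d) *\<^sub>R (B x d (Z x d) + G x d) =
                B x d (E x) + ((B x d' - B x d - (d' - d) *\<^sub>R B' x d) (Y x d')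
                + ((d' - d) *\<^sub>R B' x d (Y x d' - Y x d) + (F x d' - F x d - (d' - d) *\<^sub>R F' x d)))"
              by (simp add: E_def G_def blinfun.diff_left blinfun.diff_right blinfun.add_left
                  blinfun.add_right blinfun.scaleR_left blinfun.scaleR_right algebra_simps)
            have 1: "norm (B x d (E x)) \<le> C * norm (E x)"
              by (rule order_trans[OF norm_blinfun mult_right_mono[OF C(2)[OF x']]]) simp
            have nY: "norm (Y x d') \<le> M + 1"
              using M(2)[OF x'] r4(3)[OF x', of d'] d' e1 norm_triangle_ineq2[of "Y x d'" "Y x d"] by simp
            have 2: "norm ((B x d' - B x d - (d' - d) *\<^sub>R B' x d) (Y x d')) \<le> (e1 * \<bar>d' - d\<bar>) * (M + 1)"
              by (rule order_trans[OF norm_blinfun mult_mono]) (use r1(3)[OF x', of d'] d' nY e1 in auto)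
            have 3: "norm ((d' - d) *\<^sub>R B' x d (Y x d' - Y x d)) \<le> \<bar>d' - d\<bar> * (M1 * e1)"
              unfolding norm_scaleR real_norm_def
              by (intro mult_left_mono order_trans[OF norm_blinfun mult_mono])
                (use M1(2)[OF x'] M1(1) r4(3)[OF x', of d'] d' in auto)
            have 4: "norm (F x d' - F x d - (d' - d) *\<^sub>R F' x d) \<le> e1 * \<bar>d' - d\<bar>"
              using r2(3)[OF x', of d'] d' by simp
            have "norm ((B x d' (Y x d') + F x d') - (B x d (Y x d) + F x d)
                - (d' - d) *\<^sub>R (B x d (Z x d) + G x d))
                \<le> C * norm (E x) + ((e1 * \<bar>d' - d\<bar>) * (M + 1) + (\<bar>d' - d\<bar> * (M1 * e1) + e1 * \<bar>d' - d\<bar>))"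
              unfolding eq by (intro order_trans[OF norm_triangle_ineq] add_mono 1 2 3 4)
            also have "\<dots> = C * norm (E x) + e1 * (M + M1 + 2) * \<bar>d' - d\<bar>" by (simp add: algebra_simps)
            finally show "norm ((B x d' (Y x d') + F x d') - (B x d (Y x d) + F x d)
                - (d' - d) *\<^sub>R (B x d (Z x d) + G x d)) \<le> C * norm (E x) + e1 * (M + M1 + 2) * \<bar>d' - d\<bar>" .
          qed (use C M M1 e1 in auto)
          also have "\<dots> \<le> K * (e1 * \<bar>d' - d\<bar> + e1 * (M + M1 + 2) * \<bar>d' - d\<bar>)"
            unfolding K_def using r3(3)[of b d'] d' Zd(1)[OF d]
            by (intro mult_left_mono add_right_mono) (auto simp: E_def Z_def)
          also have "\<dots> = (K * (e1 * (M + M1 + 3))) * \<bar>d' - d\<bar>" by (simp add: algebra_simps)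
          also have "\<dots> \<le> e * \<bar>d' - d\<bar>" by (intro mult_right_mono e1K) simp
          finally show "norm (Y t d' - Y t d - (d' - d) *\<^sub>R Z t d) \<le> e * norm (d' - d)"
            by (simp add: E_def)
        qed (use r1 r2 r3 r4 in auto)
      qed
      then show "(Y t has_vector_derivative Z t d) (at d)"
        unfolding has_vector_derivative_def has_derivative_within_alt by (auto intro: bounded_linear_scaleR_left)
    qed
  }
qed

text \<open>The derivative is minus the square of the function itself, so the induction
  closes.\<close>

lemma Ck_param_inverse_fun: "Ck_param n {0} {x. x \<noteq> 0} (\<lambda>_ x. inverse x :: real)"
proof (induction n)
  case 0
  show ?case by (auto simp: split_def intro!: continuous_intros)
next
  case (Suc n)
  show ?case
  proof (rule Ck_param_SucI[where F' = "\<lambda>_ x. - (inverse x ^ 2)"])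
    show "(inverse has_vector_derivative - ((inverse d)\<^sup>2)) (at d)" if "d \<in> {x. x \<noteq> (0::real)}" for d
      using that unfolding has_real_derivative_iff_has_vector_derivative[symmetric]
      by (auto intro!: derivative_eq_intros simp: power2_eq_square)
    show "Ck_param n {0} {x. x \<noteq> 0} (\<lambda>_ x. - ((inverse x :: real)\<^sup>2))"
      by (rule Ck_param_minus[OF Ck_param_power[OF Suc.IH]])
  qed (auto simp: split_def intro!: continuous_intros)
qed

lemma Ck_param_inverse:
  fixes F :: "real \<Rightarrow> real \<Rightarrow> real"
  assumes "Ck_param n T D F" "\<And>t d. t \<in> T \<Longrightarrow> d \<in> D \<Longrightarrow> F t d \<noteq> 0"
  shows "Ck_param n T D (\<lambda>t d. inverse (F t d))"
  by (rule Ck_param_compose[OF _ Ck_param_inverse_fun assms(1)]) (use assms(2) in auto)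

lemma Ck_param_divide:
  fixes F G :: "real \<Rightarrow> real \<Rightarrow> real"
  assumes "Ck_param n T D F" "Ck_param n T D G" "\<And>t d. t \<in> T \<Longrightarrow> d \<in> D \<Longrightarrow> G t d \<noteq> 0"
  shows "Ck_param n T D (\<lambda>t d. F t d / G t d)"
  unfolding divide_inverse by (rule Ck_param_mult[OF assms(1) Ck_param_inverse[OF assms(2,3)]])

lemma Ck_param_ln:
  fixes F :: "real \<Rightarrow> real \<Rightarrow> real"
  assumes "Ck_param n T D F" "\<And>t d. t \<in> T \<Longrightarrow> d \<in> D \<Longrightarrow> F t d > 0"
  shows "Ck_param n T D (\<lambda>t d. ln (F t d))"
proof (rule Ck_param_compose[OF _ _ assms(1), where I = "{0<..}"])
  show "Ck_param n {0} {0<..} (\<lambda>_. ln :: real \<Rightarrow> real)"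
  proof (cases n)
    case 0
    then show ?thesis by (auto simp: split_def intro!: continuous_intros)
  next
    case (Suc m)
    show ?thesis unfolding Suc
    proof (rule Ck_param_SucI[where F' = "\<lambda>_. inverse"])
      show "(ln has_vector_derivative inverse d) (at d)" if "d \<in> {0<..}" for d :: real
        using that unfolding has_real_derivative_iff_has_vector_derivative[symmetric]
        by (auto intro!: derivative_eq_intros simp: inverse_eq_divide)
      show "Ck_param m {0} {0<..} (\<lambda>_. inverse :: real \<Rightarrow> real)"
        by (rule Ck_param_subset[OF Ck_param_inverse_fun]) auto
    qed (auto simp: split_def intro!: continuous_intros)
  qed
qed (use assms(2) in auto)

section \<open>The regularised Rayleigh system\<close>

definition inl_blinfun :: "'a::real_normed_vector \<Rightarrow>\<^sub>L ('a \<times> 'b::real_normed_vector)" where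
  "inl_blinfun = Blinfun (\<lambda>x. (x, 0))"

definition inr_blinfun :: "'b::real_normed_vector \<Rightarrow>\<^sub>L ('a::real_normed_vector \<times> 'b)" where
  "inr_blinfun = Blinfun (\<lambda>x. (0, x))"

lemma inl_blinfun_apply: "blinfun_apply inl_blinfun x = (x, 0)"
  unfolding inl_blinfun_def
  by (subst bounded_linear_Blinfun_apply)
    (auto intro: bounded_linear_Pair bounded_linear_ident bounded_linear_zero)

lemma inr_blinfun_apply: "blinfun_apply inr_blinfun x = (0, x)"
  unfolding inr_blinfun_def
  by (subst bounded_linear_Blinfun_apply)
    (auto intro: bounded_linear_Pair bounded_linear_ident bounded_linear_zero)

text \<open>Assembled from compositions of bounded linear maps, so that smoothness of a family of
  matrices follows from the bilinear rules entry by entry.\<close>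

definition mat2 :: "complex \<Rightarrow> complex \<Rightarrow> complex \<Rightarrow> complex \<Rightarrow> (complex \<times> complex) \<Rightarrow>\<^sub>L (complex \<times> complex)" where
  "mat2 a b c d =
     (inl_blinfun o\<^sub>L ((blinfun_mult_right a o\<^sub>L fst_blinfun) + (blinfun_mult_right b o\<^sub>L snd_blinfun)))
     + (inr_blinfun o\<^sub>L ((blinfun_mult_right c o\<^sub>L fst_blinfun) + (blinfun_mult_right d o\<^sub>L snd_blinfun)))"

lemma mat2_apply [simp]: "blinfun_apply (mat2 a b c d) p = (a * fst p + b * snd p, c * fst p + d * snd p)"
  by (simp add: mat2_def blinfun.add_left inl_blinfun_apply inr_blinfun_apply)

lemma mat2_diff: "mat2 a b c d - mat2 a' b' c' d' = mat2 (a - a') (b - b') (c - c') (d - d')"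
  by (rule blinfun_eqI) (simp add: blinfun.diff_left algebra_simps)

lemma norm_mat2: "norm (mat2 a b c d) \<le> norm a + norm b + norm c + norm d"
proof (rule norm_blinfun_bound)
  fix p :: "complex \<times> complex"
  have "norm (mat2 a b c d p) \<le> norm (a * fst p + b * snd p) + norm (c * fst p + d * snd p)"
    by (simp add: norm_Pair_le)
  also have "\<dots> \<le> (norm a * norm (fst p) + norm b * norm (snd p)) + (norm c * norm (fst p) + norm d * norm (snd p))"
    by (intro add_mono order_trans[OF norm_triangle_ineq]) (auto simp: norm_mult)
  also have "\<dots> \<le> (norm a * norm p + norm b * norm p) + (norm c * norm p + norm d * norm p)"
    by (intro add_mono mult_left_mono norm_fst_le norm_snd_le) (metis norm_fst_le norm_snd_le norm_ge_zero prod.collapse)+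
  finally show "norm (mat2 a b c d p) \<le> (norm a + norm b + norm c + norm d) * norm p"
    by (simp add: algebra_simps)
qed auto

lemma Ck_param_mat2:
  assumes "Ck_param n T D a" "Ck_param n T D b" "Ck_param n T D c" "Ck_param n T D d"
  shows "Ck_param n T D (\<lambda>t x. mat2 (a t x) (b t x) (c t x) (d t x))"
proof -
  have comp: "Ck_param n T D (\<lambda>t x. blinfun_mult_right (f t x) o\<^sub>L P)"
    if "Ck_param n T D f" for f :: "real \<Rightarrow> real \<Rightarrow> complex" and P :: "(complex \<times> complex) \<Rightarrow>\<^sub>L complex"
    by (rule Ck_param_bilinear[OF bounded_bilinear_blinfun_compose
          Ck_param_linear[OF bounded_linear_blinfun_mult_right that] Ck_param_const])
  show ?thesis unfolding mat2_def
    by (rule Ck_param_add[OF Ck_param_bilinear[OF bounded_bilinear_blinfun_compose Ck_param_const Ck_param_add[OF comp[OF assms(1)] comp[OF assms(2)]]]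
        Ck_param_bilinear[OF bounded_bilinear_blinfun_compose Ck_param_const Ck_param_add[OF comp[OF assms(3)] comp[OF assms(4)]]]])
qed

section \<open>The profile, its derivatives and the regularised coefficients\<close>

locale profile =
  fixes h :: real and U :: "real \<Rightarrow> real" and l :: nat
  assumes h_pos: "0 < h" and l_ge: "4 \<le> l" and U_Cl: "Ck_on l {0..h} U"
begin

definition DU :: "nat \<Rightarrow> real \<Rightarrow> real" where
  "DU j = (deriv_within {0..h} ^^ j) U"

lemma DU_0 [simp]: "DU 0 = U" by (simp add: DU_def)

lemma DU_deriv_within:
  assumes "j < l" "x \<in> {0..h}"
  shows "(DU j has_real_derivative DU (Suc j) x) (at x within {0..h})"
proof -
  have "DU j differentiable (at x within {0..h})"
    using U_Cl assms by (auto simp: Ck_on_def DU_def)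
  then have "(DU j has_vector_derivative vector_derivative (DU j) (at x within {0..h})) (at x within {0..h})"
    by (simp only: vector_derivative_works)
  moreover have "DU (Suc j) x = vector_derivative (DU j) (at x within {0..h})"
    by (simp add: DU_def deriv_within_def)
  ultimately show ?thesis
    unfolding has_real_derivative_iff_has_vector_derivative by simp
qed

lemma DU_deriv:
  assumes "j < l" "x \<in> {0<..<h}"
  shows "(DU j has_real_derivative DU (Suc j) x) (at x)"
proof -
  have "x \<in> interior {0..h}" using assms(2) by simp
  then show ?thesis
    using DU_deriv_within[OF assms(1), of x] assms(2) at_within_interior[of x "{0..h}"] by simp
qed

lemma DU_cont: "j \<le> l \<Longrightarrow> continuous_on {0..h} (DU j)"
proof (cases "j = l")
  case True
  then show ?thesis using U_Cl by (auto simp: Ck_on_def DU_def)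
next
  case False
  assume "j \<le> l"
  then have "j < l" using False by simp
  then show ?thesis by (rule DERIV_continuous_on[where D = "DU (Suc j)", OF DU_deriv_within])
qed

lemma Ck_param_DU: "j + n \<le> l \<Longrightarrow> Ck_param n {0} {0<..<h} (\<lambda>_. DU j)"
proof (induction n arbitrary: j)
  case 0
  have "continuous_on {0<..<h} (DU j)"
    using DU_cont[of j] 0 by (auto intro: continuous_on_subset)
  then show ?case by (auto simp: split_def intro!: continuous_on_compose2[of "{0<..<h}" "DU j"] continuous_intros)
next
  case (Suc n)
  show ?case
  proof (rule Ck_param_SucI[where F' = "\<lambda>_. DU (Suc j)"])
    show "continuous_on ({0<..<h} \<times> {0::real}) (\<lambda>(d, t). DU j d)"
      using Ck_param_cont[OF Suc.IH[of j]] Suc.prems by simp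
    show "(DU j has_vector_derivative DU (Suc j) d) (at d)" if "d \<in> {0<..<h}" for d
      using DU_deriv[of j d] that Suc.prems by (simp add: has_real_derivative_iff_has_vector_derivative)
    show "Ck_param n {0} {0<..<h} (\<lambda>_. DU (Suc j))" using Suc.IH[of "Suc j"] Suc.prems by simp
  qed
qed

definition P0 :: "real \<Rightarrow> real" where "P0 x = DU 2 x / DU 1 x"

text \<open>The derivative of \<open>P0\<close>. It contains the third derivative of
  \<open>U\<close>, and so sets the order \<open>l - 3\<close> of smoothness in the speed.\<close>

definition P1 :: "real \<Rightarrow> real" where "P1 x = (DU 3 x * DU 1 x - (DU 2 x)\<^sup>2) / (DU 1 x)\<^sup>2"

lemma P0_deriv:
  assumes "x \<in> {0<..<h}" "DU 1 x \<noteq> 0"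
  shows "(P0 has_real_derivative P1 x) (at x)"
proof -
  have "DU 1 = DU (Suc 0)" "DU 2 = DU (Suc (Suc 0))" "DU 3 = DU (Suc (Suc (Suc 0)))"
    by (simp_all add: numeral_eq_Suc)
  then have "(DU 1 has_real_derivative DU 2 x) (at x)" "(DU 2 has_real_derivative DU 3 x) (at x)"
    using DU_deriv[of "Suc 0" x] DU_deriv[of "Suc (Suc 0)" x] l_ge assms by auto
  then show ?thesis
    unfolding P0_def[abs_def] P1_def
    using assms(2)
    by (auto intro!: derivative_eq_intros simp: power2_eq_square)
qed

text \<open>With \<open>v = y' - (U''/U') L y\<close>, where \<open>L\<close> is a branch of \<open>log (U - c)\<close>, the Rayleigh equation is
  a first-order system for \<open>(y, v)\<close> whose coefficients only have logarithmic singularities.\<close>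

definition sysmat :: "real \<Rightarrow> real \<Rightarrow> complex \<Rightarrow> (complex \<times> complex) \<Rightarrow>\<^sub>L (complex \<times> complex)" where
  "sysmat k x L = mat2 (of_real (P0 x) * L) 1
     (of_real (k\<^sup>2) - of_real (P1 x) * L - (of_real (P0 x) * L)\<^sup>2) (- (of_real (P0 x) * L))"

text \<open>The derivative of \<open>P0 L f\<close> contains \<open>P0 L' f\<close>, which is
  \<open>U''/(U - c) f\<close>, exactly the singular term of the equation. The two cancel in the
  equation for the second component, and only powers of \<open>L\<close> remain.\<close>

lemma sysmat_deriv:
  fixes f g L :: "real \<Rightarrow> complex"
  assumes x: "x \<in> {0<..<h}" "DU 1 x \<noteq> 0" "of_real (U x) \<noteq> c"
    and f: "(f has_vector_derivative g x) (at x within S)"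
    and g: "(g has_vector_derivative (of_real (DU 2 x) / (of_real (U x) - c) + of_real (k\<^sup>2)) * f x) (at x within S)"
    and L: "(L has_vector_derivative of_real (DU 1 x) / (of_real (U x) - c)) (at x within S)"
  shows "((\<lambda>x. (f x, g x - of_real (P0 x) * L x * f x)) has_vector_derivative
     sysmat k x (L x) (f x, g x - of_real (P0 x) * L x * f x)) (at x within S)"
proof -
  have P: "((\<lambda>x. complex_of_real (P0 x)) has_vector_derivative of_real (P1 x)) (at x within S)"
    by (rule has_vector_derivative_of_real[OF has_field_derivative_at_within[OF P0_deriv[OF x(1,2)]]])
  have "DU 2 x = P0 x * DU 1 x" using x by (simp add: P0_def)
  then have q: "of_real (DU 2 x) / (of_real (U x) - c) = of_real (P0 x) * (of_real (DU 1 x) / (of_real (U x) - c))"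
    by simp
  define W where "W = of_real (DU 1 x) / (of_real (U x) - c)"
  have "((\<lambda>x. g x - of_real (P0 x) * L x * f x) has_vector_derivative
     (of_real (P0 x) * W + of_real (k\<^sup>2)) * f x -
      (of_real (P0 x) * L x * g x + (of_real (P0 x) * W + of_real (P1 x) * L x) * f x)) (at x within S)"
    using has_vector_derivative_diff[OF g[unfolded q, folded W_def]
        has_vector_derivative_mult[OF has_vector_derivative_mult[OF P L[folded W_def]] f]] by simp
  then have "((\<lambda>x. g x - of_real (P0 x) * L x * f x) has_vector_derivative
     snd (sysmat k x (L x) (f x, g x - of_real (P0 x) * L x * f x))) (at x within S)"
    by (rule has_vector_derivative_eq_rhs) (simp add: sysmat_def algebra_simps power2_eq_square)
  moreover have "(f has_vector_derivative fst (sysmat k x (L x) (f x, g x - of_real (P0 x) * L x * f x))) (at x within S)"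
    using f by (simp add: sysmat_def)
  ultimately show ?thesis
    using has_vector_derivative_Pair by fastforce
qed

text \<open>The same cancellation read backwards, with \<open>g = v + P0 L f\<close>.\<close>

lemma sysmat_deriv_back:
  fixes f v L :: "real \<Rightarrow> complex"
  assumes x: "x \<in> {0<..<h}" "DU 1 x \<noteq> 0" "of_real (U x) \<noteq> c"
    and fv: "((\<lambda>x. (f x, v x)) has_vector_derivative sysmat k x (L x) (f x, v x)) (at x within S)"
    and L: "(L has_vector_derivative of_real (DU 1 x) / (of_real (U x) - c)) (at x within S)"
  shows "(f has_vector_derivative v x + of_real (P0 x) * L x * f x) (at x within S)"
    "((\<lambda>x. v x + of_real (P0 x) * L x * f x) has_vector_derivative
       (of_real (DU 2 x) / (of_real (U x) - c) + of_real (k\<^sup>2)) * f x) (at x within S)"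
proof -
  have P: "((\<lambda>x. complex_of_real (P0 x)) has_vector_derivative of_real (P1 x)) (at x within S)"
    by (rule has_vector_derivative_of_real[OF has_field_derivative_at_within[OF P0_deriv[OF x(1,2)]]])
  have "DU 2 x = P0 x * DU 1 x" using x by (simp add: P0_def)
  then have q: "of_real (DU 2 x) / (of_real (U x) - c) = of_real (P0 x) * (of_real (DU 1 x) / (of_real (U x) - c))"
    by simp
  have f: "(f has_vector_derivative v x + of_real (P0 x) * L x * f x) (at x within S)"
    using bounded_linear.has_vector_derivative[OF bounded_linear_fst fv] by (simp add: sysmat_def add.commute)
  show "(f has_vector_derivative v x + of_real (P0 x) * L x * f x) (at x within S)" by (rule f)
  have v: "(v has_vector_derivative snd (sysmat k x (L x) (f x, v x))) (at x within S)"
    using bounded_linear.has_vector_derivative[OF bounded_linear_snd fv] by simp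
  define W where "W = of_real (DU 1 x) / (of_real (U x) - c)"
  show "((\<lambda>x. v x + of_real (P0 x) * L x * f x) has_vector_derivative
       (of_real (DU 2 x) / (of_real (U x) - c) + of_real (k\<^sup>2)) * f x) (at x within S)"
    unfolding q W_def[symmetric]
    by (rule has_vector_derivative_eq_rhs[OF has_vector_derivative_add[OF v
        has_vector_derivative_mult[OF has_vector_derivative_mult[OF P L[folded W_def]] f]]])
      (simp add: sysmat_def algebra_simps power2_eq_square)
qed

end

section \<open>Charts around a critical layer\<close>

text \<open>A chart around a critical layer \<open>s = V cs\<close>. The coordinate \<open>t \<in> [-1,1]\<close> is chosen such that, with
  \<open>X t d\<close> its position for the wave speed \<open>cs + d\<close>, the end points do not depend on \<open>d\<close>, and \<open>U - (cs + d)\<close>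
  is \<open>t ^ (2 q + 1)\<close> times a nonvanishing polynomial, so that \<open>d\<close> does not move the singularity and the
  vanishing of \<open>dX/dt\<close> at \<open>t = 0\<close> absorbs the logarithms.\<close>

locale layer = profile +
  fixes cs rho eta lo hi :: real and V :: "real \<Rightarrow> real" and q :: nat
  assumes rho: "rho = 1 \<or> rho = -1" and eta: "0 < eta" and q: "1 \<le> q"
    and lohi: "{lo..hi} \<subseteq> {0<..<h}" "lo < hi"
    and slope: "\<And>x. x \<in> {lo<..<hi} \<Longrightarrow> 0 < rho * DU 1 x"
    and V: "\<And>e. \<bar>e - cs\<bar> < 2 * eta \<Longrightarrow> V e \<in> {lo<..<hi} \<and> U (V e) = e"
begin

lemma lo_pos: "0 < lo" and hi_less: "hi < h"
  using lohi by (auto simp: subset_iff)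

lemma U_deriv: "x \<in> {lo..hi} \<Longrightarrow> (U has_real_derivative DU 1 x) (at x)"
  using DU_deriv[of 0 x] l_ge lohi by auto

lemma DU1_nz: "x \<in> {lo<..<hi} \<Longrightarrow> DU 1 x \<noteq> 0" using slope[of x] by auto

lemma U_mono: "x \<in> {lo<..<hi} \<Longrightarrow> y \<in> {lo<..<hi} \<Longrightarrow> x < y \<Longrightarrow> rho * U x < rho * U y"
proof (rule DERIV_pos_imp_increasing[where f = "\<lambda>x. rho * U x"])
  fix z assume a: "x \<in> {lo<..<hi}" "y \<in> {lo<..<hi}" "x \<le> z" "z \<le> y"
  then have "((\<lambda>x. rho * U x) has_real_derivative rho * DU 1 z) (at z)"
    by (intro DERIV_cmult U_deriv) auto
  then show "\<exists>D. ((\<lambda>x. rho * U x) has_real_derivative D) (at z) \<and> 0 < D"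
    using slope[of z] a by auto
qed

lemma U_inj: "x \<in> {lo<..<hi} \<Longrightarrow> y \<in> {lo<..<hi} \<Longrightarrow> U x = U y \<Longrightarrow> x = y"
  using U_mono[of x y] U_mono[of y x] by (cases x y rule: linorder_cases) auto

lemma V_U: "x \<in> {lo<..<hi} \<Longrightarrow> \<bar>U x - cs\<bar> < 2 * eta \<Longrightarrow> V (U x) = x"
  using V[of "U x"] by (auto intro: U_inj[of "V (U x)" x])

lemma V_deriv:
  assumes "\<bar>e - cs\<bar> < 2 * eta"
  shows "(V has_real_derivative inverse (DU 1 (V e))) (at e)"
proof -
  define S where "S = {lo<..<hi} \<inter> U -` {cs - 2 * eta<..<cs + 2 * eta}"
  have cU: "continuous_on {lo<..<hi} U"
    by (rule DERIV_continuous_on[where D = "DU 1"])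
      (rule has_field_derivative_at_within[OF U_deriv], auto)
  have S: "open S" unfolding S_def
    by (rule continuous_open_preimage[OF cU]) auto
  have Ve: "V e \<in> S" "U (V e) = e" using V[OF assms] assms by (auto simp: S_def)
  have "(V has_derivative (*) (inverse (DU 1 (V e)))) (at (U (V e)))"
  proof (rule has_derivative_inverse_strong[OF S Ve(1)])
    show "continuous_on S U" using cU by (rule continuous_on_subset) (auto simp: S_def)
    show "V (U x) = x" if "x \<in> S" for x using that by (intro V_U) (auto simp: S_def)
    show "(U has_derivative (*) (DU 1 (V e))) (at (V e))"
      using U_deriv[of "V e"] Ve by (auto simp: S_def has_field_derivative_def)
    show "(*) (DU 1 (V e)) \<circ> (*) (inverse (DU 1 (V e))) = id"
      using DU1_nz[of "V e"] Ve by (auto simp: S_def fun_eq_iff)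
  qed
  then show ?thesis by (simp add: has_field_derivative_def Ve)
qed

text \<open>Bootstrapping from \<open>V' = 1 / U'(V)\<close>: if \<open>V\<close> has
  \<open>m\<close> derivatives then so does the right side, as long as \<open>U\<close> has
  \<open>m + 1\<close>.\<close>

lemma Ck_param_V:
  assumes "m \<le> l" "\<And>t d. t \<in> T \<Longrightarrow> d \<in> D \<Longrightarrow> \<bar>E t d - cs\<bar> < 2 * eta" "Ck_param m T D E"
  shows "Ck_param m T D (\<lambda>t d. V (E t d))"
proof (rule Ck_param_compose[where I = "{cs - 2 * eta<..<cs + 2 * eta}", OF _ _ assms(3)])
  have cV: "continuous_on {cs - 2 * eta<..<cs + 2 * eta} V"
    by (rule DERIV_continuous_on[where D = "\<lambda>e. inverse (DU 1 (V e))"])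
      (rule has_field_derivative_at_within[OF V_deriv], auto)
  show "Ck_param m {0} {cs - 2 * eta<..<cs + 2 * eta} (\<lambda>_. V)"
    using assms(1)
  proof (induction m)
    case 0
    then show ?case
      by (auto simp: split_def intro!: continuous_on_compose2[OF cV] continuous_intros)
  next
    case (Suc m)
    show ?case
    proof (rule Ck_param_SucI[where F' = "\<lambda>_ e. inverse (DU 1 (V e))"])
      show "continuous_on ({cs - 2 * eta<..<cs + 2 * eta} \<times> {0::real}) (\<lambda>(d, t). V d)"
        using Ck_param_cont[OF Suc.IH] Suc.prems by simp
      show "(V has_vector_derivative inverse (DU 1 (V d))) (at d)"
        if "d \<in> {cs - 2 * eta<..<cs + 2 * eta}" for d
        using V_deriv[of d] that by (auto simp: has_real_derivative_iff_has_vector_derivative)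
      show "Ck_param m {0} {cs - 2 * eta<..<cs + 2 * eta} (\<lambda>_ e. inverse (DU 1 (V e)))"
      proof (rule Ck_param_inverse[where F = "\<lambda>_ e. DU 1 (V e)"])
        show "Ck_param m {0} {cs - 2 * eta<..<cs + 2 * eta} (\<lambda>_ e. DU 1 (V e))"
        proof (rule Ck_param_compose[where I = "{0<..<h}" and G = "DU 1" and F = "\<lambda>_. V"])
          show "Ck_param m {0} {0<..<h} (\<lambda>_. DU 1)" using Suc.prems by (intro Ck_param_DU) auto
          show "Ck_param m {0} {cs - 2 * eta<..<cs + 2 * eta} (\<lambda>_. V)" using Suc by auto
          show "V d \<in> {0<..<h}" if "d \<in> {cs - 2 * eta<..<cs + 2 * eta}" for d
            using V[of d] that lo_pos hi_less by (auto simp: abs_less_iff)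
        qed
        show "DU 1 (V d) \<noteq> 0" if "d \<in> {cs - 2 * eta<..<cs + 2 * eta}" for d
          using V[of d] DU1_nz that by auto
      qed
    qed
  qed
qed (use assms(2) in force)

text \<open>The value of \<open>U\<close> prescribed at the coordinate \<open>t\<close>. The
  correction in \<open>d\<close> vanishes at \<open>t = -1\<close> and \<open>t = 1\<close>, so the
  ends stay put; at \<open>t = 0\<close> it equals \<open>d\<close>, and it departs from
  \<open>d\<close> only at order \<open>2 q + 2\<close>, which leaves the factor
  \<open>t ^ (2 q + 1)\<close> in \<open>U - (cs + d)\<close>.\<close>

definition ev :: "real \<Rightarrow> real \<Rightarrow> real" where
  "ev t d = cs + rho * eta * t ^ (2 * q + 1) + d * (1 - t ^ (2 * q + 2))"

definition X :: "real \<Rightarrow> real \<Rightarrow> real" where "X t d = V (ev t d)"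

text \<open>The nonvanishing factor of \<open>dX/dt\<close>: the derivative of \<open>ev\<close> in
  \<open>t\<close> divided by \<open>U'\<close>, with \<open>t ^ (2 q)\<close> taken out.\<close>

definition k0 :: "real \<Rightarrow> real \<Rightarrow> real" where
  "k0 t d = (real (2 * q + 1) * rho * eta - real (2 * q + 2) * d * t) / DU 1 (X t d)"

definition Xd :: "real \<Rightarrow> real \<Rightarrow> real" where "Xd t d = t ^ (2 * q) * k0 t d"

text \<open>The radius \<open>eta / 2\<close> keeps \<open>ev\<close> in the domain of
  \<open>V\<close> and \<open>eta - rho d t\<close> positive; since
  \<open>(2 q + 2) / 2 < 2 q + 1\<close> for \<open>q \<ge> 1\<close>, it also keeps the numerator
  of \<open>k0\<close> from changing sign.\<close>

abbreviation "speeds \<equiv> {- (eta / 2)<..<eta / 2}"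
abbreviation "chart_dom \<equiv> {-1..1::real}"

lemma ev_bound:
  assumes "t \<in> chart_dom" "d \<in> speeds"
  shows "\<bar>ev t d - cs\<bar> < 2 * eta"
proof -
  have t: "\<bar>t\<bar> \<le> 1" using assms by auto
  have "\<bar>t ^ (2 * q + 1)\<bar> \<le> 1" "\<bar>t ^ (2 * q + 2)\<bar> \<le> 1"
    using t by (simp_all only: power_abs power_le_one abs_ge_zero)
  moreover have "0 \<le> t ^ (2 * q + 2)" by (rule zero_le_even_power) simp
  ultimately have a: "\<bar>t ^ (2 * q + 1)\<bar> \<le> 1" "\<bar>1 - t ^ (2 * q + 2)\<bar> \<le> 1" by linarith+
  have 1: "\<bar>rho * eta * t ^ (2 * q + 1)\<bar> \<le> eta"
    using mult_left_mono[OF a(1), of eta] eta rho by (auto simp: abs_mult)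
  have 2: "\<bar>d * (1 - t ^ (2 * q + 2))\<bar> \<le> \<bar>d\<bar>"
    using mult_left_mono[OF a(2), of "\<bar>d\<bar>"] by (simp only: abs_mult mult_1_right abs_ge_zero)
  have "\<bar>d\<bar> < eta / 2" using assms(2) unfolding greaterThanLessThan_iff by linarith
  then show ?thesis
    using 1 2 eta unfolding ev_def by linarith
qed

lemma X_in: "t \<in> chart_dom \<Longrightarrow> d \<in> speeds \<Longrightarrow> X t d \<in> {lo<..<hi}"
  and U_X: "t \<in> chart_dom \<Longrightarrow> d \<in> speeds \<Longrightarrow> U (X t d) = ev t d"
  using V ev_bound unfolding X_def by auto

lemma U_X_minus:
  "t \<in> chart_dom \<Longrightarrow> d \<in> speeds \<Longrightarrow> U (X t d) - (cs + d) = t ^ (2 * q + 1) * (rho * eta - d * t)"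
  by (simp add: U_X ev_def algebra_simps)

lemma X_0: "X 0 d = V (cs + d)" and X_1: "X 1 d = V (cs + rho * eta)"
  and X_m1: "X (-1) d = V (cs - rho * eta)"
  using q by (simp_all add: X_def ev_def)

lemma ev_deriv:
  "((\<lambda>t. ev t d) has_real_derivative t ^ (2 * q) * (real (2 * q + 1) * rho * eta - real (2 * q + 2) * d * t)) (at t)"
proof -
  have p: "((\<lambda>t::real. t ^ (2 * q + 1)) has_real_derivative real (2 * q + 1) * t ^ (2 * q)) (at t)"
    "((\<lambda>t::real. t ^ (2 * q + 2)) has_real_derivative real (2 * q + 2) * t ^ (2 * q + 1)) (at t)"
    using DERIV_pow[of "2 * q + 1" t] DERIV_pow[of "2 * q + 2" t] by simp_all
  show ?thesis
    unfolding ev_def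
    by (rule DERIV_cong[OF DERIV_add[OF DERIV_add[OF DERIV_const DERIV_cmult[OF p(1)]]
          DERIV_cmult[OF DERIV_diff[OF DERIV_const p(2)]]]])
      (simp add: algebra_simps)
qed

lemma X_deriv:
  assumes "t \<in> chart_dom" "d \<in> speeds"
  shows "((\<lambda>t. X t d) has_real_derivative Xd t d) (at t)"
proof -
  have "((\<lambda>t. V (ev t d)) has_real_derivative inverse (DU 1 (V (ev t d))) *
      (t ^ (2 * q) * (real (2 * q + 1) * rho * eta - real (2 * q + 2) * d * t))) (at t)"
    by (rule DERIV_chain2[OF V_deriv[OF ev_bound[OF assms]] ev_deriv])
  then show ?thesis
    by (simp add: X_def[abs_def] Xd_def k0_def field_simps)
qed

lemma dt_bound: "t \<in> chart_dom \<Longrightarrow> d \<in> speeds \<Longrightarrow> \<bar>d * t\<bar> < eta / 2"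
proof -
  assume "t \<in> chart_dom" "d \<in> speeds"
  then have "\<bar>d\<bar> * \<bar>t\<bar> \<le> \<bar>d\<bar> * 1" "\<bar>d\<bar> < eta / 2"
    by (auto simp: abs_less_iff intro!: mult_left_le)
  then show ?thesis by (simp add: abs_mult)
qed

lemma rdt_pos:
  assumes "t \<in> chart_dom" "d \<in> speeds"
  shows "eta / 2 < eta - rho * d * t" "eta - rho * d * t < 2 * eta"
  using dt_bound[OF assms] rho by (auto simp: abs_less_iff)

lemma k0_pos:
  assumes "t \<in> chart_dom" "d \<in> speeds"
  shows "0 < k0 t d"
proof -
  have "real (2 * q + 2) * \<bar>d * t\<bar> \<le> real (2 * q + 2) * (eta / 2)"
    using dt_bound[OF assms] by (intro mult_left_mono) auto
  also have "\<dots> < real (2 * q + 1) * eta" using eta q by (simp add: algebra_simps)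
  finally have a: "real (2 * q + 2) * \<bar>d * t\<bar> < real (2 * q + 1) * eta" .
  have "\<bar>rho * (real (2 * q + 2) * (d * t))\<bar> = real (2 * q + 2) * \<bar>d * t\<bar>"
    using rho by (auto simp: abs_mult)
  then have "0 < real (2 * q + 1) * eta - rho * (real (2 * q + 2) * (d * t))" using a by linarith
  also have "\<dots> = rho * (real (2 * q + 1) * rho * eta - real (2 * q + 2) * d * t)"
    using rho by (auto simp: algebra_simps)
  finally have "0 < rho * (real (2 * q + 1) * rho * eta - real (2 * q + 2) * d * t)" .
  moreover have "0 < rho * DU 1 (X t d)" by (rule slope[OF X_in[OF assms]])
  ultimately show ?thesis unfolding k0_def using rho by (auto simp: zero_less_divide_iff)
qed

lemma Xd_pos: "t \<in> chart_dom \<Longrightarrow> d \<in> speeds \<Longrightarrow> t \<noteq> 0 \<Longrightarrow> 0 < Xd t d"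
  unfolding Xd_def using k0_pos by (intro mult_pos_pos) (auto simp: zero_less_power_eq)

lemma X_cont: "d \<in> speeds \<Longrightarrow> continuous_on chart_dom (\<lambda>t. X t d)"
  by (rule DERIV_continuous_on[where D = "\<lambda>t. Xd t d"]) (rule has_field_derivative_at_within[OF X_deriv])

text \<open>The derivative vanishes at \<open>t = 0\<close>, so strict growth is shown on either
  side and joined there.\<close>

lemma X_mono:
  assumes "d \<in> speeds" "t \<in> chart_dom" "t' \<in> chart_dom" "t < t'"
  shows "X t d < X t' d"
proof -
  have gen: "X t d < X t' d" if "t \<in> chart_dom" "t' \<in> chart_dom" "t < t'" "0 \<notin> {t<..<t'}" for t t'
  proof (rule DERIV_pos_imp_increasing_open[OF that(3)])
    show "\<exists>y. ((\<lambda>t. X t d) has_real_derivative y) (at x) \<and> 0 < y" if x: "t < x" "x < t'" for x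
      using X_deriv[of x d] Xd_pos[of x d] that \<open>t \<in> chart_dom\<close> \<open>t' \<in> chart_dom\<close> \<open>0 \<notin> {t<..<t'}\<close> assms(1)
      by (intro exI[of _ "Xd x d"]) auto
    show "continuous_on {t..t'} (\<lambda>t. X t d)"
      by (rule continuous_on_subset[OF X_cont[OF assms(1)]]) (use that in auto)
  qed
  show ?thesis
  proof (cases "0 \<in> {t<..<t'}")
    case True
    then show ?thesis using gen[of t 0] gen[of 0 t'] assms by auto
  qed (use gen[of t t'] assms in auto)
qed

lemma Ck_param_ev: "Ck_param n T D ev"
  unfolding ev_def[abs_def]
  by (intro Ck_param_add Ck_param_mult Ck_param_snd Ck_param_fst continuous_intros)

lemma Ck_param_X: "n \<le> l \<Longrightarrow> Ck_param n chart_dom speeds X"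
  unfolding X_def[abs_def] by (rule Ck_param_V[OF _ ev_bound Ck_param_ev])

lemma Ck_param_DU_X: "j + n \<le> l \<Longrightarrow> Ck_param n chart_dom speeds (\<lambda>t d. DU j (X t d))"
  by (rule Ck_param_compose[where I = "{0<..<h}" and G = "DU j" and F = X, OF _ Ck_param_DU Ck_param_X])
    (use X_in lo_pos hi_less in \<open>fastforce+\<close>)

lemma DU1_X_nz: "t \<in> chart_dom \<Longrightarrow> d \<in> speeds \<Longrightarrow> DU 1 (X t d) \<noteq> 0"
  by (rule DU1_nz[OF X_in])

lemma Ck_param_k0: "n + 1 \<le> l \<Longrightarrow> Ck_param n chart_dom speeds k0"
  unfolding k0_def[abs_def]
  by (intro Ck_param_divide Ck_param_diff Ck_param_mult Ck_param_snd Ck_param_fst Ck_param_DU_X continuous_intros DU1_X_nz) auto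

lemma Ck_param_P0: "n + 2 \<le> l \<Longrightarrow> Ck_param n chart_dom speeds (\<lambda>t d. P0 (X t d))"
  unfolding P0_def by (intro Ck_param_divide Ck_param_DU_X DU1_X_nz) auto

lemma Ck_param_P1: "n + 3 \<le> l \<Longrightarrow> Ck_param n chart_dom speeds (\<lambda>t d. P1 (X t d))"
  unfolding P1_def by (intro Ck_param_divide Ck_param_diff Ck_param_mult Ck_param_power Ck_param_DU_X power_not_zero DU1_X_nz) auto

lemma Ck_param_lnr: "Ck_param n chart_dom speeds (\<lambda>t d. ln (eta - rho * d * t))"
proof (rule Ck_param_ln)
  show "0 < eta - rho * d * t" if "t \<in> chart_dom" "d \<in> speeds" for t d
    using rdt_pos[OF that] eta by linarith
qed (intro Ck_param_diff Ck_param_mult Ck_param_snd Ck_param_fst continuous_intros)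

end

text \<open>The boundary value of the principal \<open>Ln (w - i e)\<close> as \<open>e\<close>
  tends to 0 with sign \<open>\<sigma>\<close>; with \<open>w = U - cs\<close> this is the limit of
  the logarithm of \<open>U - (cs + i e)\<close>.\<close>

definition log_branch :: "real \<Rightarrow> real \<Rightarrow> complex" where
  "log_branch \<sigma> w = of_real (ln \<bar>w\<bar>) - (if w < 0 then \<i> * of_real (\<sigma> * pi) else 0)"

lemma log_branch_deriv_at:
  assumes "w \<noteq> 0"
  shows "(log_branch \<sigma> has_vector_derivative of_real (1 / w)) (at w)"
proof -
  have ln: "((\<lambda>w. complex_of_real (ln \<bar>w\<bar>)) has_vector_derivative of_real (1 / w)) (at w)"
  proof (rule has_vector_derivative_of_real)
    show "((\<lambda>w. ln \<bar>w\<bar>) has_real_derivative 1 / w) (at w)"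
    proof (cases "w > 0")
      case True
      have "(ln has_real_derivative 1 / w) (at w)"
        using True by (auto intro!: derivative_eq_intros)
      then show ?thesis
        by (rule has_field_derivative_transform_within_open[where S = "{0<..}"]) (use True in auto)
    next
      case False
      have "((\<lambda>w. ln (- w)) has_real_derivative 1 / w) (at w)"
        using False assms by (auto intro!: derivative_eq_intros)
      then show ?thesis
        by (rule has_field_derivative_transform_within_open[where S = "{..<0}"]) (use False assms in auto)
    qed
  qed
  define K where "K = (if w < 0 then \<i> * of_real (\<sigma> * pi) else 0)"
  have "((\<lambda>w. complex_of_real (ln \<bar>w\<bar>) - K) has_vector_derivative of_real (1 / w)) (at w)"
    using has_vector_derivative_diff[OF ln has_vector_derivative_const[of K]] by simp
  then show ?thesis
  proof (rule has_vector_derivative_transform_within_open[where S = "{x. w < 0 \<and> x < 0 \<or> \<not> w < 0 \<and> 0 < x}"])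
    show "open {x::real. w < 0 \<and> x < 0 \<or> \<not> w < 0 \<and> 0 < x}" 
      using open_lessThan[of "0::real"] open_greaterThan[of "0::real"]
      by (cases "w < 0") (simp_all add: lessThan_def greaterThan_def)
  qed (use assms in \<open>auto simp: log_branch_def K_def\<close>)
qed

lemma log_branch_deriv:
  assumes "(u has_real_derivative u') (at x within S)" "u x \<noteq> 0"
  shows "((\<lambda>x. log_branch \<sigma> (u x)) has_vector_derivative of_real (u' / u x)) (at x within S)"
proof -
  have "(u has_vector_derivative u') (at x within S)"
    using assms(1) by (simp add: has_real_derivative_iff_has_vector_derivative)
  then have "((log_branch \<sigma> \<circ> u) has_vector_derivative u' *\<^sub>R of_real (1 / u x)) (at x within S)"
    by (rule vector_diff_chain_within) (rule has_vector_derivative_at_within[OF log_branch_deriv_at[OF assms(2)]])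
  then show ?thesis by (simp add: o_def scaleR_conv_of_real)
qed

text \<open>From \<open>ln z \<le> z - 1\<close> at \<open>z = 1 / sqrt |t|\<close>. Any power of
  \<open>1 / |t|\<close> below the first would make \<open>t ln |t|\<close> tend to 0; the square
  root is the handiest.\<close>

lemma abs_ln_le:
  assumes "t \<noteq> 0" "\<bar>t\<bar> \<le> 1"
  shows "\<bar>ln \<bar>t\<bar>\<bar> \<le> 2 / sqrt \<bar>t\<bar>"
proof -
  define s where "s = sqrt \<bar>t\<bar>"
  have s: "s > 0" "\<bar>t\<bar> = s * s" using assms by (auto simp: s_def)
  have "ln (1 / s) \<le> 1 / s - 1" using s by (intro ln_le_minus_one) auto
  then have "- ln s \<le> 1 / s" using s by (simp add: ln_div)
  moreover have "ln \<bar>t\<bar> = 2 * ln s" using s by (simp add: ln_mult)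
  moreover have "ln \<bar>t\<bar> \<le> 0" using assms by simp
  ultimately show ?thesis unfolding s_def[symmetric] by simp
qed

lemma scaleR_mat2: "r *\<^sub>R mat2 a b c d = mat2 (of_real r * a) (of_real r * b) (of_real r * c) (of_real r * d)"
  by (rule blinfun_eqI) (simp add: blinfun.scaleR_left scaleR_conv_of_real algebra_simps)

text \<open>Bounded coefficients give a bounded solution, hence a bounded derivative, hence a
  Lipschitz function, which extends to the end point 0. The linear rate \<open>K t\<close> is kept
  because it must later beat a logarithm.\<close>

lemma ode_half_limit:
  fixes Y :: "real \<Rightarrow> 'a::{real_inner, complete_space}"
  assumes d: "\<And>t. t \<in> {0<..1} \<Longrightarrow> (Y has_vector_derivative Y' t) (at t)"
    and bd: "\<And>t. t \<in> {0<..1} \<Longrightarrow> norm (Y' t) \<le> C * norm (Y t)" and C: "C \<ge> 0"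
  obtains Y0 K where "(Y \<longlongrightarrow> Y0) (at_right 0)" "\<And>t. t \<in> {0<..1} \<Longrightarrow> norm (Y t - Y0) \<le> K * t"
proof -
  define M where "M = 2 * exp (C + 1) * norm (Y 1)"
  have M0: "M \<ge> 0" by (simp add: M_def)
  have M: "norm (Y t) \<le> M" if t: "t \<in> {0<..1}" for t
  proof -
    have "norm (Y t) + 0 \<le> 2 * exp ((C + 1) * (1 - t)) * (norm (Y 1) + 0)"
    proof (rule gronwall_ends(1)[where Y' = Y'])
      show "continuous_on {t..1} Y"
        by (rule continuous_on_vector_derivative[where f' = Y'])
          (rule has_vector_derivative_at_within[OF d], use t in auto)
    qed (use t d bd C in auto)
    also have "\<dots> \<le> M"
    proof -
      have "(C + 1) * (1 - t) \<le> (C + 1) * 1" using t C by (intro mult_left_mono) auto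
      then show ?thesis unfolding M_def by (simp add: mult_right_mono)
    qed
    finally show ?thesis by simp
  qed
  have lip: "norm (Y t - Y u) \<le> C * M * \<bar>t - u\<bar>" if "t \<in> {0<..1}" "u \<in> {0<..1}" for t u
  proof -
    have "norm (Y t - Y u) \<le> C * M * norm (t - u)"
    proof (rule differentiable_bound[where S = "{0<..1}" and f' = "\<lambda>t h. h *\<^sub>R Y' t"])
      show "(Y has_derivative (\<lambda>h. h *\<^sub>R Y' x)) (at x within {0<..1})" if "x \<in> {0<..1}" for x
        using has_vector_derivative_at_within[OF d[OF that]] by (simp add: has_vector_derivative_def)
      show "onorm (\<lambda>h. h *\<^sub>R Y' x) \<le> C * M" if x: "x \<in> {0<..1}" for x
      proof (rule onorm_le)
        fix a :: real
        have "norm (Y' x) \<le> C * M"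
          using bd[OF x] M[OF x] C by (meson mult_left_mono order_trans)
        then show "norm (a *\<^sub>R Y' x) \<le> C * M * norm a" by (simp add: mult.commute mult_left_mono)
      qed
    qed (use that in auto)
    then show ?thesis by simp
  qed
  have "uniformly_continuous_on {0<..1} Y"
    unfolding uniformly_continuous_on_def
  proof (intro allI impI)
    fix e :: real assume e: "e > 0"
    show "\<exists>r>0. \<forall>x\<in>{0<..1}. \<forall>x'\<in>{0<..1}. dist x' x < r \<longrightarrow> dist (Y x') (Y x) < e"
    proof (intro exI[of _ "e / (C * M + 1)"] conjI ballI impI)
      have p: "0 < C * M + 1" using C M0 by (simp add: add_nonneg_pos)
      then show "0 < e / (C * M + 1)" using e by simp
      fix x x' :: real assume "x \<in> {0<..1}" "x' \<in> {0<..1}" and r: "dist x' x < e / (C * M + 1)"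
      then have "norm (Y x' - Y x) \<le> C * M * \<bar>x' - x\<bar>" by (intro lip)
      also have "\<dots> \<le> (C * M + 1) * \<bar>x' - x\<bar>" by (intro mult_right_mono) auto
      also have "\<dots> < e" using r p by (simp add: dist_real_def pos_less_divide_eq mult.commute)
      finally show "dist (Y x') (Y x) < e" by (simp add: dist_norm)
    qed
  qed
  moreover have "(0::real) \<in> closure {0<..1}" by simp
  ultimately obtain Y0 where "(Y \<longlongrightarrow> Y0) (at 0 within {0<..1})"
    by (metis uniformly_continuous_on_extension_at_closure)
  moreover have "at (0::real) within {0<..1} = at_right 0"
    by (rule at_within_nhd[of _ "{..<1}"]) auto
  ultimately have Y0: "(Y \<longlongrightarrow> Y0) (at_right 0)" by simp
  show ?thesis
  proof (rule that[OF Y0])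
    fix t :: real assume t: "t \<in> {0<..1}"
    have "((\<lambda>u. norm (Y t - Y u)) \<longlongrightarrow> norm (Y t - Y0)) (at_right 0)"
      by (intro tendsto_intros Y0)
    moreover have "\<forall>\<^sub>F u in at_right 0. norm (Y t - Y u) \<le> C * M * t"
      unfolding eventually_at_right_field
    proof (intro exI[of _ t] conjI allI impI)
      fix u assume u: "0 < u" "u < t"
      have "norm (Y t - Y u) \<le> C * M * \<bar>t - u\<bar>" using u t by (intro lip) auto
      also have "\<dots> \<le> C * M * t" using u C M0 by (intro mult_left_mono) auto
      finally show "norm (Y t - Y u) \<le> C * M * t" .
    qed (use t in auto)
    ultimately show "norm (Y t - Y0) \<le> C * M * t"
      by (rule tendsto_upperbound) simp
  qed
qed

definition (in profile) ode_at :: "real \<Rightarrow> complex \<Rightarrow> (real \<Rightarrow> complex) \<Rightarrow> (real \<Rightarrow> complex) \<Rightarrow> real set \<Rightarrow> real \<Rightarrow> bool" where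
  "ode_at k c f g S x \<longleftrightarrow> (f has_vector_derivative g x) (at x within S) \<and>
     (g has_vector_derivative (of_real (DU 2 x) / (of_real (U x) - c) + of_real (k\<^sup>2)) * f x) (at x within S)"

section \<open>The Rayleigh system in the chart\<close>

context layer
begin

text \<open>For \<open>t \<noteq> 0\<close>, the logarithm of \<open>rho t ^ (2 q + 1)\<close> in
  the chosen branch. It carries the whole singularity and does not depend on \<open>d\<close>; the
  remaining \<open>ln (eta - rho d t)\<close> is smooth in \<open>d\<close>.\<close>

definition ell :: "real \<Rightarrow> real \<Rightarrow> complex" where
  "ell \<sigma> t = of_real (real (2 * q + 1) * ln \<bar>t\<bar>) - (if rho * t < 0 then \<i> * of_real (\<sigma> * pi) else 0)"

lemma U_X_minus_rho:
  "t \<in> chart_dom \<Longrightarrow> d \<in> speeds \<Longrightarrow> U (X t d) - (cs + d) = rho * t ^ (2 * q + 1) * (eta - rho * d * t)"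
  using rho by (auto simp: U_X_minus algebra_simps)

lemma log_branch_X:
  assumes "t \<in> chart_dom" "d \<in> speeds" "t \<noteq> 0"
  shows "log_branch \<sigma> (U (X t d) - (cs + d)) = ell \<sigma> t + of_real (ln (eta - rho * d * t))"
proof -
  define r where "r = eta - rho * d * t"
  have r: "r > 0" using rdt_pos[OF assms(1,2)] eta by (simp add: r_def)
  have w: "U (X t d) - (cs + d) = rho * t ^ (2 * q + 1) * r"
    unfolding r_def by (rule U_X_minus_rho[OF assms(1,2)])
  have "\<bar>rho * t ^ (2 * q + 1) * r\<bar> = \<bar>t\<bar> ^ (2 * q + 1) * r"
    using rho r by (auto simp: abs_mult power_abs)
  then have 1: "ln \<bar>rho * t ^ (2 * q + 1) * r\<bar> = real (2 * q + 1) * ln \<bar>t\<bar> + ln r"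
    using r assms(3) by (simp only: ln_mult ln_realpow zero_less_power zero_less_abs_iff)
      (simp add: ln_mult ln_realpow)
  have 2: "rho * t ^ (2 * q + 1) * r < 0 \<longleftrightarrow> rho * t < 0"
  proof -
    have e: "0 < t ^ (2 * q)" using assms(3) by (simp add: zero_less_power_eq)
    have "rho * t ^ (2 * q + 1) * r = (rho * t) * (t ^ (2 * q) * r)" by simp
    moreover have "0 < t ^ (2 * q) * r" using e r by simp
    ultimately show ?thesis by (metis mult_neg_pos mult_nonneg_nonneg not_less less_imp_le)
  qed
  show ?thesis unfolding w log_branch_def ell_def 1 2 r_def[symmetric]
    by (simp only: of_real_add diff_add_eq)
qed

lemma ell_cont:
  assumes "t \<noteq> 0"
  shows "isCont (ell \<sigma>) t"
proof -
  define K where "K = (if rho * t < 0 then \<i> * of_real (\<sigma> * pi) else 0)"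
  have "isCont (\<lambda>t. of_real (real (2 * q + 1) * ln \<bar>t\<bar>) - K) t"
    using assms by (intro continuous_intros) auto
  moreover have "\<forall>\<^sub>F u in nhds t. ell \<sigma> u = of_real (real (2 * q + 1) * ln \<bar>u\<bar>) - K"
  proof -
    have "open {u. 0 < t * u}" "t \<in> {u. 0 < t * u}"
      using assms by (auto simp: open_Collect_less continuous_on_mult_left zero_less_mult_iff linorder_neq_iff)
    then have "\<forall>\<^sub>F u in nhds t. u \<in> {u. 0 < t * u}" by (rule eventually_nhds_in_open)
    then show ?thesis
      by eventually_elim (use rho in \<open>auto simp: ell_def K_def zero_less_mult_iff\<close>)
  qed
  ultimately show ?thesis using isCont_cong by fastforce
qed

lemma norm_ell:
  assumes "\<bar>\<sigma>\<bar> \<le> 1"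
  shows "norm (ell \<sigma> t) \<le> real (2 * q + 1) * \<bar>ln \<bar>t\<bar>\<bar> + pi"
proof -
  have "norm (if rho * t < 0 then \<i> * of_real (\<sigma> * pi) else 0 :: complex) \<le> pi"
    using assms by (auto simp: norm_mult abs_mult mult_left_le_one_le)
  moreover have "norm (complex_of_real (real (2 * q + 1) * ln \<bar>t\<bar>)) = real (2 * q + 1) * \<bar>ln \<bar>t\<bar>\<bar>"
    by (simp only: norm_of_real abs_mult abs_of_nat)
  ultimately show ?thesis
    unfolding ell_def by (intro order_trans[OF norm_triangle_ineq4]) linarith
qed

lemma t_ell_tendsto:
  assumes "\<bar>\<sigma>\<bar> \<le> 1"
  shows "((\<lambda>t. of_real t * ell \<sigma> t) \<longlongrightarrow> 0) (at 0)"
proof -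
  define A where "A = 2 * real (2 * q + 1)"
  show ?thesis
  proof (rule tendsto_norm_zero_cancel,
      rule tendsto_sandwich[where f = "\<lambda>_. 0" and h = "\<lambda>t. A * sqrt \<bar>t\<bar> + pi * \<bar>t\<bar>"])
  show "\<forall>\<^sub>F t in at 0. norm (of_real t * ell \<sigma> t) \<le> A * sqrt \<bar>t\<bar> + pi * \<bar>t\<bar>"
    unfolding eventually_at
  proof (intro exI[of _ 1] conjI ballI impI)
    fix t :: real assume "t \<noteq> 0 \<and> dist t 0 < 1"
    then have t: "t \<noteq> 0" "\<bar>t\<bar> \<le> 1" by auto
    have s: "sqrt \<bar>t\<bar> > 0" "\<bar>t\<bar> = sqrt \<bar>t\<bar> * sqrt \<bar>t\<bar>" using t by auto
    have "\<bar>t\<bar> * (real (2 * q + 1) * \<bar>ln \<bar>t\<bar>\<bar>) \<le> \<bar>t\<bar> * (real (2 * q + 1) * (2 / sqrt \<bar>t\<bar>))"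
      by (intro mult_left_mono abs_ln_le t) auto
    also have "\<dots> = A * (\<bar>t\<bar> / sqrt \<bar>t\<bar>)" by (simp add: A_def)
    also have "\<bar>t\<bar> / sqrt \<bar>t\<bar> = sqrt \<bar>t\<bar>" using s by (metis nonzero_mult_div_cancel_left less_irrefl)
    finally have 1: "\<bar>t\<bar> * (real (2 * q + 1) * \<bar>ln \<bar>t\<bar>\<bar>) \<le> A * sqrt \<bar>t\<bar>" .
    have "norm (of_real t * ell \<sigma> t) \<le> \<bar>t\<bar> * (real (2 * q + 1) * \<bar>ln \<bar>t\<bar>\<bar> + pi)"
      unfolding norm_mult norm_of_real by (intro mult_left_mono norm_ell assms) auto
    then show "norm (of_real t * ell \<sigma> t) \<le> A * sqrt \<bar>t\<bar> + pi * \<bar>t\<bar>"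
      using 1 by (simp add: distrib_left mult.commute)
  qed auto
  have "((\<lambda>t. A * sqrt \<bar>t\<bar> + pi * \<bar>t\<bar>) \<longlongrightarrow> A * sqrt \<bar>0\<bar> + pi * \<bar>0\<bar>) (at 0)"
    by (intro tendsto_intros)
  then show "((\<lambda>t. A * sqrt \<bar>t\<bar> + pi * \<bar>t\<bar>) \<longlongrightarrow> 0) (at 0)" by simp
  qed auto
qed

text \<open>Since \<open>q \<ge> 1\<close>, \<open>t ^ (2 q)\<close> contains two factors
  \<open>t\<close>, one for each power of the logarithm in the coefficients, and \<open>t\<close>
  times the logarithm tends to 0.\<close>

lemma sing_cont:
  assumes "\<bar>\<sigma>\<bar> \<le> 1"
  shows "continuous_on UNIV (\<lambda>t. of_real (t ^ (2 * q)) * ell \<sigma> t)"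
    "continuous_on UNIV (\<lambda>t. of_real (t ^ (2 * q)) * (ell \<sigma> t)\<^sup>2)"
proof -
  obtain q' where q': "q = Suc q'" using q by (cases q) auto
  have t2: "complex_of_real (t ^ (2 * q)) = of_real (t ^ (2 * q')) * of_real t * of_real t" for t :: real
    by (simp add: q')
  have lim0: "((\<lambda>t::real. of_real (t ^ (2 * q')) * of_real t :: complex) \<longlongrightarrow> of_real (0 ^ (2 * q')) * of_real 0) (at 0)"
    "((\<lambda>t::real. of_real (t ^ (2 * q')) :: complex) \<longlongrightarrow> of_real (0 ^ (2 * q'))) (at 0)"
    by (intro tendsto_intros)+
  have "isCont (\<lambda>t. of_real (t ^ (2 * q)) * ell \<sigma> t) t" for t
  proof (cases "t = 0")
    case True
    have "((\<lambda>t. of_real (t ^ (2 * q')) * of_real t * (of_real t * ell \<sigma> t)) \<longlongrightarrow> of_real (0 ^ (2 * q')) * of_real 0 * 0) (at 0)"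
      by (intro tendsto_mult[OF lim0(1) t_ell_tendsto] assms)
    then show ?thesis unfolding True isCont_def t2 by (simp add: mult_ac)
  qed (intro continuous_intros ell_cont)
  then show "continuous_on UNIV (\<lambda>t. of_real (t ^ (2 * q)) * ell \<sigma> t)"
    by (simp add: continuous_on_eq_continuous_at)
  have "isCont (\<lambda>t. of_real (t ^ (2 * q)) * (ell \<sigma> t)\<^sup>2) t" for t
  proof (cases "t = 0")
    case True
    have "((\<lambda>t. of_real (t ^ (2 * q')) * ((of_real t * ell \<sigma> t) * (of_real t * ell \<sigma> t))) \<longlongrightarrow> of_real (0 ^ (2 * q')) * (0 * 0)) (at 0)"
      by (intro tendsto_mult[OF lim0(2)] tendsto_mult t_ell_tendsto assms)
    then show ?thesis unfolding True isCont_def t2 by (simp add: mult_ac power2_eq_square)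
  qed (intro continuous_intros ell_cont)
  then show "continuous_on UNIV (\<lambda>t. of_real (t ^ (2 * q)) * (ell \<sigma> t)\<^sup>2)"
    by (simp add: continuous_on_eq_continuous_at)
qed

text \<open>\<open>Xd\<close> times the first power of the logarithm, as \<open>E2\<close> is
  \<open>Xd\<close> times the second. Both are multiplied out so that each power of
  \<open>ell\<close> stands next to \<open>t ^ (2 q)\<close>, which makes continuity at
  \<open>t = 0\<close> visible.\<close>

definition E1 :: "real \<Rightarrow> real \<Rightarrow> real \<Rightarrow> complex" where
  "E1 \<sigma> t d = of_real (k0 t d) * (of_real (t ^ (2 * q)) * ell \<sigma> t + of_real (t ^ (2 * q)) * of_real (ln (eta - rho * d * t)))"

definition E2 :: "real \<Rightarrow> real \<Rightarrow> real \<Rightarrow> complex" where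
  "E2 \<sigma> t d = of_real (k0 t d) * (of_real (t ^ (2 * q)) * (ell \<sigma> t)\<^sup>2
     + 2 * (of_real (t ^ (2 * q)) * ell \<sigma> t) * of_real (ln (eta - rho * d * t))
     + of_real (t ^ (2 * q)) * of_real (ln (eta - rho * d * t)) ^ 2)"

text \<open>The system matrix in the coordinate \<open>t\<close>, in a form that is continuous at
  the layer itself; off the layer it is \<open>Xd\<close> times \<open>sysmat\<close>.\<close>

definition chart_mat :: "real \<Rightarrow> real \<Rightarrow> real \<Rightarrow> real \<Rightarrow> (complex \<times> complex) \<Rightarrow>\<^sub>L (complex \<times> complex)" where
  "chart_mat \<sigma> k t d = mat2 (of_real (P0 (X t d)) * E1 \<sigma> t d) (of_real (Xd t d))
     (of_real (Xd t d) * of_real (k\<^sup>2) - of_real (P1 (X t d)) * E1 \<sigma> t d - of_real (P0 (X t d)) ^ 2 * E2 \<sigma> t d)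
     (- (of_real (P0 (X t d)) * E1 \<sigma> t d))"

lemma chart_mat_eq:
  assumes "t \<in> chart_dom" "d \<in> speeds" "t \<noteq> 0"
  shows "chart_mat \<sigma> k t d = Xd t d *\<^sub>R sysmat k (X t d) (log_branch \<sigma> (U (X t d) - (cs + d)))"
  unfolding log_branch_X[OF assms] chart_mat_def sysmat_def scaleR_mat2 E1_def E2_def Xd_def
  by (simp add: algebra_simps power2_eq_square)

lemma Ck_param_chart_mat:
  assumes "n + 3 \<le> l" "\<bar>\<sigma>\<bar> \<le> 1"
  shows "Ck_param n chart_dom speeds (chart_mat \<sigma> k)"
proof -
  note s = Ck_param_fst[OF continuous_on_subset[OF sing_cont(1)[OF assms(2)] subset_UNIV]]
    Ck_param_fst[OF continuous_on_subset[OF sing_cont(2)[OF assms(2)] subset_UNIV]]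
  have k: "Ck_param n chart_dom speeds (\<lambda>t d. complex_of_real (k0 t d))" by (rule Ck_param_of_real[OF Ck_param_k0]) (use assms in simp)
  have p: "Ck_param n chart_dom speeds (\<lambda>t d. complex_of_real (t ^ (2 * q)))"
    by (rule Ck_param_fst) (intro continuous_intros)
  note lr = Ck_param_of_real[OF Ck_param_lnr]
  have E1: "Ck_param n chart_dom speeds (E1 \<sigma>)"
    unfolding E1_def[abs_def] by (rule Ck_param_mult[OF k Ck_param_add[OF s(1) Ck_param_mult[OF p lr]]])
  have E2: "Ck_param n chart_dom speeds (E2 \<sigma>)"
    unfolding E2_def[abs_def]
    by (rule Ck_param_mult[OF k Ck_param_add[OF Ck_param_add[OF s(2) Ck_param_mult[OF Ck_param_mult[OF Ck_param_const s(1)] lr]]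
          Ck_param_mult[OF p Ck_param_power[OF lr]]]])
  have Xd: "Ck_param n chart_dom speeds (\<lambda>t d. complex_of_real (Xd t d))"
    unfolding Xd_def[abs_def] of_real_mult by (rule Ck_param_mult[OF p k])
  have P: "Ck_param n chart_dom speeds (\<lambda>t d. complex_of_real (P0 (X t d)))" "Ck_param n chart_dom speeds (\<lambda>t d. complex_of_real (P1 (X t d)))"
    by (rule Ck_param_of_real[OF Ck_param_P0], use assms in simp, rule Ck_param_of_real[OF Ck_param_P1], use assms in simp)
  show ?thesis unfolding chart_mat_def[abs_def]
    by (rule Ck_param_mat2[OF Ck_param_mult[OF P(1) E1] Xd Ck_param_diff[OF Ck_param_diff[OF Ck_param_mult[OF Xd Ck_param_const] Ck_param_mult[OF P(2) E1]]
          Ck_param_mult[OF Ck_param_power[OF P(1)] E2]] Ck_param_minus[OF Ck_param_mult[OF P(1) E1]]])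
qed

text \<open>Stated for arbitrary \<open>c\<close> and any \<open>L\<close> with derivative
  \<open>U' / (U - c)\<close>, so that it serves real speeds with \<open>log_branch\<close> as well
  as complex speeds with the principal logarithm.\<close>

lemma layer_deriv:
  assumes t: "t \<in> chart_dom" "d \<in> speeds" and c: "c \<noteq> of_real (U (X t d))"
    and ode: "ode_at k c f g UNIV (X t d)"
    and L: "(L has_vector_derivative of_real (DU 1 (X t d)) / (of_real (U (X t d)) - c)) (at (X t d))"
  shows "((\<lambda>t. (f (X t d), g (X t d) - of_real (P0 (X t d)) * L (X t d) * f (X t d))) has_vector_derivative
     (Xd t d *\<^sub>R sysmat k (X t d) (L (X t d)))
       (f (X t d), g (X t d) - of_real (P0 (X t d)) * L (X t d) * f (X t d))) (at t)"
proof -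
  have x: "X t d \<in> {0<..<h}" "DU 1 (X t d) \<noteq> 0"
    using X_in[OF t] lo_pos hi_less DU1_X_nz[OF t] by auto
  have "((\<lambda>x. (f x, g x - of_real (P0 x) * L x * f x)) has_vector_derivative
     sysmat k (X t d) (L (X t d)) (f (X t d), g (X t d) - of_real (P0 (X t d)) * L (X t d) * f (X t d))) (at (X t d))"
    by (rule sysmat_deriv[OF x, where c = c]) (use c ode L in \<open>auto simp: ode_at_def\<close>)
  moreover have "((\<lambda>t. X t d) has_vector_derivative Xd t d) (at t)"
    using X_deriv[OF t] by (simp add: has_real_derivative_iff_has_vector_derivative)
  ultimately show ?thesis
    using vector_diff_chain_at[of "\<lambda>t. X t d" "Xd t d" t
        "\<lambda>x. (f x, g x - of_real (P0 x) * L x * f x)"] by (auto simp: o_def blinfun.scaleR_left)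
qed

lemma real_layer_deriv:
  assumes t: "t \<in> chart_dom" "d \<in> speeds" "t \<noteq> 0"
    and ode: "ode_at k (of_real (cs + d)) f g UNIV (X t d)"
    and Y: "\<And>x. Lx x = log_branch \<sigma> (U x - (cs + d))"
  shows "((\<lambda>t. (f (X t d), g (X t d) - of_real (P0 (X t d)) * Lx (X t d) * f (X t d))) has_vector_derivative
     chart_mat \<sigma> k t d (f (X t d), g (X t d) - of_real (P0 (X t d)) * Lx (X t d) * f (X t d))) (at t)"
proof -
  define w where "w = U (X t d) - (cs + d)"
  have "t ^ (2 * q + 1) * (eta - rho * d * t) \<noteq> 0"
    using t rdt_pos[OF t(1,2)] eta by simp
  then have w: "w \<noteq> 0" unfolding w_def U_X_minus_rho[OF t(1,2)] using rho by auto
  have L: "(Lx has_vector_derivative of_real (DU 1 (X t d)) / (of_real (U (X t d)) - of_real (cs + d))) (at (X t d))"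
  proof -
    have "((\<lambda>x. U x - (cs + d)) has_real_derivative DU 1 (X t d)) (at (X t d))"
      using U_deriv[of "X t d"] X_in[OF t(1,2)] by (auto intro!: derivative_eq_intros)
    from log_branch_deriv[OF this, of \<sigma>] w show ?thesis by (simp add: w_def Y[abs_def])
  qed
  have "of_real (cs + d) \<noteq> complex_of_real (U (X t d))"
    unfolding of_real_eq_iff using w by (simp add: w_def)
  from layer_deriv[OF t(1,2) this ode L] show ?thesis
    by (simp only: chart_mat_eq[OF t] Y)
qed

lemma layer_image_right:
  assumes "d \<in> speeds" "t1 \<in> {0<..1}" "x \<in> {X 0 d<..<X t1 d}"
  obtains t where "t \<in> {0<..<t1}" "X t d = x"
proof -
  have "\<exists>t. 0 \<le> t \<and> t \<le> t1 \<and> X t d = x"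
    by (rule IVT') (use assms in \<open>auto intro: continuous_on_subset[OF X_cont]\<close>)
  then obtain t where "0 \<le> t" "t \<le> t1" "X t d = x" by blast
  moreover from this have "t \<noteq> 0" "t \<noteq> t1" using assms by auto
  ultimately show ?thesis by (intro that[of t]) auto
qed

lemma layer_image_left:
  assumes "d \<in> speeds" "t1 \<in> {0<..1}" "x \<in> {X (-t1) d<..<X 0 d}"
  obtains t where "t \<in> {-t1<..<0}" "X t d = x"
proof -
  have "\<exists>t. - t1 \<le> t \<and> t \<le> 0 \<and> X t d = x"
    by (rule IVT') (use assms in \<open>auto intro: continuous_on_subset[OF X_cont]\<close>)
  then obtain t where "- t1 \<le> t" "t \<le> 0" "X t d = x" by blast
  moreover from this have "t \<noteq> 0" "t \<noteq> - t1" using assms by auto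
  ultimately show ?thesis by (intro that[of t]) auto
qed

text \<open>By monotonicity and the intermediate value theorem \<open>X\<close> maps right
  neighbourhoods of 0 onto right neighbourhoods of the layer, so limits in \<open>t\<close> are
  limits in \<open>x\<close>.\<close>

lemma layer_lim_right:
  assumes d: "d \<in> speeds" and lim: "((\<lambda>t. G (X t d)) \<longlongrightarrow> L) (at_right 0)"
  shows "(G \<longlongrightarrow> L) (at_right (X 0 d))"
proof (rule topological_tendstoI)
  fix S assume "open S" "L \<in> S"
  then have "\<forall>\<^sub>F t in at_right 0. G (X t d) \<in> S" by (rule topological_tendstoD[OF lim])
  then obtain b where b: "b > 0" "\<And>t. 0 < t \<Longrightarrow> t < b \<Longrightarrow> G (X t d) \<in> S"
    unfolding eventually_at_right_field by blast
  define t1 where "t1 = min b 1"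
  have t1: "t1 \<in> {0<..1}" "t1 \<le> b" using b by (auto simp: t1_def)
  show "\<forall>\<^sub>F x in at_right (X 0 d). G x \<in> S"
    unfolding eventually_at_right_field
  proof (intro exI[of _ "X t1 d"] conjI allI impI)
    show "X 0 d < X t1 d" by (rule X_mono[OF d]) (use t1 in auto)
    fix x assume "X 0 d < x" "x < X t1 d"
    then obtain t where "t \<in> {0<..<t1}" "X t d = x" using layer_image_right[OF d t1(1), of x] by auto
    then show "G x \<in> S" using b(2)[of t] t1 by auto
  qed
qed

lemma layer_lim_left:
  assumes d: "d \<in> speeds" and lim: "((\<lambda>t. G (X t d)) \<longlongrightarrow> L) (at_left 0)"
  shows "(G \<longlongrightarrow> L) (at_left (X 0 d))"
proof (rule topological_tendstoI)
  fix S assume "open S" "L \<in> S"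
  then have "\<forall>\<^sub>F t in at_left 0. G (X t d) \<in> S" by (rule topological_tendstoD[OF lim])
  then obtain b where b: "b < 0" "\<And>t. b < t \<Longrightarrow> t < 0 \<Longrightarrow> G (X t d) \<in> S"
    unfolding eventually_at_left_field by blast
  define t1 where "t1 = min (-b) 1"
  have t1: "t1 \<in> {0<..1}" "t1 \<le> -b" using b by (auto simp: t1_def)
  show "\<forall>\<^sub>F x in at_left (X 0 d). G x \<in> S"
    unfolding eventually_at_left_field
  proof (intro exI[of _ "X (-t1) d"] conjI allI impI)
    show "X (-t1) d < X 0 d" by (rule X_mono[OF d]) (use t1 in auto)
    fix x assume "X (-t1) d < x" "x < X 0 d"
    then obtain t where "t \<in> {-t1<..<0}" "X t d = x" using layer_image_left[OF d t1(1), of x] by auto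
    then show "G x \<in> S" using b(2)[of t] t1 by auto
  qed
qed

lemma layer_lim:
  assumes "d \<in> speeds" "((\<lambda>t. G (X t d)) \<longlongrightarrow> L) (at 0)"
  shows "(G \<longlongrightarrow> L) (at (X 0 d))"
  using layer_lim_right[OF assms(1), of G L] layer_lim_left[OF assms(1), of G L] assms(2)
  by (simp add: filterlim_at_split)

end

section \<open>One-sided limits and the jump condition\<close>

lemma at_within_le_at: "at x within S \<le> at x"
  by (rule at_le) simp

lemma at_left_via_right: "filterlim G F (at_left a) \<longleftrightarrow> filterlim (\<lambda>t. G (a - t)) F (at_right (0::real))" for a :: real
  unfolding filterlim_at_left_to_right[of G F a] filterlim_at_right_to_0[of _ F "- a"]
  by (simp add: algebra_simps)

lemma at_right_via_right: "filterlim G F (at_right a) \<longleftrightarrow> filterlim (\<lambda>t. G (a + t)) F (at_right (0::real))" for a :: real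
  unfolding filterlim_at_right_to_0[of G F a] by (simp add: add.commute)

context layer
begin

lemma chart_mat_bounded:
  assumes "\<bar>\<sigma>\<bar> \<le> 1" "d \<in> speeds"
  obtains C where "C > 0" "\<And>t. t \<in> chart_dom \<Longrightarrow> norm (chart_mat \<sigma> k t d) \<le> C"
proof (rule Ck_param_bounded[of chart_dom d speeds 0 "chart_mat \<sigma> k"])
  show "Ck_param 0 chart_dom speeds (chart_mat \<sigma> k)" by (rule Ck_param_chart_mat) (use l_ge assms in auto)
qed (use assms that in auto)

lemma t_log_branch_tendsto:
  assumes "\<bar>\<sigma>\<bar> \<le> 1" "d \<in> speeds"
  shows "((\<lambda>t. of_real t * log_branch \<sigma> (U (X t d) - (cs + d))) \<longlongrightarrow> 0) (at 0)"
proof -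
  have "((\<lambda>t. of_real t * complex_of_real (ln (eta - rho * d * t))) \<longlongrightarrow>
      of_real 0 * of_real (ln (eta - rho * d * 0))) (at 0)"
    using eta by (intro tendsto_intros) auto
  from tendsto_add[OF t_ell_tendsto[OF assms(1)] this]
  have lim: "((\<lambda>t. of_real t * (ell \<sigma> t + of_real (ln (eta - rho * d * t)))) \<longlongrightarrow> 0) (at 0)"
    by (simp add: distrib_left)
  have "\<forall>\<^sub>F t in at 0. of_real t * (ell \<sigma> t + of_real (ln (eta - rho * d * t))) =
      of_real t * log_branch \<sigma> (U (X t d) - (cs + d))"
    unfolding eventually_at
  proof (intro exI[of _ 1] conjI ballI impI)
    fix t :: real assume "t \<noteq> 0 \<and> dist t 0 < 1"
    then show "of_real t * (ell \<sigma> t + of_real (ln (eta - rho * d * t))) =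
      of_real t * log_branch \<sigma> (U (X t d) - (cs + d))"
      using log_branch_X[OF _ assms(2), of t \<sigma>] by (auto simp: abs_less_iff)
  qed simp
  then show ?thesis using lim by (rule Lim_transform_eventually[rotated])
qed

text \<open>The sign \<open>e\<close> reflects \<open>t\<close>, so one argument covers both sides
  of the layer. The last limit holds because \<open>f - f0\<close> is \<open>O(t)\<close> while the
  logarithm is \<open>o(1/t)\<close>.\<close>

lemma layer_limits_t:
  assumes d: "d \<in> speeds" and \<sigma>: "\<bar>\<sigma>\<bar> \<le> 1" and e: "e = 1 \<or> e = -1"
    and ode: "\<And>x. x \<in> {lo<..<hi} \<Longrightarrow> U x \<noteq> cs + d \<Longrightarrow> ode_at k (of_real (cs + d)) f g UNIV x"
    and v: "\<And>x. v x = g x - of_real (P0 x) * log_branch \<sigma> (U x - (cs + d)) * f x"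
  shows "\<exists>f0 v0. ((\<lambda>t. f (X (e * t) d)) \<longlongrightarrow> f0) (at_right 0) \<and>
    ((\<lambda>t. v (X (e * t) d)) \<longlongrightarrow> v0) (at_right 0) \<and>
    ((\<lambda>t. (f (X (e * t) d) - f0) * log_branch \<sigma> (U (X (e * t) d) - (cs + d))) \<longlongrightarrow> 0) (at_right 0)"
proof -
  obtain C where C: "C > 0" "\<And>t. t \<in> chart_dom \<Longrightarrow> norm (chart_mat \<sigma> k t d) \<le> C"
    using chart_mat_bounded[OF \<sigma> d] by blast
  define Y where "Y t = (f (X t d), v (X t d))" for t
  have et: "e * t \<in> chart_dom" "e * t \<noteq> 0" "\<bar>e * t\<bar> = t" if "t \<in> {0<..1}" for t using e that by auto
  have dY: "(Y has_vector_derivative chart_mat \<sigma> k t d (Y t)) (at t)" if t: "t \<in> chart_dom" "t \<noteq> 0" for t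
    unfolding Y_def v
  proof (rule real_layer_deriv[OF t(1) d t(2)])
    have "t ^ (2 * q + 1) * (eta - rho * d * t) \<noteq> 0"
      using t rdt_pos[OF t(1) d] eta by simp
    then have "U (X t d) - (cs + d) \<noteq> 0" unfolding U_X_minus_rho[OF t(1) d] using rho by auto
    then show "ode_at k (of_real (cs + d)) f g UNIV (X t d)"
      using ode X_in[OF t(1) d] by auto
  qed simp
  have dY': "((\<lambda>t. Y (e * t)) has_vector_derivative e *\<^sub>R chart_mat \<sigma> k (e * t) d (Y (e * t))) (at t)"
    if t: "t \<in> {0<..1}" for t
  proof -
    have "((\<lambda>t. e * t) has_vector_derivative e) (at t)"
      by (auto intro!: derivative_eq_intros)
    from vector_diff_chain_at[OF this dY[OF et(1,2)[OF t]]] show ?thesis by (simp add: o_def)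
  qed
  have bd: "norm (e *\<^sub>R chart_mat \<sigma> k (e * t) d (Y (e * t))) \<le> C * norm (Y (e * t))" if t: "t \<in> {0<..1}" for t
  proof -
    have "norm (chart_mat \<sigma> k (e * t) d (Y (e * t))) \<le> C * norm (Y (e * t))"
      by (rule order_trans[OF norm_blinfun mult_right_mono[OF C(2)[OF et(1)[OF t]]]]) simp
    then show ?thesis using e by auto
  qed
  obtain Y0 K where Y0: "((\<lambda>t. Y (e * t)) \<longlongrightarrow> Y0) (at_right 0)"
    and K: "\<And>t. t \<in> {0<..1} \<Longrightarrow> norm (Y (e * t) - Y0) \<le> K * t"
    by (rule ode_half_limit[where Y = "\<lambda>t. Y (e * t)" and C = C
          and Y' = "\<lambda>t. e *\<^sub>R chart_mat \<sigma> k (e * t) d (Y (e * t))"], erule dY', erule bd,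
        use C in simp, rule that)
  have lim: "((\<lambda>t. of_real (e * t) * log_branch \<sigma> (U (X (e * t) d) - (cs + d))) \<longlongrightarrow> 0) (at_right 0)"
  proof (rule filterlim_compose[OF t_log_branch_tendsto[OF \<sigma> d]])
    show "filterlim (\<lambda>t. e * t) (at 0) (at_right 0)"
    proof (rule filterlim_atI)
      show "((\<lambda>t. e * t) \<longlongrightarrow> 0) (at_right 0)"
        by (rule tendsto_eq_intros refl)+ simp
      show "\<forall>\<^sub>F t in at_right 0. e * t \<noteq> 0"
        using e unfolding eventually_at_right_field by (intro exI[of _ 1]) auto
    qed
  qed
  show ?thesis
  proof (rule exI[of _ "fst Y0"], rule exI[of _ "snd Y0"], intro conjI)
    show "((\<lambda>t. f (X (e * t) d)) \<longlongrightarrow> fst Y0) (at_right 0)"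
      using tendsto_fst[OF Y0] by (simp add: Y_def)
    show "((\<lambda>t. v (X (e * t) d)) \<longlongrightarrow> snd Y0) (at_right 0)"
      using tendsto_snd[OF Y0] by (simp add: Y_def)
    show "((\<lambda>t. (f (X (e * t) d) - fst Y0) * log_branch \<sigma> (U (X (e * t) d) - (cs + d))) \<longlongrightarrow> 0) (at_right 0)"
    proof (rule Lim_null_comparison)
      show "\<forall>\<^sub>F t in at_right 0. norm ((f (X (e * t) d) - fst Y0) * log_branch \<sigma> (U (X (e * t) d) - (cs + d)))
          \<le> K * norm (of_real (e * t) * log_branch \<sigma> (U (X (e * t) d) - (cs + d)))"
        unfolding eventually_at_right_field
      proof (intro exI[of _ 1] conjI allI impI)
        fix t :: real assume "0 < t" "t < 1"
        then have t: "t \<in> {0<..1}" by auto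
        have "norm (f (X (e * t) d) - fst Y0) \<le> norm (Y (e * t) - Y0)"
          using norm_fst_le[of "f (X (e * t) d) - fst Y0" "v (X (e * t) d) - snd Y0"]
          by (cases Y0) (simp add: Y_def)
        also note K[OF t]
        finally show "norm ((f (X (e * t) d) - fst Y0) * log_branch \<sigma> (U (X (e * t) d) - (cs + d)))
          \<le> K * norm (of_real (e * t) * log_branch \<sigma> (U (X (e * t) d) - (cs + d)))"
          unfolding norm_mult norm_of_real et(3)[OF t] by (simp only: mult.assoc[symmetric] mult_right_mono norm_ge_zero)
      qed simp
      show "((\<lambda>t. K * norm (of_real (e * t) * log_branch \<sigma> (U (X (e * t) d) - (cs + d)))) \<longlongrightarrow> 0) (at_right 0)"
        using tendsto_mult_right_zero[OF tendsto_norm_zero[OF lim]] .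
    qed
  qed
qed

lemma layer_limits:
  assumes d: "d \<in> speeds" and \<sigma>: "\<bar>\<sigma>\<bar> \<le> 1"
    and ode: "\<And>x. x \<in> {lo<..<hi} \<Longrightarrow> U x \<noteq> cs + d \<Longrightarrow> ode_at k (of_real (cs + d)) f g UNIV x"
    and v: "\<And>x. v x = g x - of_real (P0 x) * log_branch \<sigma> (U x - (cs + d)) * f x"
  shows "\<exists>fr vr fl vl. (f \<longlongrightarrow> fr) (at_right (X 0 d)) \<and> (v \<longlongrightarrow> vr) (at_right (X 0 d)) \<and>
    ((\<lambda>x. (f x - fr) * log_branch \<sigma> (U x - (cs + d))) \<longlongrightarrow> 0) (at_right (X 0 d)) \<and>
    (f \<longlongrightarrow> fl) (at_left (X 0 d)) \<and> (v \<longlongrightarrow> vl) (at_left (X 0 d)) \<and>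
    ((\<lambda>x. (f x - fl) * log_branch \<sigma> (U x - (cs + d))) \<longlongrightarrow> 0) (at_left (X 0 d))"
proof -
  have ex: "\<exists>f0 v0. ((\<lambda>t. f (X (e * t) d)) \<longlongrightarrow> f0) (at_right 0) \<and>
    ((\<lambda>t. v (X (e * t) d)) \<longlongrightarrow> v0) (at_right 0) \<and>
    ((\<lambda>t. (f (X (e * t) d) - f0) * log_branch \<sigma> (U (X (e * t) d) - (cs + d))) \<longlongrightarrow> 0) (at_right 0)"
    if e: "e = 1 \<or> e = -1" for e
    by (rule layer_limits_t[where k = k and g = g]) (fact d \<sigma> e ode v)+
  obtain fr vr where r: "((\<lambda>t. f (X (1 * t) d)) \<longlongrightarrow> fr) (at_right 0)"
    "((\<lambda>t. v (X (1 * t) d)) \<longlongrightarrow> vr) (at_right 0)"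
    "((\<lambda>t. (f (X (1 * t) d) - fr) * log_branch \<sigma> (U (X (1 * t) d) - (cs + d))) \<longlongrightarrow> 0) (at_right 0)"
    using ex[of 1] by blast
  obtain fl vl where l: "((\<lambda>t. f (X (-1 * t) d)) \<longlongrightarrow> fl) (at_right 0)"
    "((\<lambda>t. v (X (-1 * t) d)) \<longlongrightarrow> vl) (at_right 0)"
    "((\<lambda>t. (f (X (-1 * t) d) - fl) * log_branch \<sigma> (U (X (-1 * t) d) - (cs + d))) \<longlongrightarrow> 0) (at_right 0)"
    using ex[of "-1"] by blast
  have conv: "((\<lambda>t. G (X t d)) \<longlongrightarrow> L) (at_left 0)" if "((\<lambda>t. G (X (-1 * t) d)) \<longlongrightarrow> L) (at_right 0)"
    for G :: "real \<Rightarrow> complex" and L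
    using that at_left_via_right[of "\<lambda>t. G (X t d)" "nhds L" 0] by simp
  show ?thesis
    by (intro exI conjI) (rule layer_lim_right[OF d r(1)[unfolded mult_1]] layer_lim_right[OF d r(2)[unfolded mult_1]]
          layer_lim_right[OF d r(3)[unfolded mult_1]] layer_lim_left[OF d conv[OF l(1)]]
          layer_lim_left[OF d conv[OF l(2)]] layer_lim_left[OF d conv[OF l(3)]])+
qed

text \<open>Along the chart \<open>P0\<close> is differentiable at \<open>t = 0\<close>, so its
  increment is \<open>O(t)\<close>, and \<open>t\<close> times the logarithm tends to 0.\<close>

lemma P0_log_branch_tendsto:
  assumes d: "d \<in> speeds" and \<sigma>: "\<bar>\<sigma>\<bar> \<le> 1"
  shows "((\<lambda>x. of_real (P0 x - P0 (X 0 d)) * log_branch \<sigma> (U x - (cs + d))) \<longlongrightarrow> 0) (at (X 0 d))"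
proof (rule layer_lim[OF d])
  have x: "X 0 d \<in> {0<..<h}" "DU 1 (X 0 d) \<noteq> 0"
    using X_in[of 0 d] lo_pos hi_less DU1_X_nz[of 0 d] d by auto
  have "((\<lambda>t. P0 (X t d)) has_real_derivative P1 (X 0 d) * Xd 0 d) (at 0)"
    by (rule DERIV_chain2[OF P0_deriv[OF x] X_deriv]) (use d in auto)
  then have "((\<lambda>t. complex_of_real ((P0 (X t d) - P0 (X 0 d)) / (t - 0))) \<longlongrightarrow> of_real (P1 (X 0 d) * Xd 0 d)) (at 0)"
    unfolding has_field_derivative_iff by (rule tendsto_of_real)
  from tendsto_mult[OF this t_log_branch_tendsto[OF \<sigma> d]]
  have lim: "((\<lambda>t. of_real ((P0 (X t d) - P0 (X 0 d)) / (t - 0)) * (of_real t * log_branch \<sigma> (U (X t d) - (cs + d)))) \<longlongrightarrow> 0) (at 0)"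
    by simp
  show "((\<lambda>t. of_real (P0 (X t d) - P0 (X 0 d)) * log_branch \<sigma> (U (X t d) - (cs + d))) \<longlongrightarrow> 0) (at 0)"
    by (rule Lim_transform_eventually[OF lim]) (auto simp: eventually_at_filter)
qed

text \<open>Both difference quotients of \<open>U\<close> tend to \<open>U'\<close>, so the real
  parts at \<open>x0 + t\<close> and \<open>x0 - t\<close> cancel in the limit. What is left is the
  imaginary constant on the side where \<open>U < cs + d\<close>: the left one when
  \<open>rho = 1\<close>, the right one when \<open>rho = -1\<close>.\<close>

lemma log_branch_jump:
  assumes d: "d \<in> speeds"
  shows "((\<lambda>t. log_branch \<sigma> (U (X 0 d + t) - (cs + d)) - log_branch \<sigma> (U (X 0 d - t) - (cs + d))) \<longlongrightarrow>
     \<i> * of_real (\<sigma> * pi * rho)) (at_right 0)"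
proof -
  define x0 where "x0 = X 0 d"
  have x0: "x0 \<in> {lo<..<hi}" "U x0 = cs + d" using X_in[of 0 d] U_X[of 0 d] d by (auto simp: x0_def ev_def)
  define D where "D = DU 1 x0"
  have D: "D \<noteq> 0" using DU1_nz[OF x0(1)] by (simp add: D_def)
  have der: "((\<lambda>h. (U (x0 + h) - U x0) / h) \<longlongrightarrow> D) (at 0)"
    using U_deriv[of x0] x0(1) by (simp add: DERIV_def D_def)
  have r: "((\<lambda>t. (U (x0 + t) - U x0) / t) \<longlongrightarrow> D) (at_right 0)"
    using der by (simp add: filterlim_at_split)
  have l: "((\<lambda>t. (U (x0 - t) - U x0) / (- t)) \<longlongrightarrow> D) (at_right 0)"
    using der at_left_via_right[of "\<lambda>h. (U (x0 + h) - U x0) / h" "nhds D" 0] by (simp add: filterlim_at_split)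
  have "((\<lambda>t. ln \<bar>(U (x0 + t) - U x0) / t\<bar> - ln \<bar>(U (x0 - t) - U x0) / (- t)\<bar>) \<longlongrightarrow> ln \<bar>D\<bar> - ln \<bar>D\<bar>) (at_right 0)"
    using D by (intro tendsto_intros r l) auto
  then have lim: "((\<lambda>t. complex_of_real (ln \<bar>(U (x0 + t) - U x0) / t\<bar> - ln \<bar>(U (x0 - t) - U x0) / (- t)\<bar>)
      + \<i> * of_real (\<sigma> * pi * rho)) \<longlongrightarrow> of_real 0 + \<i> * of_real (\<sigma> * pi * rho)) (at_right 0)"
    by (intro tendsto_intros) simp
  have ev: "\<forall>\<^sub>F t in at_right 0. complex_of_real (ln \<bar>(U (x0 + t) - U x0) / t\<bar> - ln \<bar>(U (x0 - t) - U x0) / (- t)\<bar>)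
      + \<i> * of_real (\<sigma> * pi * rho) = log_branch \<sigma> (U (x0 + t) - (cs + d)) - log_branch \<sigma> (U (x0 - t) - (cs + d))"
    unfolding eventually_at_right_field
  proof (intro exI[of _ "min (x0 - lo) (hi - x0)"] conjI allI impI)
    fix t assume t: "0 < t" "t < min (x0 - lo) (hi - x0)"
    have "rho * U x0 < rho * U (x0 + t)" "rho * U (x0 - t) < rho * U x0"
      using U_mono[of x0 "x0 + t"] U_mono[of "x0 - t" x0] x0 t by auto
    then have pos: "rho * (U (x0 + t) - U x0) > 0" "rho * (U (x0 - t) - U x0) < 0"
      by (simp_all add: algebra_simps)
    then have nz: "U (x0 + t) - U x0 \<noteq> 0" "U (x0 - t) - U x0 \<noteq> 0" by auto
    have a: "ln \<bar>(U (x0 + t) - U x0) / t\<bar> = ln \<bar>U (x0 + t) - U x0\<bar> - ln t"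
      "ln \<bar>(U (x0 - t) - U x0) / (- t)\<bar> = ln \<bar>U (x0 - t) - U x0\<bar> - ln t"
      using nz t by (simp_all add: abs_divide ln_div)
    show "complex_of_real (ln \<bar>(U (x0 + t) - U x0) / t\<bar> - ln \<bar>(U (x0 - t) - U x0) / (- t)\<bar>)
      + \<i> * of_real (\<sigma> * pi * rho) = log_branch \<sigma> (U (x0 + t) - (cs + d)) - log_branch \<sigma> (U (x0 - t) - (cs + d))"
      unfolding a log_branch_def x0(2)[symmetric] using pos rho by auto
  qed (use x0 in auto)
  show ?thesis
    unfolding x0_def[symmetric]
    using Lim_transform_eventually[OF lim ev] by simp
qed

text \<open>Near the layer \<open>g\<close> is a constant multiple of \<open>L\<close> plus a
  function with one-sided limits \<open>vr\<close> and \<open>vl\<close>. The jump of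
  \<open>L\<close> contributes exactly the prescribed jump, because
  \<open>rho P0 = U'' / |U'|\<close>; the rest of the jump of \<open>g\<close> is
  \<open>vr - vl\<close>, so the condition says that \<open>v\<close> has a two-sided limit.\<close>

lemma jump_iff:
  assumes d: "d \<in> speeds" and \<sigma>: "\<bar>\<sigma>\<bar> \<le> 1"
    and ode: "\<And>x. x \<in> {lo<..<hi} \<Longrightarrow> U x \<noteq> cs + d \<Longrightarrow> ode_at k (of_real (cs + d)) f g UNIV x"
    and f: "(f \<longlongrightarrow> f (X 0 d)) (at_left (X 0 d))" "(f \<longlongrightarrow> f (X 0 d)) (at_right (X 0 d))"
  shows "((\<lambda>t. g (X 0 d + t) - g (X 0 d - t)) \<longlongrightarrow>
      \<i> * of_real \<sigma> * of_real (pi * DU 2 (X 0 d) / \<bar>DU 1 (X 0 d)\<bar>) * f (X 0 d)) (at_right 0) \<longleftrightarrow>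
    (\<exists>v0. ((\<lambda>x. g x - of_real (P0 x) * log_branch \<sigma> (U x - (cs + d)) * f x) \<longlongrightarrow> v0) (at (X 0 d)))"
proof -
  define x0 where "x0 = X 0 d"
  have x0: "x0 \<in> {lo<..<hi}" using X_in[of 0 d] d by (auto simp: x0_def)
  define L where "L x = log_branch \<sigma> (U x - (cs + d))" for x
  define v where "v x = g x - of_real (P0 x) * L x * f x" for x
  obtain fr vr fl vl where lim: "(f \<longlongrightarrow> fr) (at_right x0)" "(v \<longlongrightarrow> vr) (at_right x0)"
    "((\<lambda>x. (f x - fr) * L x) \<longlongrightarrow> 0) (at_right x0)"
    "(f \<longlongrightarrow> fl) (at_left x0)" "(v \<longlongrightarrow> vl) (at_left x0)"
    "((\<lambda>x. (f x - fl) * L x) \<longlongrightarrow> 0) (at_left x0)"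
  proof -
    have "\<exists>fr vr fl vl. (f \<longlongrightarrow> fr) (at_right x0) \<and> (v \<longlongrightarrow> vr) (at_right x0) \<and>
    ((\<lambda>x. (f x - fr) * L x) \<longlongrightarrow> 0) (at_right x0) \<and>
    (f \<longlongrightarrow> fl) (at_left x0) \<and> (v \<longlongrightarrow> vl) (at_left x0) \<and>
    ((\<lambda>x. (f x - fl) * L x) \<longlongrightarrow> 0) (at_left x0)"
      unfolding x0_def L_def
      by (rule layer_limits[where k = k and g = g]) (fact d \<sigma> ode v_def[unfolded L_def])+
    then show ?thesis using that by blast
  qed
  have eq: "fr = f x0" "fl = f x0"
    using tendsto_unique[OF _ lim(1) f(2)[folded x0_def]] tendsto_unique[OF _ lim(4) f(1)[folded x0_def]]
    by simp_all
  define J where "J = \<i> * of_real (\<sigma> * pi * rho)"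
  have P: "((\<lambda>x. of_real (P0 x - P0 x0) * L x) \<longlongrightarrow> 0) (at x0)"
    unfolding L_def x0_def by (rule P0_log_branch_tendsto[OF d \<sigma>])
  have "isCont P0 x0"
    using P0_deriv[of x0] DU1_nz[OF x0] x0 lo_pos hi_less by (auto intro: DERIV_isCont)
  then have Pc: "((\<lambda>x. complex_of_real (P0 x)) \<longlongrightarrow> of_real (P0 x0)) (at x0)"
    by (intro tendsto_of_real) (simp add: isCont_def)
  \<comment> \<open>\<open>g\<close> with \<open>L\<close> removed at the coefficient it has in the
    layer. The increments of \<open>f\<close> and \<open>P0\<close> times \<open>L\<close> tend to
    0, so \<open>w\<close> has the one-sided limits of \<open>v\<close>.\<close>
  define w where "w x = v x + of_real (P0 x) * ((f x - f x0) * L x) + of_real (P0 x - P0 x0) * L x * f x0" for x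
  have wr: "(w \<longlongrightarrow> vr + of_real (P0 x0) * 0 + 0 * f x0) (at_right x0)"
    unfolding w_def
    by (intro tendsto_add tendsto_mult tendsto_const lim(2) lim(3)[unfolded eq]
        filterlim_mono[OF P order_refl at_within_le_at] filterlim_mono[OF Pc order_refl at_within_le_at])
  have wl: "(w \<longlongrightarrow> vl + of_real (P0 x0) * 0 + 0 * f x0) (at_left x0)"
    unfolding w_def
    by (intro tendsto_add tendsto_mult tendsto_const lim(5) lim(6)[unfolded eq]
        filterlim_mono[OF P order_refl at_within_le_at] filterlim_mono[OF Pc order_refl at_within_le_at])
  have g: "g x = w x + of_real (P0 x0) * f x0 * L x" for x
    by (simp add: w_def v_def algebra_simps)
  have "((\<lambda>t. w (x0 + t) - w (x0 - t) + of_real (P0 x0) * f x0 * (L (x0 + t) - L (x0 - t))) \<longlongrightarrow>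
      (vr + of_real (P0 x0) * 0 + 0 * f x0) - (vl + of_real (P0 x0) * 0 + 0 * f x0) + of_real (P0 x0) * f x0 * J) (at_right 0)"
    using wr wl log_branch_jump[OF d, of \<sigma>] unfolding at_right_via_right[of w] at_left_via_right[of w]
    by (intro tendsto_add tendsto_diff tendsto_mult tendsto_const) (simp_all add: L_def x0_def J_def)
  then have gl: "((\<lambda>t. g (x0 + t) - g (x0 - t)) \<longlongrightarrow> vr - vl + of_real (P0 x0) * f x0 * J) (at_right 0)"
    by (simp add: g algebra_simps)
  have "\<bar>DU 1 x0\<bar> = rho * DU 1 x0" using slope[OF x0] rho by auto
  then have "DU 2 x0 / \<bar>DU 1 x0\<bar> = rho * P0 x0" using rho by (auto simp: P0_def)
  then have Jeq: "of_real (P0 x0) * f x0 * J = \<i> * of_real \<sigma> * of_real (pi * DU 2 x0 / \<bar>DU 1 x0\<bar>) * f x0"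
    by (simp add: J_def times_divide_eq_right[symmetric] del: times_divide_eq_right)
  have "((\<lambda>t. g (x0 + t) - g (x0 - t)) \<longlongrightarrow>
      \<i> * of_real \<sigma> * of_real (pi * DU 2 x0 / \<bar>DU 1 x0\<bar>) * f x0) (at_right 0) \<longleftrightarrow> vr = vl"
    unfolding Jeq[symmetric]
  proof
    assume a: "((\<lambda>t. g (x0 + t) - g (x0 - t)) \<longlongrightarrow> of_real (P0 x0) * f x0 * J) (at_right 0)"
    show "vr = vl" using tendsto_unique[OF _ gl a] by simp
  next
    assume "vr = vl"
    then show "((\<lambda>t. g (x0 + t) - g (x0 - t)) \<longlongrightarrow> of_real (P0 x0) * f x0 * J) (at_right 0)" using gl by simp
  qed
  also have "\<dots> \<longleftrightarrow> (\<exists>v0. (v \<longlongrightarrow> v0) (at x0))"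
  proof
    assume "vr = vl"
    then show "\<exists>v0. (v \<longlongrightarrow> v0) (at x0)" using lim(2,5) by (auto simp: filterlim_at_split)
  next
    assume "\<exists>v0. (v \<longlongrightarrow> v0) (at x0)"
    then obtain v0 where v0: "(v \<longlongrightarrow> v0) (at_right x0)" "(v \<longlongrightarrow> v0) (at_left x0)"
      by (auto simp: filterlim_at_split)
    show "vr = vl"
      using tendsto_unique[OF _ lim(2) v0(1)] tendsto_unique[OF _ lim(5) v0(2)] by simp
  qed
  finally show ?thesis unfolding v_def L_def x0_def .
qed

end

text \<open>The radius \<open>r\<close> lets the chart avoid a given point, and \<open>q\<close> is
  left to the caller because the convergence rate dictates it.\<close>

lemma (in profile) layer_exists:
  assumes s: "s \<in> {0<..<h}" "DU 1 s \<noteq> 0" and r: "r > 0" and q: "1 \<le> q"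
  obtains rho eta lo hi V where "layer h U l (U s) rho eta lo hi V q" "s \<in> {lo<..<hi}" "s - r < lo" "hi < s + r"
proof -
  define rho where "rho = sgn (DU 1 s)"
  have rho: "rho = 1 \<or> rho = -1" using s by (auto simp: rho_def sgn_if)
  have "continuous_on {0<..<h} (\<lambda>x. rho * DU 1 x)"
    using DU_cont[of 1] l_ge by (intro continuous_intros) (auto intro: continuous_on_subset)
  then have op: "open ({0<..<h} \<inter> (\<lambda>x. rho * DU 1 x) -` {0<..})"
    by (rule continuous_open_preimage) auto
  have "s \<in> {0<..<h} \<inter> (\<lambda>x. rho * DU 1 x) -` {0<..}"
    using s by (auto simp: rho_def sgn_if)
  with op obtain e where e: "e > 0" "ball s e \<subseteq> {0<..<h} \<inter> (\<lambda>x. rho * DU 1 x) -` {0<..}"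
    using open_contains_ball by blast
  define r' where "r' = min e r / 2"
  have r': "0 < r'" "r' < e" "r' < r" using e r by (auto simp: r'_def)
  have in': "x \<in> {0<..<h}" "0 < rho * DU 1 x" if "\<bar>x - s\<bar> \<le> r'" for x
  proof -
    have "x \<in> ball s e" using that r' by (auto simp: dist_real_def)
    then show "x \<in> {0<..<h}" "0 < rho * DU 1 x" using e(2) by auto
  qed
  define lo where "lo = s - r'"
  define hi where "hi = s + r'"
  have dU: "((\<lambda>x. rho * U x) has_real_derivative rho * DU 1 x) (at x)" if "\<bar>x - s\<bar> \<le> r'" for x
    using DU_deriv[of 0 x] in'[OF that] l_ge by (intro DERIV_cmult) auto
  have mono: "rho * U x < rho * U y" if "lo \<le> x" "x < y" "y \<le> hi" for x y
  proof (rule DERIV_pos_imp_increasing[OF that(2)])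
    fix z assume "x \<le> z" "z \<le> y"
    then have "\<bar>z - s\<bar> \<le> r'" using that by (auto simp: lo_def hi_def)
    then show "\<exists>D. ((\<lambda>x. rho * U x) has_real_derivative D) (at z) \<and> 0 < D"
      using dU in' by blast
  qed
  \<comment> \<open>Half the smaller gap between the value of \<open>U\<close> at \<open>s\<close>
    and at the two ends, so that values within \<open>2 eta\<close> of \<open>U s\<close> are
    attained inside \<open>{lo<..<hi}\<close>.\<close>
  define eta where "eta = min (rho * U hi - rho * U s) (rho * U s - rho * U lo) / 2"
  have eta: "0 < eta" using mono[of s hi] mono[of lo s] r' by (auto simp: eta_def lo_def hi_def)
  have eta_le: "2 * eta \<le> rho * U hi - rho * U s" "2 * eta \<le> rho * U s - rho * U lo"
    by (auto simp: eta_def)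
  have ex: "\<exists>x. x \<in> {lo<..<hi} \<and> U x = e" if "\<bar>e - U s\<bar> < 2 * eta" for e
  proof -
    have a: "\<bar>rho * e - rho * U s\<bar> < 2 * eta" using that rho by auto
    have "\<exists>x. lo \<le> x \<and> x \<le> hi \<and> rho * U x = rho * e"
    proof (rule IVT')
      show "continuous_on {lo..hi} (\<lambda>x. rho * U x)"
        by (rule DERIV_continuous_on[where D = "\<lambda>x. rho * DU 1 x"])
          (rule has_field_derivative_at_within[OF dU], auto simp: lo_def hi_def)
      show "rho * U lo \<le> rho * e" "rho * e \<le> rho * U hi"
        using a eta_le by linarith+
    qed (use r' in \<open>auto simp: lo_def hi_def\<close>)
    then obtain x where x: "lo \<le> x" "x \<le> hi" "rho * U x = rho * e" by blast
    have "rho * U lo < rho * e" "rho * e < rho * U hi" using a eta_le by linarith+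
    then have "x \<noteq> lo" "x \<noteq> hi" using x by auto
    moreover have "U x = e" using x rho by auto
    ultimately show ?thesis using x by (intro exI[of _ x]) auto
  qed
  define V where "V e = (SOME x. x \<in> {lo<..<hi} \<and> U x = e)" for e
  have V: "V e \<in> {lo<..<hi} \<and> U (V e) = e" if "\<bar>e - U s\<bar> < 2 * eta" for e
    unfolding V_def by (rule someI_ex[OF ex[OF that]])
  show ?thesis
  proof
    show "layer h U l (U s) rho eta lo hi V q"
    proof
      show "{lo..hi} \<subseteq> {0<..<h}" using in'(1) by (auto simp: lo_def hi_def)
      show "0 < rho * DU 1 x" if "x \<in> {lo<..<hi}" for x
        using that by (intro in'(2)) (auto simp: lo_def hi_def)
    qed (use rho eta q V r' in \<open>auto simp: lo_def hi_def\<close>)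
  qed (use r' in \<open>auto simp: lo_def hi_def\<close>)
qed

lemma (in layer) chart_cover:
  assumes "d \<in> speeds" "x \<in> {X (-1) d..X 1 d}"
  obtains t where "t \<in> chart_dom" "X t d = x"
proof -
  have "\<exists>t. -1 \<le> t \<and> t \<le> 1 \<and> X t d = x"
    by (rule IVT') (use assms X_cont[OF assms(1)] in auto)
  then show ?thesis using that by auto
qed

lemma (in layer) U_X_ne:
  assumes "t \<in> chart_dom" "d \<in> speeds" "t \<noteq> 0"
  shows "U (X t d) \<noteq> cs + d"
proof -
  have "t ^ (2 * q + 1) * (eta - rho * d * t) \<noteq> 0"
    using assms rdt_pos[OF assms(1,2)] eta by simp
  then have "U (X t d) - (cs + d) \<noteq> 0" unfolding U_X_minus_rho[OF assms(1,2)] using rho by auto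
  then show ?thesis by simp
qed

section \<open>Passing the layers one by one\<close>

context profile
begin

definition regular_speed :: "real \<Rightarrow> bool" where
  "regular_speed c \<longleftrightarrow> c \<notin> {U 0, U h} \<and> (\<forall>x\<in>{0..h}. U x = c \<longrightarrow> DU 1 x \<noteq> 0)"

lemma regular_speed_interior: "regular_speed c \<Longrightarrow> x \<in> {0..h} \<Longrightarrow> U x = c \<Longrightarrow> x \<in> {0<..<h}"
  by (cases "x = 0"; cases "x = h") (auto simp: regular_speed_def)

lemma U_cont: "continuous_on {0..h} U" using DU_cont[of 0] by simp

text \<open>An infinite set of layers would accumulate in \<open>{0..h}\<close>, by continuity at
  another layer, near which \<open>U\<close> is injective.\<close>

lemma finite_layers:
  assumes "regular_speed c"
  shows "finite {x \<in> {0..h}. U x = c}"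
proof -
  let ?S = "{x \<in> {0..h}. U x = c}"
  have "closed ?S"
    using continuous_closed_preimage[OF U_cont, of "{c}"] by (simp add: vimage_def Int_def)
  have "finite ({0..h} \<inter> ?S)"
  proof (rule finite_not_islimpt_in_compact)
    fix z assume "z \<in> {0..h}"
    show "\<not> z islimpt ?S"
    proof
      assume l: "z islimpt ?S"
      then have z: "z \<in> ?S" using \<open>closed ?S\<close> closed_limpt by blast
      then have z': "z \<in> {0<..<h}" "DU 1 z \<noteq> 0"
        using regular_speed_interior[OF assms, of z] assms by (auto simp: regular_speed_def)
      obtain rho eta lo hi V where L: "layer h U l (U z) rho eta lo hi V 1" "z \<in> {lo<..<hi}"
        by (rule layer_exists[OF z' zero_less_one order_refl], rule that)
      obtain y where "y \<in> ?S" "y \<in> {lo<..<hi}" "y \<noteq> z"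
        using l L(2) islimptE[of z ?S "{lo<..<hi}"] by auto
      then show False using layer.U_inj[OF L(1), of y z] L(2) z by auto
    qed
  qed simp
  moreover have "{0..h} \<inter> ?S = ?S" by blast
  ultimately show ?thesis by simp
qed

text \<open>Induction on the number of layers to the right of \<open>x\<close>. Existence, bounds,
  convergence and smoothness all have this form: a property passes leftwards over a layer-free
  interval and from one end of a chart to the other. \<open>P\<close> is never evaluated at a
  layer.\<close>

lemma layer_induct:
  assumes c: "regular_speed c" and base: "P h"
    and regular: "\<And>a b. 0 \<le> a \<Longrightarrow> a \<le> b \<Longrightarrow> b \<le> h \<Longrightarrow> (\<And>x. x \<in> {a..b} \<Longrightarrow> U x \<noteq> c) \<Longrightarrow> P b \<Longrightarrow> P a"
    and layer: "\<And>rho eta lo hi V. layer h U l c rho eta lo hi V q \<Longrightarrow>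
      P (layer.X c rho eta V q 1 0) \<Longrightarrow> P (layer.X c rho eta V q (-1) 0)"
    and q: "1 \<le> q" and x: "x \<in> {0..h}" "U x \<noteq> c"
  shows "P x"
  using x
proof (induction "card {s \<in> {0..h}. U s = c \<and> x < s}" arbitrary: x rule: less_induct)
  case less
  let ?S = "\<lambda>x. {s \<in> {0..h}. U s = c \<and> x < s}"
  have fin: "finite (?S x)" for x by (rule finite_subset[OF _ finite_layers[OF c]]) auto
  show ?case
  proof (cases "?S x = {}")
    case True
    have "U y \<noteq> c" if "y \<in> {x..h}" for y
      using True that less.prems by (cases "y = x") auto
    then show ?thesis using regular[of x h] base less.prems by auto
  next
    case False
    \<comment> \<open>The first layer to the right of \<open>x\<close>; its chart is taken with
      \<open>lo > x\<close>, so that only a layer-free interval remains between \<open>x\<close> and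
      the left end of the chart.\<close>
    define s where "s = Min (?S x)"
    have s: "s \<in> ?S x" "\<And>y. y \<in> ?S x \<Longrightarrow> s \<le> y"
      unfolding s_def using False fin Min_in Min_le by blast+
    then have s': "s \<in> {0<..<h}" "DU 1 s \<noteq> 0" "s - x > 0"
      using regular_speed_interior[OF c, of s] c by (auto simp: regular_speed_def)
    obtain rho eta lo hi V where L: "layer h U l (U s) rho eta lo hi V q" "s \<in> {lo<..<hi}" "s - (s - x) < lo"
      by (rule layer_exists[OF s' q], rule that)
    have L': "layer h U l c rho eta lo hi V q" using L s by auto
    interpret L: layer h U l c rho eta lo hi V q by (rule L')
    define a b where "a = L.X (-1) 0" and "b = L.X 1 0"
    have z: "(0::real) \<in> L.speeds" using L.eta by simp
    have X0: "L.X 0 0 = s" using L.V_U[of s] L s L.eta by (simp add: L.X_0)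
    have ab: "a \<in> {lo<..<hi}" "b \<in> {lo<..<hi}" "a < s" "s < b"
      using L.X_in[of "-1" 0] L.X_in[of 1 0] z L.X_mono[OF z, of "-1" 0] L.X_mono[OF z, of 0 1]
      by (auto simp: a_def b_def X0)
    have U_ne: "U y \<noteq> c" if "y \<in> {lo<..<hi}" "y \<noteq> s" for y
      using L.U_inj[of y s] that L(2) s by auto
    have "P b"
    proof (rule less.hyps)
      have "s \<in> ?S x" "s \<notin> ?S b" by (use s(1) in blast, use ab(4) in simp)
      moreover have "?S b \<subseteq> ?S x"
      proof
        fix y assume "y \<in> ?S b"
        then show "y \<in> ?S x" using ab(4) s'(3) by simp
      qed
      ultimately have "?S b \<subset> ?S x" by blast
      then show "card (?S b) < card (?S x)" by (rule psubset_card_mono[OF fin])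
      show "b \<in> {0..h}" using ab L.lo_pos L.hi_less by auto
      show "U b \<noteq> c" using U_ne ab by auto
    qed
    then have "P a" unfolding a_def b_def using layer[OF L'] by simp
    moreover have "U y \<noteq> c" if "y \<in> {x..a}" for y
    proof
      assume "U y = c"
      then have "y \<noteq> x" using less.prems by auto
      then have "y \<in> ?S x" using that \<open>U y = c\<close> ab L.hi_less less.prems by auto
      then show False using s(2)[of y] that ab by auto
    qed
    ultimately show ?thesis
      using regular[of x a] less.prems ab L(3) L.hi_less by auto
  qed
qed

text \<open>The limiting problem with \<open>g\<close> for the derivative and the jump condition
  traded for a limit of \<open>v\<close> at each layer. No data at \<open>h\<close> are included, so
  the pairs \<open>(f, g)\<close> form a linear space, and nothing is asked of the value of
  \<open>g\<close> at a layer.\<close>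

definition limit_sys :: "real \<Rightarrow> real \<Rightarrow> real \<Rightarrow> (real \<Rightarrow> complex) \<Rightarrow> (real \<Rightarrow> complex) \<Rightarrow> bool" where
  "limit_sys k c \<sigma> f g \<longleftrightarrow>
     (\<forall>x\<in>{0..h}. U x \<noteq> c \<longrightarrow> (f has_vector_derivative g x) (at x within {0..h})) \<and>
     continuous_on {x \<in> {0..h}. U x \<noteq> c} g \<and>
     (\<forall>x\<in>{0<..<h}. U x \<noteq> c \<longrightarrow> ode_at k (of_real c) f g UNIV x) \<and>
     (\<forall>x\<in>{0..h}. U x = c \<longrightarrow> (f \<longlongrightarrow> f x) (at x) \<and>
        (\<exists>v0. ((\<lambda>x. g x - of_real (P0 x) * log_branch \<sigma> (U x - c) * f x) \<longlongrightarrow> v0) (at x)))"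

lemma deriv_within_eq:
  "(f has_vector_derivative D) (at x within {0..h}) \<Longrightarrow> x \<in> {0..h} \<Longrightarrow> deriv_within {0..h} f x = D"
  unfolding deriv_within_def
  using vector_derivative_within_cbox[of 0 h x f D] h_pos by simp

lemma DU_12: "deriv_within {0..h} U = DU 1" "deriv_within {0..h} (DU 1) = DU 2"
  by (simp_all add: DU_def numeral_eq_Suc)

lemma rayleigh_solutionD:
  assumes "rayleigh_solution h U k c S y"
  defines "g \<equiv> deriv_within {0..h} y"
  shows "\<And>x. x \<in> {0..h} - S \<Longrightarrow> (y has_vector_derivative g x) (at x within {0..h})"
    "continuous_on ({0..h} - S) g" "\<And>x. x \<in> {0<..<h} - S \<Longrightarrow> ode_at k c y g UNIV x" "y h = 0" "g h = 1"
proof -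
  note a = assms(1)[unfolded rayleigh_solution_def Let_def, folded g_def]
  show 1: "(y has_vector_derivative g x) (at x within {0..h})" if "x \<in> {0..h} - S" for x
    using a that unfolding g_def deriv_within_def vector_derivative_works[symmetric] by blast
  show "continuous_on ({0..h} - S) g" "y h = 0" "g h = 1" using a by auto
  show "ode_at k c y g UNIV x" if x: "x \<in> {0<..<h} - S" for x
  proof -
    have i: "at x within {0..h} = at x" by (rule at_within_interior) (use x in auto)
    have "g differentiable (at x)" using a x by auto
    then have "(g has_vector_derivative deriv_within {0..h} g x) (at x)"
      unfolding deriv_within_def i by (simp only: vector_derivative_works)
    moreover have "- deriv_within {0..h} g x + rayleigh_coeff h U k c x * y x = 0" using a x by auto
    ultimately show ?thesis
      using 1[of x] x unfolding ode_at_def i rayleigh_coeff_def DU_12 by (auto simp: i)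
  qed
qed

lemma rayleigh_solutionI:
  assumes f: "\<And>x. x \<in> {0..h} - S \<Longrightarrow> (f has_vector_derivative g x) (at x within {0..h})"
    and g: "continuous_on ({0..h} - S) g" and ode: "\<And>x. x \<in> {0<..<h} - S \<Longrightarrow> ode_at k c f g UNIV x"
    and data: "f h = 0" "g h = 1" "h \<notin> S" and S: "closed S"
  shows "rayleigh_solution h U k c S f"
proof -
  have eq: "deriv_within {0..h} f x = g x" if "x \<in> {0..h} - S" for x
    using deriv_within_eq[OF f[OF that]] that by auto
  have g': "(deriv_within {0..h} f has_vector_derivative
      (of_real (DU 2 x) / (of_real (U x) - c) + of_real (k\<^sup>2)) * f x) (at x)" if x: "x \<in> {0<..<h} - S" for x
  proof (rule has_vector_derivative_transform_within_open[where f = g and S = "{0<..<h} - S"])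
    show "open ({0<..<h} - S)" using S by auto
    show "g y = deriv_within {0..h} f y" if "y \<in> {0<..<h} - S" for y
      using eq[of y] that by auto
  qed (use ode[OF x] x in \<open>auto simp: ode_at_def\<close>)
  show ?thesis
    unfolding rayleigh_solution_def Let_def
  proof (intro conjI ballI)
    show "f differentiable (at x within {0..h})" if "x \<in> {0..h} - S" for x
      by (rule differentiableI_vector[OF f[OF that]])
    show "continuous_on ({0..h} - S) (deriv_within {0..h} f)"
      by (rule continuous_on_eq[OF g]) (simp add: eq)
    show "deriv_within {0..h} f differentiable (at x)" if "x \<in> {0<..<h} - S" for x
      by (rule differentiableI_vector[OF g'[OF that]])
    show "- deriv_within {0..h} (deriv_within {0..h} f) x + rayleigh_coeff h U k c x * f x = 0"
      if x: "x \<in> {0<..<h} - S" for x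
      using deriv_within_eq[OF has_vector_derivative_at_within[OF g'[OF x]]] x
      unfolding rayleigh_coeff_def DU_12 by auto
  qed (use data h_pos eq[of h] in auto)
qed

lemma layer_at:
  assumes "regular_speed c" "s \<in> {0..h}" "U s = c" "1 \<le> q"
  obtains rho eta lo hi V where "layer h U l c rho eta lo hi V q" "s \<in> {lo<..<hi}"
    "layer.X c rho eta V q 0 0 = s" "\<And>x. x \<in> {lo<..<hi} \<Longrightarrow> U x = c \<longleftrightarrow> x = s"
proof -
  have s: "s \<in> {0<..<h}" "DU 1 s \<noteq> 0"
    using regular_speed_interior[OF assms(1-3)] assms by (auto simp: regular_speed_def)
  obtain rho eta lo hi V where L: "layer h U l (U s) rho eta lo hi V q" "s \<in> {lo<..<hi}"
    by (rule layer_exists[OF s zero_less_one assms(4)], rule that)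
  interpret L: layer h U l "U s" rho eta lo hi V q by (rule L(1))
  show ?thesis
  proof (rule that)
    show "layer.X c rho eta V q 0 0 = s"
      using L.V_U[of s] L L.eta assms(3) L.X_0[of 0] by simp
    show "U x = c \<longleftrightarrow> x = s" if "x \<in> {lo<..<hi}" for x
      using L.U_inj[OF that L(2)] assms(3) by auto
  qed (use L assms in auto)
qed

text \<open>This is \<open>jump_iff\<close> at \<open>d = 0\<close>; any chart around
  \<open>s\<close> serves, so \<open>q = 1\<close>.\<close>

lemma limit_solution_jump:
  assumes c: "regular_speed c" and s: "s \<in> {0..h}" "U s = c" and \<sigma>: "\<bar>\<sigma>\<bar> \<le> 1"
    and ode: "\<And>x. x \<in> {0<..<h} \<Longrightarrow> U x \<noteq> c \<Longrightarrow> ode_at k (of_real c) f g UNIV x"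
    and f: "(f \<longlongrightarrow> f s) (at s)"
  shows "((\<lambda>t. g (s + t) - g (s - t)) \<longlongrightarrow>
      \<i> * of_real \<sigma> * of_real (pi * DU 2 s / \<bar>DU 1 s\<bar>) * f s) (at_right 0) \<longleftrightarrow>
    (\<exists>v0. ((\<lambda>x. g x - of_real (P0 x) * log_branch \<sigma> (U x - c) * f x) \<longlongrightarrow> v0) (at s))"
proof -
  obtain rho eta lo hi V where L: "layer h U l c rho eta lo hi V 1" "s \<in> {lo<..<hi}"
    "layer.X c rho eta V 1 0 0 = s"
    by (rule layer_at[OF c s order_refl], rule that)
  interpret L: layer h U l c rho eta lo hi V 1 by (rule L(1))
  have z: "(0::real) \<in> L.speeds" using L.eta by simp
  have "ode_at k (of_real (c + 0)) f g UNIV x" if "x \<in> {lo<..<hi}" "U x \<noteq> c + 0" for x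
    using ode[of x] that L.lo_pos L.hi_less by auto
  moreover have "(f \<longlongrightarrow> f s) (at_left s)" "(f \<longlongrightarrow> f s) (at_right s)"
    using f by (auto simp: filterlim_at_split)
  ultimately show ?thesis
    using L.jump_iff[OF z \<sigma>, where k = k and f = f and g = g, unfolded add_0_right L(3)] by simp
qed

lemma limit_solutionD:
  assumes c: "regular_speed c" and \<sigma>: "\<bar>\<sigma>\<bar> \<le> 1" and y: "limit_solution h U k c \<sigma> y"
  shows "limit_sys k c \<sigma> y (deriv_within {0..h} y)" "y h = 0" "deriv_within {0..h} y h = 1"
proof -
  let ?g = "deriv_within {0..h} y"
  have r: "rayleigh_solution h U k (of_real c) (critical_layers h U c) y"
    using y by (simp add: limit_solution_def)
  note D = rayleigh_solutionD[OF r]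
  show "y h = 0" "?g h = 1" using D by auto
  have S: "{0..h} - critical_layers h U c = {x \<in> {0..h}. U x \<noteq> c}"
    by (auto simp: critical_layers_def)
  have ode: "ode_at k (of_real c) y ?g UNIV x" if "x \<in> {0<..<h}" "U x \<noteq> c" for x
    by (rule D(3)) (use that in \<open>auto simp: critical_layers_def\<close>)
  have lay: "(y \<longlongrightarrow> y s) (at s)" "\<exists>v0. ((\<lambda>x. ?g x - of_real (P0 x) * log_branch \<sigma> (U x - c) * y x) \<longlongrightarrow> v0) (at s)"
    if s: "s \<in> {0..h}" "U s = c" for s
  proof -
    have "s \<in> critical_layers h U c" using s by (simp add: critical_layers_def)
    then have l: "(y \<longlongrightarrow> y s) (at_left s)" "(y \<longlongrightarrow> y s) (at_right s)"
      "((\<lambda>t. ?g (s + t) - ?g (s - t)) \<longlongrightarrow>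
        \<i> * of_real \<sigma> * of_real (pi * DU 2 s / \<bar>DU 1 s\<bar>) * y s) (at_right 0)"
      using y unfolding limit_solution_def DU_12 by auto
    show yc: "(y \<longlongrightarrow> y s) (at s)" using l by (simp add: filterlim_at_split)
    show "\<exists>v0. ((\<lambda>x. ?g x - of_real (P0 x) * log_branch \<sigma> (U x - c) * y x) \<longlongrightarrow> v0) (at s)"
      using limit_solution_jump[OF c s \<sigma> ode yc] l(3) by blast
  qed
  show "limit_sys k c \<sigma> y ?g"
    unfolding limit_sys_def
  proof (intro conjI ballI impI)
    show "(y has_vector_derivative ?g x) (at x within {0..h})" if "x \<in> {0..h}" "U x \<noteq> c" for x
      by (rule D(1)) (use that in \<open>auto simp: critical_layers_def\<close>)
    show "continuous_on {x \<in> {0..h}. U x \<noteq> c} ?g" using D(2) by (simp add: S)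
  qed (use ode lay in auto)
qed

lemma limit_solutionI:
  assumes c: "regular_speed c" and \<sigma>: "\<bar>\<sigma>\<bar> \<le> 1" and fg: "limit_sys k c \<sigma> f g" "f h = 0" "g h = 1"
  shows "limit_solution h U k c \<sigma> f"
proof -
  have S: "{0..h} - critical_layers h U c = {x \<in> {0..h}. U x \<noteq> c}"
    by (auto simp: critical_layers_def)
  note a = fg(1)[unfolded limit_sys_def]
  have ode: "\<And>x. x \<in> {0<..<h} \<Longrightarrow> U x \<noteq> c \<Longrightarrow> ode_at k (of_real c) f g UNIV x" using a by blast
  have ray: "rayleigh_solution h U k (of_real c) (critical_layers h U c) f"
  proof (rule rayleigh_solutionI)
    show "closed (critical_layers h U c)"
      using finite_layers[OF c] by (simp add: critical_layers_def finite_imp_closed)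
    show "h \<notin> critical_layers h U c" using c by (auto simp: regular_speed_def critical_layers_def)
    show "continuous_on ({0..h} - critical_layers h U c) g" using a by (simp add: S)
  qed (use a fg S in \<open>auto simp: critical_layers_def\<close>)
  show ?thesis
    unfolding limit_solution_def
  proof (intro conjI ballI ray)
    fix s assume "s \<in> critical_layers h U c"
    then have s: "s \<in> {0..h}" "U s = c" by (auto simp: critical_layers_def)
    have fs: "(f \<longlongrightarrow> f s) (at s)" using a s by blast
    then show "(f \<longlongrightarrow> f s) (at_left s)" "(f \<longlongrightarrow> f s) (at_right s)" by (auto simp: filterlim_at_split)
    have j: "((\<lambda>t. g (s + t) - g (s - t)) \<longlongrightarrow>
      \<i> * of_real \<sigma> * of_real (pi * DU 2 s / \<bar>DU 1 s\<bar>) * f s) (at_right 0)"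
      using limit_solution_jump[OF c s \<sigma> ode fs] a s by blast
    obtain rho eta lo hi V where L: "layer h U l c rho eta lo hi V 1" "s \<in> {lo<..<hi}"
      "\<And>x. x \<in> {lo<..<hi} \<Longrightarrow> U x = c \<longleftrightarrow> x = s"
      by (rule layer_at[OF c s order_refl], rule that)
    interpret L: layer h U l c rho eta lo hi V 1 by (rule L(1))
    have eq: "deriv_within {0..h} f x = g x" if "x \<in> {lo<..<hi}" "x \<noteq> s" for x
      using that L(3)[of x] a L.lo_pos L.hi_less by (intro deriv_within_eq) auto
    have "\<forall>\<^sub>F t in at_right 0. g (s + t) - g (s - t) = deriv_within {0..h} f (s + t) - deriv_within {0..h} f (s - t)"
      unfolding eventually_at_right_field
      by (intro exI[of _ "min (hi - s) (s - lo)"] conjI allI impI) (use L(2) eq in auto)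
    from Lim_transform_eventually[OF j this]
    show "((\<lambda>t. deriv_within {0..h} f (s + t) - deriv_within {0..h} f (s - t)) \<longlongrightarrow>
           \<i> * of_real \<sigma> * of_real (pi * deriv_within {0..h} (deriv_within {0..h} U) s
                    / \<bar>deriv_within {0..h} U s\<bar>) * f s) (at_right 0)"
      unfolding DU_12 .
  qed
qed

end

lemma gronwall_linear:
  fixes Y :: "real \<Rightarrow> 'a::{real_inner}"
  assumes "continuous_on {a..b} Y" "t \<in> {a..b}"
    "\<And>x. x \<in> {a<..<b} - {z} \<Longrightarrow> (Y has_vector_derivative blinfun_apply (B x) (Y x)) (at x)"
    "\<And>x. x \<in> {a<..<b} \<Longrightarrow> norm (B x) \<le> C" "0 \<le> C"
  shows "norm (Y t) \<le> 4 * exp (2 * (C + 1) * (b - a)) * norm (Y b)"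
proof -
  have "norm (Y t) \<le> 4 * exp (2 * (C + 1) * (b - a)) * (norm (Y b) + 0)"
  proof (rule gronwall[where z = z and Y' = "\<lambda>x. B x (Y x)"])
    show "norm (B x (Y x)) \<le> C * norm (Y x) + 0" if "x \<in> {a<..<b} - {z}" for x
      using order_trans[OF norm_blinfun mult_right_mono[OF assms(4)]] that by auto
  qed (use assms in auto)
  then show ?thesis by simp
qed

text \<open>In the chart a solution crosses the layer continuously: the second component is given at
  \<open>t = 0\<close> the limit of \<open>v\<close> that \<open>limit_sys\<close> provides.\<close>

lemma (in layer) sys_chart:
  assumes d: "d \<in> speeds" and fg: "limit_sys k (cs + d) \<sigma> f g"
  obtains Y where "continuous_on chart_dom Y"
    "\<And>t. t \<in> chart_dom - {0} \<Longrightarrow> (Y has_vector_derivative chart_mat \<sigma> k t d (Y t)) (at t)"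
    "\<And>t. t \<in> chart_dom \<Longrightarrow> fst (Y t) = f (X t d)"
    "\<And>t. t \<in> chart_dom - {0} \<Longrightarrow> snd (Y t) = g (X t d) - of_real (P0 (X t d)) * log_branch \<sigma> (U (X t d) - (cs + d)) * f (X t d)"
proof -
  define L where "L x = log_branch \<sigma> (U x - (cs + d))" for x
  define v where "v x = g x - of_real (P0 x) * L x * f x" for x
  have X0: "X 0 d \<in> {0..h}" "U (X 0 d) = cs + d"
    using X_in[of 0 d] U_X[of 0 d] d lo_pos hi_less by (auto simp: ev_def)
  then obtain v0 where v0: "(v \<longlongrightarrow> v0) (at (X 0 d))"
    using fg unfolding limit_sys_def v_def L_def by blast
  have f0: "(f \<longlongrightarrow> f (X 0 d)) (at (X 0 d))" using fg X0 unfolding limit_sys_def by blast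
  define Y where "Y t = (f (X t d), if t = 0 then v0 else v (X t d))" for t
  have dY: "(Y has_vector_derivative chart_mat \<sigma> k t d (Y t)) (at t)" if t: "t \<in> chart_dom - {0}" for t
  proof -
    have t': "t \<in> chart_dom" "t \<noteq> 0" using t by auto
    have ode: "ode_at k (of_real (cs + d)) f g UNIV (X t d)"
      using fg U_X_ne[OF t'(1) d t'(2)] X_in[OF t'(1) d] lo_pos hi_less unfolding limit_sys_def by auto
    have "((\<lambda>t. (f (X t d), v (X t d))) has_vector_derivative chart_mat \<sigma> k t d (f (X t d), v (X t d))) (at t)"
      unfolding v_def by (rule real_layer_deriv[OF t'(1) d t'(2) ode]) (simp add: L_def)
    then have "((\<lambda>t. (f (X t d), v (X t d))) has_vector_derivative chart_mat \<sigma> k t d (Y t)) (at t)"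
      using t' by (simp add: Y_def)
    then show ?thesis
      by (rule has_vector_derivative_transform_within_open[where S = "- {0}"]) (use t' in \<open>auto simp: Y_def\<close>)
  qed
  have "filterlim (\<lambda>t. X t d) (at (X 0 d)) (at 0)"
  proof (rule filterlim_atI)
    have "isCont (\<lambda>t. X t d) 0" by (rule DERIV_isCont[OF X_deriv]) (use d in auto)
    then show "((\<lambda>t. X t d) \<longlongrightarrow> X 0 d) (at 0)" by (simp add: isCont_def)
    show "\<forall>\<^sub>F t in at 0. X t d \<noteq> X 0 d"
      unfolding eventually_at
    proof (intro exI[of _ 1] conjI ballI impI)
      fix t :: real assume "t \<noteq> 0 \<and> dist t 0 < 1"
      then show "X t d \<noteq> X 0 d" using U_X_ne[of t d] d X0(2) by (auto simp: abs_less_iff)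
    qed simp
  qed
  from filterlim_compose[OF f0 this] filterlim_compose[OF v0 this]
  have lim: "((\<lambda>t. (f (X t d), v (X t d))) \<longlongrightarrow> (f (X 0 d), v0)) (at 0)"
    by (rule tendsto_Pair)
  have "(Y \<longlongrightarrow> Y 0) (at 0)"
    using Lim_transform_eventually[OF lim, of Y] by (auto simp: Y_def eventually_at_filter)
  then have Y0: "isCont Y 0" by (simp add: isCont_def)
  have "continuous (at t within chart_dom) Y" if "t \<in> chart_dom" for t
    using Y0 has_vector_derivative_continuous[OF dY, of t] that
    by (cases "t = 0") (auto intro: continuous_at_imp_continuous_at_within)
  then have "continuous_on chart_dom Y" by (simp add: continuous_on_eq_continuous_within)
  then show ?thesis
    by (rule that[OF _ dY]) (auto simp: Y_def v_def L_def)
qed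

text \<open>\<open>k\<close> occurs in a single entry, as \<open>Xd\<close> times
  \<open>k^2\<close>, so the bound at \<open>k = 0\<close> only has to be enlarged.\<close>

lemma (in layer) chart_mat_bounded_uniform:
  assumes "\<bar>\<sigma>\<bar> \<le> 1" "d \<in> speeds"
  obtains C where "C > 0" "\<And>t k. t \<in> chart_dom \<Longrightarrow> \<bar>k\<bar> \<le> \<kappa> \<Longrightarrow> norm (chart_mat \<sigma> k t d) \<le> C"
proof -
  obtain C0 where C0: "C0 > 0" "\<And>t. t \<in> chart_dom \<Longrightarrow> norm (chart_mat \<sigma> 0 t d) \<le> C0"
    using chart_mat_bounded[OF assms] by blast
  have cXd: "Ck_param 0 chart_dom speeds Xd"
    unfolding Xd_def[abs_def] by (rule Ck_param_mult[OF Ck_param_fst Ck_param_k0]) (use l_ge in \<open>auto intro!: continuous_intros\<close>)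
  obtain C1 where C1: "C1 > 0" "\<And>t. t \<in> chart_dom \<Longrightarrow> norm (Xd t d) \<le> C1"
    by (rule Ck_param_bounded[OF compact_Icc assms(2) cXd], rule that)
  show ?thesis
  proof (rule that[of "C0 + C1 * \<kappa>\<^sup>2"])
    show "0 < C0 + C1 * \<kappa>\<^sup>2" using C0 C1 by (simp add: add_pos_nonneg)
    fix t k assume t: "t \<in> chart_dom" and k: "\<bar>k\<bar> \<le> \<kappa>"
    have "chart_mat \<sigma> k t d = chart_mat \<sigma> 0 t d + mat2 0 0 (of_real (Xd t d) * of_real (k\<^sup>2)) 0"
      by (rule blinfun_eqI) (simp add: chart_mat_def blinfun.add_left algebra_simps)
    also have "norm \<dots> \<le> norm (chart_mat \<sigma> 0 t d) + norm (mat2 0 0 (of_real (Xd t d) * of_real (k\<^sup>2)) 0)"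
      by (rule norm_triangle_ineq)
    also have "\<dots> \<le> C0 + \<bar>Xd t d\<bar> * k\<^sup>2"
      using C0(2)[OF t] norm_mat2[of 0 0 "of_real (Xd t d) * of_real (k\<^sup>2)" 0] by (simp add: norm_mult norm_power)
    also have "\<dots> \<le> C0 + C1 * \<kappa>\<^sup>2"
      using C1 t k by (intro add_left_mono mult_mono) (auto simp: abs_le_square_iff[symmetric])
    finally show "norm (chart_mat \<sigma> k t d) \<le> C0 + C1 * \<kappa>\<^sup>2" .
  qed
qed

section \<open>A priori bounds uniform in the wave number, uniqueness, and gluing\<close>

context profile
begin

text \<open>The coefficient matrix for the pair \<open>(y, y')\<close>, used on layer-free
  intervals.\<close>

definition rayleigh_mat :: "real \<Rightarrow> complex \<Rightarrow> real \<Rightarrow> (complex \<times> complex) \<Rightarrow>\<^sub>L (complex \<times> complex)" where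
  "rayleigh_mat k c x = mat2 0 1 (of_real (DU 2 x) / (of_real (U x) - c) + of_real (k\<^sup>2)) 0"

lemma ode_at_rayleigh_mat:
  "ode_at k c f g S x \<longleftrightarrow> ((\<lambda>x. (f x, g x)) has_vector_derivative rayleigh_mat k c x (f x, g x)) (at x within S)"
proof
  assume "ode_at k c f g S x"
  then show "((\<lambda>x. (f x, g x)) has_vector_derivative rayleigh_mat k c x (f x, g x)) (at x within S)"
    unfolding ode_at_def rayleigh_mat_def by (auto intro: has_vector_derivative_Pair)
next
  assume a: "((\<lambda>x. (f x, g x)) has_vector_derivative rayleigh_mat k c x (f x, g x)) (at x within S)"
  show "ode_at k c f g S x"
    using bounded_linear.has_vector_derivative[OF bounded_linear_fst a]
      bounded_linear.has_vector_derivative[OF bounded_linear_snd a]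
    by (simp add: ode_at_def rayleigh_mat_def)
qed

lemma rayleigh_mat_bounded:
  assumes "0 \<le> a" "b \<le> h" "\<And>x. x \<in> {a..b} \<Longrightarrow> U x \<noteq> c"
  obtains C where "C > 0" "\<And>x k. x \<in> {a..b} \<Longrightarrow> \<bar>k\<bar> \<le> \<kappa> \<Longrightarrow> norm (rayleigh_mat k (of_real c) x) \<le> C"
proof -
  have "continuous_on {a..b} (\<lambda>x. DU 2 x / (U x - c))"
    using DU_cont[of 2] U_cont l_ge assms
    by (intro continuous_intros) (auto intro: continuous_on_subset)
  then have "bounded ((\<lambda>x. DU 2 x / (U x - c)) ` {a..b})"
    by (intro compact_imp_bounded compact_continuous_image) auto
  then obtain M where M: "M > 0" "\<And>x. x \<in> {a..b} \<Longrightarrow> \<bar>DU 2 x / (U x - c)\<bar> \<le> M"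
    by (auto simp: bounded_pos)
  show ?thesis
  proof (rule that[of "1 + (M + \<kappa>\<^sup>2)"])
    show "0 < 1 + (M + \<kappa>\<^sup>2)" using M by (simp add: add_pos_nonneg)
    fix x k assume x: "x \<in> {a..b}" and k: "\<bar>k\<bar> \<le> \<kappa>"
    have "norm (rayleigh_mat k (of_real c) x) \<le> 1 + norm (of_real (DU 2 x) / (of_real (U x) - of_real c) + complex_of_real (k\<^sup>2))"
      unfolding rayleigh_mat_def using norm_mat2[of 0 1 _ 0] by (rule order_trans) simp
    also have "of_real (DU 2 x) / (of_real (U x) - of_real c) = complex_of_real (DU 2 x / (U x - c))" by simp
    also have "norm (complex_of_real (DU 2 x / (U x - c)) + of_real (k\<^sup>2)) \<le> M + \<kappa>\<^sup>2"
      using M(2)[OF x] power_mono[OF k abs_ge_zero, of 2]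
      by (intro order_trans[OF norm_triangle_ineq] add_mono)
        (simp_all only: norm_of_real real_norm_def abs_power2 power2_abs)
    finally show "norm (rayleigh_mat k (of_real c) x) \<le> 1 + (M + \<kappa>\<^sup>2)" by simp
  qed
qed

lemma limit_sys_regular_speed:
  assumes fg: "limit_sys k c \<sigma> f g" and ab: "0 \<le> a" "b \<le> h" "\<And>x. x \<in> {a..b} \<Longrightarrow> U x \<noteq> c"
  shows "continuous_on {a..b} (\<lambda>x. (f x, g x))"
    "\<And>x. x \<in> {a<..<b} \<Longrightarrow> ((\<lambda>x. (f x, g x)) has_vector_derivative rayleigh_mat k (of_real c) x (f x, g x)) (at x)"
proof -
  note a = fg[unfolded limit_sys_def]
  have "continuous_on {a..b} f"
  proof (rule continuous_on_vector_derivative)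
    fix x assume x: "x \<in> {a..b}"
    then have "x \<in> {0..h}" "U x \<noteq> c" using ab by auto
    then have "(f has_vector_derivative g x) (at x within {0..h})" using a by blast
    then show "(f has_vector_derivative g x) (at x within {a..b})"
      by (rule has_vector_derivative_within_subset) (use ab in auto)
  qed
  moreover have "continuous_on {a..b} g"
  proof (rule continuous_on_subset)
    show "continuous_on {x \<in> {0..h}. U x \<noteq> c} g" using a by blast
    show "{a..b} \<subseteq> {x \<in> {0..h}. U x \<noteq> c}"
    proof
      fix x assume "x \<in> {a..b}"
      then show "x \<in> {x \<in> {0..h}. U x \<noteq> c}" using ab(3)[of x] ab(1,2) by simp
    qed
  qed
  ultimately show "continuous_on {a..b} (\<lambda>x. (f x, g x))" by (intro continuous_intros)
  show "((\<lambda>x. (f x, g x)) has_vector_derivative rayleigh_mat k (of_real c) x (f x, g x)) (at x)" if "x \<in> {a<..<b}" for x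
    using a that ab ode_at_rayleigh_mat[of k "of_real c" f g UNIV x] by auto
qed

text \<open>\<open>f\<close> is bounded on all of \<open>{x..h}\<close> but \<open>g\<close> only at
  \<open>x\<close>, since \<open>g\<close> may be logarithmically large at the layers in between.
  The bound is linear in the data at \<open>h\<close>, so it also yields uniqueness, and its
  constant sees \<open>k\<close> through \<open>\<kappa>\<close>.\<close>

lemma lim_bound:
  assumes c: "regular_speed c" and \<sigma>: "\<bar>\<sigma>\<bar> \<le> 1" and x: "x \<in> {0..h}" "U x \<noteq> c"
  shows "\<exists>M\<ge>0. \<forall>k f g. \<bar>k\<bar> \<le> \<kappa> \<longrightarrow> limit_sys k c \<sigma> f g \<longrightarrow>
    (\<forall>y\<in>{x..h}. norm (f y) \<le> M * (norm (f h) + norm (g h))) \<and> norm (g x) \<le> M * (norm (f h) + norm (g h))"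
proof -
  obtain q :: nat where q: "1 \<le> q" by blast
  show ?thesis
  proof (rule layer_induct[OF c _ _ _ q x, where P = "\<lambda>x. \<exists>M\<ge>0. \<forall>k f g. \<bar>k\<bar> \<le> \<kappa> \<longrightarrow> limit_sys k c \<sigma> f g \<longrightarrow>
    (\<forall>y\<in>{x..h}. norm (f y) \<le> M * (norm (f h) + norm (g h))) \<and> norm (g x) \<le> M * (norm (f h) + norm (g h))"])
  show "\<exists>M\<ge>0. \<forall>k f g. \<bar>k\<bar> \<le> \<kappa> \<longrightarrow> limit_sys k c \<sigma> f g \<longrightarrow>
    (\<forall>y\<in>{h..h}. norm (f y) \<le> M * (norm (f h) + norm (g h))) \<and> norm (g h) \<le> M * (norm (f h) + norm (g h))"
    by (intro exI[of _ 1]) auto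
next
  fix a b assume ab: "0 \<le> a" "a \<le> b" "b \<le> h" "\<And>x. x \<in> {a..b} \<Longrightarrow> U x \<noteq> c"
    and "\<exists>M\<ge>0. \<forall>k f g. \<bar>k\<bar> \<le> \<kappa> \<longrightarrow> limit_sys k c \<sigma> f g \<longrightarrow>
    (\<forall>y\<in>{b..h}. norm (f y) \<le> M * (norm (f h) + norm (g h))) \<and> norm (g b) \<le> M * (norm (f h) + norm (g h))"
  then obtain M where M: "M \<ge> 0" "\<And>k f g. \<bar>k\<bar> \<le> \<kappa> \<Longrightarrow> limit_sys k c \<sigma> f g \<Longrightarrow>
    (\<forall>y\<in>{b..h}. norm (f y) \<le> M * (norm (f h) + norm (g h))) \<and> norm (g b) \<le> M * (norm (f h) + norm (g h))"
    by blast
  obtain C where C: "C > 0" "\<And>x k. x \<in> {a..b} \<Longrightarrow> \<bar>k\<bar> \<le> \<kappa> \<Longrightarrow> norm (rayleigh_mat k (of_real c) x) \<le> C"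
    using rayleigh_mat_bounded[OF ab(1,3,4)] by blast
  define K where "K = 4 * exp (2 * (C + 1) * (b - a))"
  have K: "K \<ge> 0" by (simp add: K_def)
  show "\<exists>M\<ge>0. \<forall>k f g. \<bar>k\<bar> \<le> \<kappa> \<longrightarrow> limit_sys k c \<sigma> f g \<longrightarrow>
    (\<forall>y\<in>{a..h}. norm (f y) \<le> M * (norm (f h) + norm (g h))) \<and> norm (g a) \<le> M * (norm (f h) + norm (g h))"
  proof (intro exI[of _ "M + K * (2 * M)"] conjI allI impI)
    show "M + K * (2 * M) \<ge> 0" using M K by simp
    fix k f g assume k: "\<bar>k\<bar> \<le> \<kappa>" and fg: "limit_sys k c \<sigma> f g"
    define N where "N = norm (f h) + norm (g h)"
    have N: "N \<ge> 0" by (simp add: N_def)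
    note Mb = M(2)[OF k fg, folded N_def]
    have fh: "norm (f y) \<le> M * N" if "b \<le> y" "y \<le> h" for y using Mb that by simp
    have gb: "norm (g b) \<le> M * N" using Mb by blast
    have "norm (f b, g b) \<le> norm (f b) + norm (g b)" by (rule norm_Pair_le)
    also have "\<dots> \<le> 2 * M * N" using fh[of b] gb ab(3) by simp
    finally have nb: "norm (f b, g b) \<le> 2 * M * N" .
    have Y: "norm (f y, g y) \<le> K * (2 * M) * N" if "y \<in> {a..b}" for y
    proof -
      have "norm (f y, g y) \<le> 4 * exp (2 * (C + 1) * (b - a)) * norm (f b, g b)"
        by (rule gronwall_linear[OF limit_sys_regular_speed(1)[OF fg ab(1,3,4)] that, where z = a and B = "rayleigh_mat k (of_real c)"])
          (use limit_sys_regular_speed(2)[OF fg ab(1,3,4)] C k in auto)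
      also have "\<dots> \<le> K * (2 * M * N)" unfolding K_def by (intro mult_left_mono nb) auto
      finally show ?thesis by (simp add: mult_ac)
    qed
    have le: "K * (2 * M) * N \<le> (M + K * (2 * M)) * N" "M * N \<le> (M + K * (2 * M)) * N"
      using M K N by (auto intro!: mult_right_mono)
    show "\<forall>y\<in>{a..h}. norm (f y) \<le> (M + K * (2 * M)) * (norm (f h) + norm (g h))"
    proof
      fix y assume y: "y \<in> {a..h}"
      show "norm (f y) \<le> (M + K * (2 * M)) * (norm (f h) + norm (g h))"
        using Y[of y] norm_fst_le[of "f y" "g y"] fh[of y] le y unfolding N_def[symmetric]
        by (cases "y \<le> b") auto
    qed
    show "norm (g a) \<le> (M + K * (2 * M)) * (norm (f h) + norm (g h))"
      using Y[of a] norm_snd_le[of "g a" "f a"] le ab unfolding N_def[symmetric] by auto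
  qed
next
  fix rho eta lo hi V assume L: "layer h U l c rho eta lo hi V q"
  interpret L: layer h U l c rho eta lo hi V q by (rule L)
  define a b where "a = L.X (-1) 0" and "b = L.X 1 0"
  assume "\<exists>M\<ge>0. \<forall>k f g. \<bar>k\<bar> \<le> \<kappa> \<longrightarrow> limit_sys k c \<sigma> f g \<longrightarrow>
    (\<forall>y\<in>{L.X 1 0..h}. norm (f y) \<le> M * (norm (f h) + norm (g h))) \<and> norm (g (L.X 1 0)) \<le> M * (norm (f h) + norm (g h))"
  then obtain M where M: "M \<ge> 0" "\<And>k f g. \<bar>k\<bar> \<le> \<kappa> \<Longrightarrow> limit_sys k c \<sigma> f g \<Longrightarrow>
    (\<forall>y\<in>{b..h}. norm (f y) \<le> M * (norm (f h) + norm (g h))) \<and> norm (g b) \<le> M * (norm (f h) + norm (g h))"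
    unfolding b_def by blast
  have z: "(0::real) \<in> L.speeds" using L.eta by simp
  have ab: "a \<in> {lo<..<hi}" "b \<in> {lo<..<hi}" "a < b"
    using L.X_in[of "-1" 0] L.X_in[of 1 0] z L.X_mono[OF z, of "-1" 1] by (auto simp: a_def b_def)
  obtain C where C: "C > 0" "\<And>t k. t \<in> L.chart_dom \<Longrightarrow> \<bar>k\<bar> \<le> \<kappa> \<Longrightarrow> norm (L.chart_mat \<sigma> k t 0) \<le> C"
    using L.chart_mat_bounded_uniform[OF \<sigma> z] by metis
  define K where "K = 4 * exp (2 * (C + 1) * (1 - (-1)))"
  have K: "K \<ge> 0" by (simp add: K_def)
  \<comment> \<open>The cost of exchanging \<open>g\<close> and \<open>v\<close> at a chart end: at
    \<open>b\<close> on entering the chart and at \<open>a\<close> on leaving it.\<close>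
  define A where "A x = norm (of_real (P0 x) * log_branch \<sigma> (U x - c))" for x
  have A: "A x \<ge> 0" for x by (simp add: A_def)
  define M' where "M' = K * ((2 + A b) * M)"
  have M': "M' \<ge> 0" using K A[of b] M by (simp add: M'_def)
  show "\<exists>M\<ge>0. \<forall>k f g. \<bar>k\<bar> \<le> \<kappa> \<longrightarrow> limit_sys k c \<sigma> f g \<longrightarrow>
    (\<forall>y\<in>{L.X (-1) 0..h}. norm (f y) \<le> M * (norm (f h) + norm (g h))) \<and> norm (g (L.X (-1) 0)) \<le> M * (norm (f h) + norm (g h))"
    unfolding a_def[symmetric]
  proof (intro exI[of _ "M + (1 + A a) * M'"] conjI allI impI)
    show "M + (1 + A a) * M' \<ge> 0" using M M' A[of a] by simp
    fix k f g assume k: "\<bar>k\<bar> \<le> \<kappa>" and fg: "limit_sys k c \<sigma> f g"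
    define N where "N = norm (f h) + norm (g h)"
    have N: "N \<ge> 0" by (simp add: N_def)
    note Mb = M(2)[OF k fg, folded N_def]
    have fh: "norm (f y) \<le> M * N" if "b \<le> y" "y \<le> h" for y using Mb that by simp
    obtain Y where Y: "continuous_on L.chart_dom Y"
      "\<And>t. t \<in> L.chart_dom - {0} \<Longrightarrow> (Y has_vector_derivative L.chart_mat \<sigma> k t 0 (Y t)) (at t)"
      "\<And>t. t \<in> L.chart_dom \<Longrightarrow> fst (Y t) = f (L.X t 0)"
      "\<And>t. t \<in> L.chart_dom - {0} \<Longrightarrow> snd (Y t) = g (L.X t 0) - of_real (P0 (L.X t 0)) * log_branch \<sigma> (U (L.X t 0) - c) * f (L.X t 0)"
      by (rule L.sys_chart[OF z, unfolded add_0_right, OF fg], rule that)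
    have fb: "norm (f b) \<le> M * N" "norm (g b) \<le> M * N"
      using Mb ab L.hi_less by auto
    have "norm (Y 1) \<le> norm (fst (Y 1)) + norm (snd (Y 1))"
      using norm_Pair_le[of "fst (Y 1)" "snd (Y 1)"] by simp
    also have "\<dots> \<le> norm (f b) + (norm (g b) + A b * norm (f b))"
      using Y(3)[of 1] Y(4)[of 1] norm_triangle_ineq4[of "g b" "of_real (P0 b) * log_branch \<sigma> (U b - c) * f b"]
      by (auto simp: b_def[symmetric] A_def norm_mult)
    also have "\<dots> \<le> M * N + (M * N + A b * (M * N))"
      using fb A[of b] by (intro add_mono mult_left_mono) auto
    finally have n1: "norm (Y 1) \<le> (2 + A b) * M * N" by (simp add: algebra_simps)
    have nY: "norm (Y t) \<le> M' * N" if "t \<in> L.chart_dom" for t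
    proof -
      have "norm (Y t) \<le> 4 * exp (2 * (C + 1) * (1 - (-1))) * norm (Y 1)"
        by (rule gronwall_linear[OF Y(1) that, where z = 0 and B = "\<lambda>t. L.chart_mat \<sigma> k t 0"])
          (use Y(2) C k in auto)
      also have "\<dots> \<le> K * ((2 + A b) * M * N)" unfolding K_def by (intro mult_left_mono n1) auto
      finally show ?thesis by (simp add: M'_def mult_ac)
    qed
    have fY: "norm (f (L.X t 0)) \<le> M' * N" if "t \<in> L.chart_dom" for t
      using nY[OF that] norm_fst_le[of "fst (Y t)" "snd (Y t)"]
      unfolding Y(3)[OF that, symmetric] prod.collapse by linarith
    have MA: "M' * N \<le> (M + (1 + A a) * M') * N" "M * N \<le> (M + (1 + A a) * M') * N"
      using M M' N A[of a] by (auto intro!: mult_right_mono simp: distrib_right)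
    show "\<forall>y\<in>{a..h}. norm (f y) \<le> (M + (1 + A a) * M') * (norm (f h) + norm (g h))"
    proof
      fix y assume y: "y \<in> {a..h}"
      show "norm (f y) \<le> (M + (1 + A a) * M') * (norm (f h) + norm (g h))"
        unfolding N_def[symmetric]
      proof (cases "y \<le> b")
        case True
        then obtain t where "t \<in> L.chart_dom" "L.X t 0 = y"
          using L.chart_cover[OF z, of y] y by (auto simp: a_def b_def)
        then show "norm (f y) \<le> (M + (1 + A a) * M') * N" using fY[of t] MA by auto
      next
        case False
        then show "norm (f y) \<le> (M + (1 + A a) * M') * N" using fh[of y] MA y by auto
      qed
    qed
    have "g a = snd (Y (-1)) + of_real (P0 a) * log_branch \<sigma> (U a - c) * f a"
      using Y(4)[of "-1"] by (simp add: a_def)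
    then have "norm (g a) \<le> norm (snd (Y (-1))) + A a * norm (f a)"
      using norm_triangle_ineq[of "snd (Y (-1))" "of_real (P0 a) * log_branch \<sigma> (U a - c) * f a"]
      by (simp add: A_def norm_mult)
    also have "\<dots> \<le> M' * N + A a * (M' * N)"
      using nY[of "-1"] norm_snd_le[of "snd (Y (-1))" "fst (Y (-1))"] fY[of "-1"] A[of a]
      unfolding prod.collapse by (intro add_mono mult_left_mono) (auto simp: a_def)
    also have "\<dots> \<le> (M + (1 + A a) * M') * N"
      using M N by (simp add: algebra_simps)
    finally show "norm (g a) \<le> (M + (1 + A a) * M') * (norm (f h) + norm (g h))" by (simp add: N_def)
  qed
qed
qed

text \<open>\<open>limit_sys\<close> is linear, so \<open>lim_bound\<close> applies to the
  difference, whose data vanish.\<close>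

lemma limit_sys_unique:
  assumes c: "regular_speed c" and \<sigma>: "\<bar>\<sigma>\<bar> \<le> 1"
    and 1: "limit_sys k c \<sigma> f1 g1" and 2: "limit_sys k c \<sigma> f2 g2"
    and h: "f1 h = f2 h" "g1 h = g2 h" and x: "x \<in> {0..h}"
  shows "f1 x = f2 x"
proof -
  note a = 1[unfolded limit_sys_def] 2[unfolded limit_sys_def]
  have "limit_sys k c \<sigma> (\<lambda>x. f1 x - f2 x) (\<lambda>x. g1 x - g2 x)"
    unfolding limit_sys_def
  proof (intro conjI ballI impI)
    show "((\<lambda>x. f1 x - f2 x) has_vector_derivative g1 x - g2 x) (at x within {0..h})"
      if "x \<in> {0..h}" "U x \<noteq> c" for x
      using a that by (intro has_vector_derivative_diff) auto
    show "continuous_on {x \<in> {0..h}. U x \<noteq> c} (\<lambda>x. g1 x - g2 x)"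
      using a by (intro continuous_on_diff) auto
    show "ode_at k (of_real c) (\<lambda>x. f1 x - f2 x) (\<lambda>x. g1 x - g2 x) UNIV x" if "x \<in> {0<..<h}" "U x \<noteq> c" for x
    proof -
      have o: "ode_at k (of_real c) f1 g1 UNIV x" "ode_at k (of_real c) f2 g2 UNIV x" using a that by auto
      show ?thesis
        unfolding ode_at_def right_diff_distrib
        using o[unfolded ode_at_def] by (intro conjI has_vector_derivative_diff) auto
    qed
    fix s assume s: "s \<in> {0..h}" "U s = c"
    show "((\<lambda>x. f1 x - f2 x) \<longlongrightarrow> f1 s - f2 s) (at s)" using a s by (intro tendsto_diff) auto
    have "\<exists>v. ((\<lambda>x. g1 x - of_real (P0 x) * log_branch \<sigma> (U x - c) * f1 x) \<longlongrightarrow> v) (at s)"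
      "\<exists>v. ((\<lambda>x. g2 x - of_real (P0 x) * log_branch \<sigma> (U x - c) * f2 x) \<longlongrightarrow> v) (at s)"
      using a s by blast+
    then obtain v1 v2 where v: "((\<lambda>x. g1 x - of_real (P0 x) * log_branch \<sigma> (U x - c) * f1 x) \<longlongrightarrow> v1) (at s)"
      "((\<lambda>x. g2 x - of_real (P0 x) * log_branch \<sigma> (U x - c) * f2 x) \<longlongrightarrow> v2) (at s)"
      by blast
    show "\<exists>v0. ((\<lambda>x. g1 x - g2 x - of_real (P0 x) * log_branch \<sigma> (U x - c) * (f1 x - f2 x)) \<longlongrightarrow> v0) (at s)"
      using tendsto_diff[OF v] by (intro exI[of _ "v1 - v2"]) (simp add: algebra_simps)
  qed
  moreover have "U 0 \<noteq> c" using c by (auto simp: regular_speed_def)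
  then obtain M where "\<forall>k' f g. \<bar>k'\<bar> \<le> \<bar>k\<bar> \<longrightarrow> limit_sys k' c \<sigma> f g \<longrightarrow>
    (\<forall>y\<in>{0..h}. norm (f y) \<le> M * (norm (f h) + norm (g h))) \<and> norm (g 0) \<le> M * (norm (f h) + norm (g h))"
    using lim_bound[OF c \<sigma>, of 0 "\<bar>k\<bar>"] h_pos by auto
  then have "\<And>f g. limit_sys k c \<sigma> f g \<Longrightarrow> \<forall>y\<in>{0..h}. norm (f y) \<le> M * (norm (f h) + norm (g h))"
    using order_refl[of "\<bar>k\<bar>"] by blast
  ultimately have "\<forall>y\<in>{0..h}. norm (f1 y - f2 y) \<le> M * (norm (f1 h - f2 h) + norm (g1 h - g2 h))"
    by blast
  then show ?thesis using h x by auto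
qed

text \<open>A piece of the limiting solution on \<open>{a..b}\<close>. Derivatives are taken within
  \<open>{a..b}\<close>, hence one-sided at the ends, so that pieces can be joined.\<close>

definition part_sys :: "real \<Rightarrow> real \<Rightarrow> real \<Rightarrow> (real \<Rightarrow> complex) \<Rightarrow> (real \<Rightarrow> complex) \<Rightarrow> real \<Rightarrow> real \<Rightarrow> bool" where
  "part_sys k c \<sigma> f g a b \<longleftrightarrow>
     (\<forall>x\<in>{a..b}. U x \<noteq> c \<longrightarrow> ode_at k (of_real c) f g {a..b} x) \<and>
     (\<forall>x\<in>{a<..<b}. U x = c \<longrightarrow> (f \<longlongrightarrow> f x) (at x) \<and>
        (\<exists>v0. ((\<lambda>x. g x - of_real (P0 x) * log_branch \<sigma> (U x - c) * f x) \<longlongrightarrow> v0) (at x)))"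

text \<open>At the joint the one-sided derivatives agree because both are
  \<open>rayleigh_mat\<close> applied to the common value of the pair. A layer lies strictly inside
  one piece, where its conditions are local.\<close>

lemma part_sys_glue:
  assumes 1: "part_sys k c \<sigma> f1 g1 a b" and 2: "part_sys k c \<sigma> f2 g2 b e" and ab: "a \<le> b" "b \<le> e"
    and eq: "f1 b = f2 b" "g1 b = g2 b" and b: "U b \<noteq> c"
  shows "part_sys k c \<sigma> (\<lambda>x. if x \<in> {a..b} then f1 x else f2 x) (\<lambda>x. if x \<in> {a..b} then g1 x else g2 x) a e"
    (is "part_sys k c \<sigma> ?f ?g a e")
  unfolding part_sys_def
proof (intro conjI ballI impI)
  fix x assume x: "x \<in> {a..e}" "U x \<noteq> c"
  have ae: "{a..e} = {a..b} \<union> {b..e}" using ab by auto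
  have "((\<lambda>x. if x \<in> {a..b} then (f1 x, g1 x) else (f2 x, g2 x)) has_vector_derivative
      (if x \<in> {a..b} then rayleigh_mat k (of_real c) x (f1 x, g1 x) else rayleigh_mat k (of_real c) x (f2 x, g2 x))) (at x within {a..e})"
  proof (rule has_vector_derivative_If_within_closures[where T = "{b..e}", OF _ ae])
    have i: "{a..b} \<union> (closure {a..b} \<inter> closure {b..e}) = {a..b}" "{b..e} \<union> (closure {a..b} \<inter> closure {b..e}) = {b..e}"
      using ab by auto
    show "((\<lambda>x. (f1 x, g1 x)) has_vector_derivative rayleigh_mat k (of_real c) x (f1 x, g1 x))
        (at x within {a..b} \<union> (closure {a..b} \<inter> closure {b..e}))"
      if "x \<in> {a..b} \<union> (closure {a..b} \<inter> closure {b..e})"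
      using 1 that x unfolding i part_sys_def ode_at_rayleigh_mat by blast
    show "((\<lambda>x. (f2 x, g2 x)) has_vector_derivative rayleigh_mat k (of_real c) x (f2 x, g2 x))
        (at x within {b..e} \<union> (closure {a..b} \<inter> closure {b..e}))"
      if "x \<in> {b..e} \<union> (closure {a..b} \<inter> closure {b..e})"
      using 2 that x unfolding i part_sys_def ode_at_rayleigh_mat by blast
    show "(f1 x, g1 x) = (f2 x, g2 x)" if "x \<in> closure {a..b}" "x \<in> closure {b..e}"
      using that eq by (cases "x = b") auto
    show "rayleigh_mat k (of_real c) x (f1 x, g1 x) = rayleigh_mat k (of_real c) x (f2 x, g2 x)" if "x \<in> closure {a..b}" "x \<in> closure {b..e}"
      using that eq by (cases "x = b") auto
  qed (use x ae in auto)
  moreover have "(\<lambda>x. if x \<in> {a..b} then (f1 x, g1 x) else (f2 x, g2 x)) = (\<lambda>x. (?f x, ?g x))" by auto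
  moreover have "(if x \<in> {a..b} then rayleigh_mat k (of_real c) x (f1 x, g1 x) else rayleigh_mat k (of_real c) x (f2 x, g2 x)) =
      rayleigh_mat k (of_real c) x (?f x, ?g x)" by auto
  ultimately show "ode_at k (of_real c) ?f ?g {a..e} x" unfolding ode_at_rayleigh_mat by simp
next
  fix x assume x: "x \<in> {a<..<e}" "U x = c"
  then have "x \<noteq> b" using b by auto
  obtain F G S where FG: "open S" "x \<in> S" "\<And>y. y \<in> S \<Longrightarrow> ?f y = F y \<and> ?g y = G y"
    "(F \<longlongrightarrow> F x) (at x)" "\<exists>v0. ((\<lambda>x. G x - of_real (P0 x) * log_branch \<sigma> (U x - c) * F x) \<longlongrightarrow> v0) (at x)"
  proof (cases "x < b")
    case True
    show ?thesis
      by (rule that[of "{a<..<b}" f1 g1]) (use 1 x True in \<open>auto simp: part_sys_def\<close>)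
  next
    case False
    show ?thesis
      by (rule that[of "{b<..<e}" f2 g2]) (use 2 x False \<open>x \<noteq> b\<close> in \<open>auto simp: part_sys_def\<close>)
  qed
  have ev: "\<forall>\<^sub>F y in at x. ?f y = F y \<and> ?g y = G y"
    by (rule eventually_mono[OF eventually_at_in_open'[OF FG(1,2)] FG(3)])
  show "(?f \<longlongrightarrow> ?f x) (at x)"
  proof -
    have "?f x = F x" using FG(3)[OF FG(2)] by blast
    moreover have "(?f \<longlongrightarrow> F x) (at x)"
      by (rule Lim_transform_eventually[OF FG(4)], rule eventually_mono[OF ev]) simp
    ultimately show ?thesis by (simp only:)
  qed
  obtain v0 where v0: "((\<lambda>x. G x - of_real (P0 x) * log_branch \<sigma> (U x - c) * F x) \<longlongrightarrow> v0) (at x)" using FG(5) by blast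
  show "\<exists>v0. ((\<lambda>x. ?g x - of_real (P0 x) * log_branch \<sigma> (U x - c) * ?f x) \<longlongrightarrow> v0) (at x)"
    by (rule exI[of _ v0], rule Lim_transform_eventually[OF v0], rule eventually_mono[OF ev]) simp
qed

lemma part_sys_regular:
  assumes ab: "0 \<le> a" "a \<le> b" "b \<le> h" "\<And>x. x \<in> {a..b} \<Longrightarrow> U x \<noteq> c"
  obtains f g where "part_sys k c \<sigma> f g a b" "f b = y0" "g b = y1"
proof -
  have cont: "continuous_on {a..b} (rayleigh_mat k (of_real c))"
  proof -
    have "continuous_on {a..b} (\<lambda>x. DU 2 x / (U x - c))"
      using DU_cont[of 2] U_cont l_ge ab
      by (intro continuous_intros) (auto intro: continuous_on_subset)
    then have "Ck_param 0 {a..b} {0} (\<lambda>x d. mat2 0 1 (of_real (DU 2 x / (U x - c)) + of_real (k\<^sup>2)) 0)"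
      by (intro Ck_param_mat2 Ck_param_add Ck_param_of_real Ck_param_const Ck_param_fst)
    from Ck_param_cont_fst[OF this, of 0] show ?thesis by (simp add: rayleigh_mat_def[abs_def])
  qed
  obtain Y where Y: "Y b = (y0, y1)"
    "\<And>x. x \<in> {a..b} \<Longrightarrow> (Y has_vector_derivative rayleigh_mat k (of_real c) x (Y x) + 0) (at x within {a..b})"
    by (rule linear_ode_exists[OF ab(2) cont continuous_on_const[of _ 0]], rule that)
  show ?thesis
  proof (rule that[of "\<lambda>x. fst (Y x)" "\<lambda>x. snd (Y x)"])
    show "part_sys k c \<sigma> (\<lambda>x. fst (Y x)) (\<lambda>x. snd (Y x)) a b"
      using Y(2) ab(4) unfolding part_sys_def ode_at_rayleigh_mat by auto
  qed (use Y in auto)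
qed

end

text \<open>The system is solved in \<open>t\<close>, where its coefficients are continuous, and
  carried back by the inverse \<open>T\<close> of the chart. \<open>T\<close> is continuous but not
  differentiable at the layer, and limits are all that \<open>part_sys\<close> asks for
  there.\<close>

lemma (in layer) part_sys_layer:
  assumes \<sigma>: "\<bar>\<sigma>\<bar> \<le> 1"
  obtains f g where "part_sys k cs \<sigma> f g (X (-1) 0) (X 1 0)" "f (X 1 0) = y0" "g (X 1 0) = y1"
proof -
  have z: "(0::real) \<in> speeds" using eta by simp
  define a b where "a = X (-1) 0" and "b = X 1 0"
  have ab: "a \<in> {lo<..<hi}" "b \<in> {lo<..<hi}" "a < b"
    using X_in[of "-1" 0] X_in[of 1 0] z X_mono[OF z, of "-1" 1] by (auto simp: a_def b_def)
  define L where "L x = log_branch \<sigma> (U x - cs)" for x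
  have "Ck_param 0 chart_dom speeds (chart_mat \<sigma> k)" by (rule Ck_param_chart_mat) (use l_ge \<sigma> in auto)
  then have cB: "continuous_on chart_dom (\<lambda>t. chart_mat \<sigma> k t 0)" by (rule Ck_param_cont_fst[OF _ z])
  \<comment> \<open>The lemma prescribes \<open>g\<close> at the right end, hence
    \<open>v = g - P0 L f\<close> is the datum here.\<close>
  obtain Y where Y: "Y 1 = (y0, y1 - of_real (P0 b) * L b * y0)"
    "\<And>t. t \<in> chart_dom \<Longrightarrow> (Y has_vector_derivative chart_mat \<sigma> k t 0 (Y t) + 0) (at t within chart_dom)"
    by (rule linear_ode_exists[OF _ cB continuous_on_const[of _ 0]], simp, rule that)
  have eta0: "eta \<noteq> 0" using eta by simp
  define n where "n = 2 * q + 1"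
  have n: "odd n" "0 < n" by (auto simp: n_def)
  \<comment> \<open>At \<open>d = 0\<close> the chart satisfies
    \<open>rho (U - cs) = eta t ^ n\<close>, so its inverse is an explicit odd root.\<close>
  define T where "T x = root n (rho * (U x - cs) / eta)" for x
  have Xn: "rho * (U (X t 0) - cs) / eta = t ^ n" if "t \<in> chart_dom" for t
    using U_X_minus_rho[OF that z] eta rho by (auto simp: n_def)
  have TX: "T (X t 0) = t" if "t \<in> chart_dom" for t
    unfolding T_def Xn[OF that] by (rule odd_real_root_power_cancel[OF n(1)])
  have XT: "T x \<in> chart_dom" "X (T x) 0 = x" if x: "x \<in> {a..b}" for x
  proof -
    obtain t where "t \<in> chart_dom" "X t 0 = x"
      by (rule chart_cover[OF z x[unfolded a_def b_def]], rule that)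
    then show "T x \<in> chart_dom" "X (T x) 0 = x" using TX[of t] by auto
  qed
  have Tc: "isCont T x" if "x \<in> {lo<..<hi}" for x
  proof -
    have "isCont U x" using U_deriv[of x] that by (auto intro: DERIV_isCont)
    then show ?thesis unfolding T_def
      by (intro continuous_intros) (simp_all add: eta0)
  qed
  have Td: "(T has_vector_derivative inverse (Xd (T x) 0)) (at x)" if x: "x \<in> {a..b}" "U x \<noteq> cs" for x
  proof -
    have x': "x \<in> {lo<..<hi}" using x ab by auto
    have nz: "rho * (U x - cs) / eta \<noteq> 0" using x rho eta by auto
    have "((\<lambda>x. rho * (U x - cs) / eta) has_real_derivative rho * DU 1 x / eta) (at x)"
      using U_deriv[of x] x' eta0 by (auto intro!: derivative_eq_intros)
    from DERIV_chain2[OF DERIV_odd_real_root[OF n(1) nz] this]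
    have "(T has_real_derivative inverse (real n * T x ^ (n - Suc 0)) * (rho * DU 1 x / eta)) (at x)"
      by (simp add: T_def[abs_def])
    moreover have "inverse (real n * T x ^ (n - Suc 0)) * (rho * DU 1 x / eta) = inverse (Xd (T x) 0)"
    proof -
      have ir: "inverse rho = rho" using rho by auto
      have "Xd (T x) 0 = T x ^ (n - Suc 0) * (real n * rho * eta / DU 1 x)"
        using XT(2)[OF x(1)] by (simp add: Xd_def k0_def n_def)
      then show ?thesis
        by (simp add: divide_inverse inverse_mult_distrib mult_ac ir)
    qed
    ultimately show ?thesis by (simp add: has_real_derivative_iff_has_vector_derivative)
  qed
  have T0: "T x = 0 \<longleftrightarrow> U x = cs" for x
    using n rho eta by (auto simp: T_def)
  define f where "f x = fst (Y (T x))" for x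
  define v where "v x = snd (Y (T x))" for x
  have dfv: "((\<lambda>x. (f x, v x)) has_vector_derivative sysmat k x (L x) (f x, v x)) (at x within {a..b})"
    if x: "x \<in> {a..b}" "U x \<noteq> cs" for x
  proof -
    have t: "T x \<in> chart_dom" "T x \<noteq> 0" using XT[OF x(1)] x T0 by auto
    have "(Y has_vector_derivative chart_mat \<sigma> k (T x) 0 (Y (T x))) (at (T x) within T ` {a..b})"
      using Y(2)[OF t(1)] XT(1) by (auto intro: has_vector_derivative_within_subset)
    from vector_diff_chain_within[OF has_vector_derivative_at_within[OF Td[OF x]] this]
    have "((\<lambda>x. Y (T x)) has_vector_derivative inverse (Xd (T x) 0) *\<^sub>R chart_mat \<sigma> k (T x) 0 (Y (T x))) (at x within {a..b})"
      by (simp add: o_def)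
    moreover have "inverse (Xd (T x) 0) *\<^sub>R chart_mat \<sigma> k (T x) 0 (Y (T x)) = sysmat k x (L x) (Y (T x))"
      using chart_mat_eq[OF t(1) z t(2), of \<sigma> k] Xd_pos[OF t(1) z t(2)] XT(2)[OF x(1)]
      by (simp add: blinfun.scaleR_left L_def)
    ultimately show ?thesis by (simp add: f_def v_def)
  qed
  define g where "g x = v x + of_real (P0 x) * L x * f x" for x
  have ode: "ode_at k (of_real cs) f g {a..b} x" if x: "x \<in> {a..b}" "U x \<noteq> cs" for x
  proof -
    have x': "x \<in> {lo<..<hi}" using x ab by auto
    have "((\<lambda>x. U x - cs) has_real_derivative DU 1 x) (at x within {a..b})"
      by (rule has_field_derivative_at_within) (use U_deriv[of x] x' in \<open>auto intro!: derivative_eq_intros\<close>)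
    from log_branch_deriv[OF this, of \<sigma>] x
    have Ld: "(L has_vector_derivative of_real (DU 1 x) / (of_real (U x) - of_real cs)) (at x within {a..b})"
      by (simp add: L_def[abs_def])
    have xx: "x \<in> {0<..<h}" "DU 1 x \<noteq> 0" "complex_of_real (U x) \<noteq> of_real cs"
      using x' lo_pos hi_less DU1_nz x by auto
    from sysmat_deriv_back[OF xx dfv[OF x] Ld]
    show ?thesis unfolding ode_at_def g_def[abs_def] by (rule conjI)
  qed
  have lay: "(f \<longlongrightarrow> f s) (at s) \<and> (\<exists>v0. ((\<lambda>x. g x - of_real (P0 x) * log_branch \<sigma> (U x - cs) * f x) \<longlongrightarrow> v0) (at s))"
    if s: "s \<in> {a<..<b}" "U s = cs" for s
  proof -
    have "(Y has_vector_derivative chart_mat \<sigma> k 0 0 (Y 0)) (at 0)"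
      using Y(2)[of 0] at_within_interior[of 0 chart_dom] by simp
    then have "isCont Y 0" by (rule has_vector_derivative_continuous)
    then have "isCont Y (T s)" using T0[of s] s(2) by simp
    moreover have "isCont T s" using Tc s ab by auto
    ultimately have "isCont (\<lambda>x. Y (T x)) s" by (rule isCont_o2[rotated])
    then have "((\<lambda>x. Y (T x)) \<longlongrightarrow> Y (T s)) (at s)" by (simp add: isCont_def)
    from tendsto_fst[OF this] tendsto_snd[OF this]
    show ?thesis unfolding f_def g_def v_def L_def by auto
  qed
  have "part_sys k cs \<sigma> f g a b" using ode lay by (auto simp: part_sys_def)
  moreover have "T b = 1" using TX[of 1] by (simp add: b_def)
  then have "f b = y0" "g b = y1" using Y(1) by (auto simp: f_def g_def v_def)
  ultimately show ?thesis using that by (simp add: a_def b_def)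
qed

section \<open>Existence of the limiting solution\<close>

context profile
begin

text \<open>The solution grows from \<open>h\<close> downwards: each step of
  \<open>layer_induct\<close> glues a new piece on the left, started with the values of the old
  piece at its left end.\<close>

lemma limit_sys_exists:
  assumes c: "regular_speed c" and \<sigma>: "\<bar>\<sigma>\<bar> \<le> 1"
  obtains f g where "limit_sys k c \<sigma> f g" "f h = 0" "g h = 1"
proof -
  define P where "P x \<longleftrightarrow> (\<exists>f g. part_sys k c \<sigma> f g x h \<and> f h = 0 \<and> g h = 1)" for x
  have U0: "U 0 \<noteq> c" "U h \<noteq> c" using c by (auto simp: regular_speed_def)
  obtain q :: nat where q: "1 \<le> q" by blast
  have "P 0"
  proof (rule layer_induct[OF c _ _ _ q, of P 0])
    show "P h"
      unfolding P_def by (rule part_sys_regular[of h h c k \<sigma> 0 1]) (use h_pos U0 in auto)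
    show "P a" if ab: "0 \<le> a" "a \<le> b" "b \<le> h" "\<And>x. x \<in> {a..b} \<Longrightarrow> U x \<noteq> c" and Pb: "P b" for a b
    proof -
      obtain f2 g2 where 2: "part_sys k c \<sigma> f2 g2 b h" "f2 h = 0" "g2 h = 1" using Pb by (auto simp: P_def)
      obtain f1 g1 where 1: "part_sys k c \<sigma> f1 g1 a b" "f1 b = f2 b" "g1 b = g2 b"
        by (rule part_sys_regular[OF ab, of k \<sigma> "f2 b" "g2 b"], simp, rule that)
      have "U b \<noteq> c" using ab by auto
      note glue = part_sys_glue[OF 1(1) 2(1) ab(2,3) 1(2,3) this]
      show ?thesis
        unfolding P_def by (rule exI, rule exI, rule conjI, rule glue) (use 1 2 ab in auto)
    qed
    show "P (layer.X c rho eta V q (-1) 0)" if L: "layer h U l c rho eta lo hi V q"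
      and Pb: "P (layer.X c rho eta V q 1 0)" for rho eta lo hi V
    proof -
      interpret L: layer h U l c rho eta lo hi V q by (rule L)
      define a b where "a = L.X (-1) 0" and "b = L.X 1 0"
      have z: "(0::real) \<in> L.speeds" using L.eta by simp
      have ab: "a \<in> {lo<..<hi}" "b \<in> {lo<..<hi}" "a < b" "U b \<noteq> c"
        using L.X_in[of "-1" 0] L.X_in[of 1 0] z L.X_mono[OF z, of "-1" 1] L.U_X_ne[OF _ z, of 1]
        by (auto simp: a_def b_def)
      obtain f2 g2 where 2: "part_sys k c \<sigma> f2 g2 b h" "f2 h = 0" "g2 h = 1"
        using Pb by (auto simp: P_def b_def)
      obtain f1 g1 where 1: "part_sys k c \<sigma> f1 g1 a b" "f1 b = f2 b" "g1 b = g2 b"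
      proof (rule L.part_sys_layer[OF \<sigma>, of k "f2 b" "g2 b"])
        fix f g assume "part_sys k c \<sigma> f g (L.X (-1) 0) (L.X 1 0)" "f (L.X 1 0) = f2 b" "g (L.X 1 0) = g2 b"
        then show thesis by (intro that[of f g]) (simp_all only: a_def b_def)
      qed
      have "a \<le> b" "b \<le> h" using ab L.hi_less by auto
      note glue = part_sys_glue[OF 1(1) 2(1) this 1(2,3) ab(4)]
      show ?thesis
        unfolding P_def a_def[symmetric]
        by (rule exI, rule exI, rule conjI, rule glue) (use 1 2 ab L.hi_less in auto)
    qed
  qed (use h_pos U0 in auto)
  then obtain f g where fg: "part_sys k c \<sigma> f g 0 h" "f h = 0" "g h = 1" by (auto simp: P_def)
  note a = fg(1)[unfolded part_sys_def]
  have "limit_sys k c \<sigma> f g"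
    unfolding limit_sys_def
  proof (intro conjI ballI impI)
    show "(f has_vector_derivative g x) (at x within {0..h})" if "x \<in> {0..h}" "U x \<noteq> c" for x
      using a that by (auto simp: ode_at_def)
    show "continuous_on {x \<in> {0..h}. U x \<noteq> c} g"
    proof (rule continuous_on_vector_derivative)
      fix x assume x: "x \<in> {x \<in> {0..h}. U x \<noteq> c}"
      then have "(g has_vector_derivative (of_real (DU 2 x) / (of_real (U x) - of_real c) + of_real (k\<^sup>2)) * f x) (at x within {0..h})"
        using a by (auto simp: ode_at_def)
      then show "(g has_vector_derivative (of_real (DU 2 x) / (of_real (U x) - of_real c) + of_real (k\<^sup>2)) * f x)
          (at x within {x \<in> {0..h}. U x \<noteq> c})"
        by (rule has_vector_derivative_within_subset) auto
    qed
    show "ode_at k (of_real c) f g UNIV x" if "x \<in> {0<..<h}" "U x \<noteq> c" for x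
    proof -
      have "at x within {0..h} = at x" by (rule at_within_interior) (use that in auto)
      moreover have "ode_at k (of_real c) f g {0..h} x" using a that by auto
      ultimately show ?thesis by (simp add: ode_at_def)
    qed
    fix s assume s: "s \<in> {0..h}" "U s = c"
    then have "s \<in> {0<..<h}" by (rule regular_speed_interior[OF c])
    then show "(f \<longlongrightarrow> f s) (at s)" "\<exists>v0. ((\<lambda>x. g x - of_real (P0 x) * log_branch \<sigma> (U x - c) * f x) \<longlongrightarrow> v0) (at s)"
      using a s by auto
  qed
  then show ?thesis using fg that by blast
qed

lemma limit_solution_exists_unique:
  assumes c: "regular_speed c" and \<sigma>: "\<bar>\<sigma>\<bar> \<le> 1"
  shows "\<exists>y. limit_solution h U k c \<sigma> y \<and> (\<forall>z. limit_solution h U k c \<sigma> z \<longrightarrow> (\<forall>x\<in>{0..h}. z x = y x))"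
proof -
  obtain f g where fg: "limit_sys k c \<sigma> f g" "f h = 0" "g h = 1" by (rule limit_sys_exists[OF c \<sigma>], rule that)
  show ?thesis
  proof (intro exI[of _ f] conjI allI impI ballI)
    show "limit_solution h U k c \<sigma> f" by (rule limit_solutionI[OF c \<sigma> fg])
    fix z x assume z: "limit_solution h U k c \<sigma> z" and x: "x \<in> {0..h}"
    note D = limit_solutionD[OF c \<sigma> z]
    show "z x = f x" by (rule limit_sys_unique[OF c \<sigma> D(1) fg(1) _ _ x]) (use D fg in auto)
  qed
qed

lemma ystar_limit_sys:
  assumes c: "regular_speed c" and \<sigma>: "\<bar>\<sigma>\<bar> \<le> 1"
  shows "limit_sys k c \<sigma> (ystar h U k c \<sigma>) (deriv_within {0..h} (ystar h U k c \<sigma>))"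
    "ystar h U k c \<sigma> h = 0" "deriv_within {0..h} (ystar h U k c \<sigma>) h = 1"
proof -
  have "limit_solution h U k c \<sigma> (ystar h U k c \<sigma>)"
  proof -
    have "\<exists>y. limit_solution h U k c \<sigma> y" using limit_solution_exists_unique[OF c \<sigma>] by blast
    then show ?thesis unfolding ystar_def by (rule someI_ex)
  qed
  from limit_solutionD[OF c \<sigma> this]
  show "limit_sys k c \<sigma> (ystar h U k c \<sigma>) (deriv_within {0..h} (ystar h U k c \<sigma>))"
    "ystar h U k c \<sigma> h = 0" "deriv_within {0..h} (ystar h U k c \<sigma>) h = 1" by auto
qed

end

section \<open>Estimates near a layer and convergence\<close>

text \<open>The derivative \<open>- i / (1 - i x)\<close> has modulus at most 1.\<close>

lemma Ln_one_minus_le: "norm (Ln (1 - \<i> * of_real x)) \<le> \<bar>x\<bar>"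
proof -
  have "norm (Ln (1 - \<i> * of_real x) - Ln (1 - \<i> * of_real 0)) \<le> 1 * norm (x - 0)"
  proof (rule differentiable_bound[where S = UNIV and f' = "\<lambda>x h. h *\<^sub>R (- \<i> / (1 - \<i> * of_real x))"])
    fix x :: real
    have n: "1 - \<i> * of_real x \<notin> \<real>\<^sub>\<le>\<^sub>0" by (simp add: complex_nonpos_Reals_iff)
    have "((\<lambda>x. 1 - \<i> * of_real x) has_vector_derivative - \<i>) (at x)"
      by (auto intro!: derivative_eq_intros)
    from field_vector_diff_chain_at[OF this has_field_derivative_Ln[OF n]]
    show "((\<lambda>x. Ln (1 - \<i> * of_real x)) has_derivative (\<lambda>h. h *\<^sub>R (- \<i> / (1 - \<i> * of_real x)))) (at x within UNIV)"
      by (simp add: o_def has_vector_derivative_def divide_inverse)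
    have "1 \<le> norm (1 - \<i> * of_real x)"
      using abs_Re_le_cmod[of "1 - \<i> * of_real x"] by simp
    then have "norm (- \<i> / (1 - \<i> * of_real x)) \<le> 1"
      by (simp add: norm_divide divide_le_eq)
    then show "onorm (\<lambda>h. h *\<^sub>R (- \<i> / (1 - \<i> * of_real x))) \<le> 1"
      by (intro onorm_le) (simp add: mult_left_le)
  qed auto
  then show ?thesis by simp
qed

text \<open>For \<open>|x| \<le> 1\<close> the linear bound beats the power; for larger
  \<open>x\<close> the logarithm grows slower than any power. The 5 is 1 for \<open>ln 2\<close>
  plus 4 for the argument, as pi is below 4.\<close>

lemma Ln_one_minus_powr:
  assumes a: "0 < \<alpha>" "\<alpha> < 1"
  shows "norm (Ln (1 - \<i> * of_real x)) \<le> (5 + 1 / \<alpha>) * \<bar>x\<bar> powr \<alpha>"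
proof (cases "\<bar>x\<bar> \<le> 1")
  case True
  have "\<bar>x\<bar> \<le> \<bar>x\<bar> powr \<alpha>"
  proof (cases "x = 0")
    case False
    then have "\<bar>x\<bar> powr 1 \<le> \<bar>x\<bar> powr \<alpha>" using True a by (intro powr_mono') auto
    then show ?thesis using False by simp
  qed simp
  also have "\<dots> \<le> (5 + 1 / \<alpha>) * \<bar>x\<bar> powr \<alpha>"
    using mult_right_mono[of 1 "5 + 1 / \<alpha>" "\<bar>x\<bar> powr \<alpha>"] a by simp
  finally show ?thesis using Ln_one_minus_le[of x] by linarith
next
  case False
  define z where "z = 1 - \<i> * complex_of_real x"
  have z: "1 \<le> norm z" using abs_Re_le_cmod[of z] by (simp add: z_def)
  have "norm z \<le> 1 + \<bar>x\<bar>"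
    unfolding z_def by (rule order_trans[OF norm_triangle_ineq4]) (simp add: norm_mult)
  then have "norm z \<le> 2 * \<bar>x\<bar>" using False by linarith
  then have "ln (norm z) \<le> ln (2 * \<bar>x\<bar>)" using z False by (subst ln_le_cancel_iff) auto
  also have "\<dots> = ln 2 + ln \<bar>x\<bar>" using False by (simp add: ln_mult)
  also have "\<dots> \<le> 1 + \<bar>x\<bar> powr \<alpha> / \<alpha>"
    using ln_powr_bound[of "\<bar>x\<bar>" \<alpha>] ln_le_minus_one[of "2::real"] False a by (intro add_mono) auto
  finally have re: "\<bar>Re (Ln z)\<bar> \<le> 1 + \<bar>x\<bar> powr \<alpha> / \<alpha>"
    using z by (subst Re_Ln) auto
  have "z \<noteq> 0" using z by auto
  then have im: "\<bar>Im (Ln z)\<bar> \<le> 4"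
    using mpi_less_Im_Ln[of z] Im_Ln_le_pi[of z] pi_less_4 by auto
  have "norm (Ln z) \<le> 5 + \<bar>x\<bar> powr \<alpha> / \<alpha>"
    using cmod_le[of "Ln z"] re im by linarith
  also have "\<dots> \<le> 5 * \<bar>x\<bar> powr \<alpha> + \<bar>x\<bar> powr \<alpha> / \<alpha>"
    using ge_one_powr_ge_zero[of "\<bar>x\<bar>" \<alpha>] False a by simp
  finally show ?thesis by (simp add: z_def algebra_simps)
qed

text \<open>Factor \<open>w - i e = w (1 - i e / w)\<close>. The sum is a logarithm of the product;
  that it is the principal one is checked on the imaginary part, where for \<open>w < 0\<close> the
  shift by pi and the argument of the second factor have opposite signs.\<close>

lemma Ln_eq_log_branch:
  assumes w: "w \<noteq> 0" and e: "e \<noteq> 0"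
  shows "Ln (of_real w - \<i> * of_real e) = log_branch (sgn e) w + Ln (1 - \<i> * of_real (e / w))"
proof (rule Ln_unique)
  define z where "z = 1 - \<i> * complex_of_real (e / w)"
  have z: "z \<noteq> 0" "Re z = 1" "Im z = - (e / w)" by (auto simp: z_def complex_eq_iff)
  have eL: "exp (log_branch (sgn e) w) = of_real w"
  proof (cases "w < 0")
    case True
    have "exp (\<i> * of_real (sgn e * pi)) = (-1 :: complex)"
      using e by (auto simp: sgn_if exp_minus)
    moreover have "exp (complex_of_real (ln \<bar>w\<bar>)) = of_real \<bar>w\<bar>" using w by (simp add: exp_of_real)
    ultimately show ?thesis using True by (simp add: log_branch_def exp_diff del: of_real_mult)
  next
    case False
    then show ?thesis using w by (simp add: log_branch_def exp_of_real)
  qed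
  show "exp (log_branch (sgn e) w + Ln (1 - \<i> * of_real (e / w))) = of_real w - \<i> * of_real e"
    using w z(1) unfolding exp_add eL z_def[symmetric] by (simp add: z_def algebra_simps)
  have h: "\<bar>Im (Ln z)\<bar> < pi / 2" using Re_Ln_pos_lt[OF z(1)] z(2) by simp
  have pos: "Im z > 0 \<Longrightarrow> Im (Ln z) > 0" using Im_Ln_pos_lt[OF z(1)] by auto
  have neg: "Im z < 0 \<Longrightarrow> Im (Ln z) < 0" using Im_Ln_pos_le[OF z(1)] Im_Ln_le_pi[OF z(1)] by auto
  have L: "Im (log_branch (sgn e) w) = - (if w < 0 then sgn e * pi else 0)"
    by (simp add: log_branch_def)
  have "- pi < Im (log_branch (sgn e) w + Ln z) \<and> Im (log_branch (sgn e) w + Ln z) \<le> pi"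
  proof (cases "w < 0")
    case False
    then show ?thesis using h by (simp add: L) (use pi_gt_zero in linarith)
  next
    case True
    show ?thesis
    proof (cases "e > 0")
      case True
      then have "Im z > 0" using \<open>w < 0\<close> z(3) by (simp add: divide_neg_pos divide_pos_neg)
      moreover have "Im (log_branch (sgn e) w) = - pi" using L True \<open>w < 0\<close> by simp
      ultimately show ?thesis using pos h unfolding plus_complex.sel by linarith
    next
      case False
      then have "Im z < 0" using \<open>w < 0\<close> z(3) e by (simp add: divide_neg_neg)
      moreover have "Im (log_branch (sgn e) w) = pi" using L False e \<open>w < 0\<close> by simp
      ultimately show ?thesis using neg h unfolding plus_complex.sel by linarith
    qed
  qed
  then show "- pi < Im (log_branch (sgn e) w + Ln (1 - \<i> * of_real (e / w)))"
    "Im (log_branch (sgn e) w + Ln (1 - \<i> * of_real (e / w))) \<le> pi" by (auto simp: z_def)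
qed

lemma Ln_log_branch_diff:
  assumes "0 < \<alpha>" "\<alpha> < 1" "w \<noteq> 0" "e \<noteq> 0"
  shows "norm (Ln (of_real w - \<i> * of_real e) - log_branch (sgn e) w) \<le> (5 + 1 / \<alpha>) * (\<bar>e\<bar> / \<bar>w\<bar>) powr \<alpha>"
  using Ln_one_minus_powr[OF assms(1,2), of "e / w"] unfolding Ln_eq_log_branch[OF assms(3,4)] by simp

lemma norm_log_branch: "\<bar>\<sigma>\<bar> \<le> 1 \<Longrightarrow> norm (log_branch \<sigma> w) \<le> \<bar>ln \<bar>w\<bar>\<bar> + pi"
proof -
  assume "\<bar>\<sigma>\<bar> \<le> 1"
  then have "norm (if w < 0 then \<i> * of_real (\<sigma> * pi) else 0 :: complex) \<le> pi"
    by (auto simp: norm_mult abs_mult mult_left_le_one_le)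
  then show ?thesis unfolding log_branch_def by (intro order_trans[OF norm_triangle_ineq4]) simp
qed

text \<open>A bound on \<open>B2\<close> suffices, as \<open>B1\<close> lies within \<open>E\<close>
  of it. The inner \<open>K\<close> bounds \<open>Y2\<close>, which multiplies the coefficient
  error; the outer \<open>K\<close> propagates the difference.\<close>

lemma gronwall_diff:
  fixes Y1 Y2 :: "real \<Rightarrow> 'a::{real_inner}"
  assumes c: "continuous_on {a..b} Y1" "continuous_on {a..b} Y2" and t: "t \<in> {a..b}"
    and d1: "\<And>x. x \<in> {a<..<b} - {z} \<Longrightarrow> (Y1 has_vector_derivative blinfun_apply (B1 x) (Y1 x)) (at x)"
    and d2: "\<And>x. x \<in> {a<..<b} - {z} \<Longrightarrow> (Y2 has_vector_derivative blinfun_apply (B2 x) (Y2 x)) (at x)"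
    and B: "\<And>x. x \<in> {a<..<b} - {z} \<Longrightarrow> norm (B1 x - B2 x) \<le> e" "\<And>x. x \<in> {a<..<b} \<Longrightarrow> norm (B2 x) \<le> C"
    and C: "0 \<le> C" and e: "0 \<le> e" "e \<le> E"
    and K: "K = 4 * exp (2 * (C + E + 1) * (b - a))"
  shows "norm (Y1 t - Y2 t) \<le> K * (norm (Y1 b - Y2 b) + e * (K * norm (Y2 b)))"
proof -
  have Y2: "norm (Y2 x) \<le> K * norm (Y2 b)" if "x \<in> {a..b}" for x
  proof -
    have "norm (Y2 x) \<le> 4 * exp (2 * (C + 1) * (b - a)) * norm (Y2 b)"
      by (rule gronwall_linear[OF c(2) that d2 B(2) C])
    also have "\<dots> \<le> K * norm (Y2 b)"
      unfolding K using e C t by (intro mult_right_mono mult_left_mono) (auto intro!: mult_right_mono)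
    finally show ?thesis .
  qed
  have "norm (Y1 t - Y2 t) \<le> 4 * exp (2 * (C + E + 1) * (b - a)) * (norm (Y1 b - Y2 b) + e * (K * norm (Y2 b)))"
  proof (rule gronwall[where Y = "\<lambda>x. Y1 x - Y2 x" and z = z and Y' = "\<lambda>x. B1 x (Y1 x) - B2 x (Y2 x)"])
    fix x assume x: "x \<in> {a<..<b} - {z}"
    show "((\<lambda>x. Y1 x - Y2 x) has_vector_derivative B1 x (Y1 x) - B2 x (Y2 x)) (at x)"
      by (intro has_vector_derivative_diff d1 d2 x)
    have eq: "B1 x (Y1 x) - B2 x (Y2 x) = B1 x (Y1 x - Y2 x) + (B1 x - B2 x) (Y2 x)"
      by (simp add: blinfun.diff_left blinfun.diff_right)
    have "norm (B1 x) \<le> norm (B2 x) + norm (B1 x - B2 x)"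
      using norm_triangle_ineq[of "B2 x" "B1 x - B2 x"] by simp
    also have "\<dots> \<le> C + E" using B(1)[OF x] B(2)[of x] x e by auto
    finally have "norm (B1 x (Y1 x - Y2 x)) \<le> (C + E) * norm (Y1 x - Y2 x)"
      by (intro order_trans[OF norm_blinfun] mult_right_mono) auto
    moreover have "norm ((B1 x - B2 x) (Y2 x)) \<le> e * (K * norm (Y2 b))"
      by (rule order_trans[OF norm_blinfun mult_mono[OF B(1)[OF x] Y2]]) (use x e in auto)
    ultimately show "norm (B1 x (Y1 x) - B2 x (Y2 x)) \<le> (C + E) * norm (Y1 x - Y2 x) + e * (K * norm (Y2 b))"
      unfolding eq by (intro order_trans[OF norm_triangle_ineq] add_mono)
  qed (use c t C e K in \<open>auto intro!: continuous_intros\<close>)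
  then show ?thesis by (simp add: K)
qed

section \<open>Complex speeds in the chart of their real part\<close>

context layer
begin

text \<open>The chart of the real speed \<open>cs\<close>, that is \<open>d = 0\<close>, is used for
  \<open>cs + i e\<close> as well: the imaginary part enters through the logarithm alone.\<close>

definition chart_mat_complex :: "real \<Rightarrow> real \<Rightarrow> real \<Rightarrow> (complex \<times> complex) \<Rightarrow>\<^sub>L (complex \<times> complex)" where
  "chart_mat_complex k e t = Xd t 0 *\<^sub>R sysmat k (X t 0) (Ln (of_real (U (X t 0) - cs) - \<i> * of_real e))"

text \<open>\<open>sysmat\<close> is quadratic in \<open>L\<close>, and
  \<open>L^2 - L'^2 = \<delta> (\<delta> + 2 L')\<close> with \<open>\<delta> = L - L'\<close>;
  hence the product of the difference with the size of the logarithms.\<close>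

lemma norm_sysmat_diff:
  "norm (sysmat k x L - sysmat k x L') \<le>
     (2 * \<bar>P0 x\<bar> + \<bar>P1 x\<bar> + 2 * \<bar>P0 x\<bar>\<^sup>2) * (norm (L - L') * (1 + norm (L - L') + norm L'))"
proof -
  define \<delta> where "\<delta> = L - L'"
  have eq: "sysmat k x L - sysmat k x L' = mat2 (of_real (P0 x) * \<delta>) 0
      (- (of_real (P1 x) * \<delta> + of_real ((P0 x)\<^sup>2) * (\<delta> * (\<delta> + 2 * L')))) (- (of_real (P0 x) * \<delta>))"
    unfolding sysmat_def mat2_diff by (simp add: \<delta>_def algebra_simps power2_eq_square)
  have "norm (of_real (P1 x) * \<delta> + of_real ((P0 x)\<^sup>2) * (\<delta> * (\<delta> + 2 * L'))) \<le>
      \<bar>P1 x\<bar> * norm \<delta> + (P0 x)\<^sup>2 * (norm \<delta> * (norm \<delta> + 2 * norm L'))"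
  proof (rule order_trans[OF norm_triangle_ineq], rule add_mono)
    have "norm (\<delta> + 2 * L') \<le> norm \<delta> + 2 * norm L'"
      by (rule order_trans[OF norm_triangle_ineq]) (simp add: norm_mult)
    then show "norm (of_real ((P0 x)\<^sup>2) * (\<delta> * (\<delta> + 2 * L'))) \<le> (P0 x)\<^sup>2 * (norm \<delta> * (norm \<delta> + 2 * norm L'))"
      unfolding norm_mult by (intro mult_mono) (auto simp: norm_power)
  qed (simp add: norm_mult)
  then have "norm (sysmat k x L - sysmat k x L') \<le>
      2 * (\<bar>P0 x\<bar> * norm \<delta>) + (\<bar>P1 x\<bar> * norm \<delta> + (P0 x)\<^sup>2 * (norm \<delta> * (norm \<delta> + 2 * norm L')))"
    unfolding eq by (intro order_trans[OF norm_mat2]) (simp only: norm_minus_cancel norm_zero norm_mult norm_of_real)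
  also have "\<dots> \<le> 2 * (\<bar>P0 x\<bar> * (norm \<delta> * (1 + norm \<delta> + norm L'))) + (\<bar>P1 x\<bar> * (norm \<delta> * (1 + norm \<delta> + norm L'))
      + (P0 x)\<^sup>2 * (norm \<delta> * (2 * (1 + norm \<delta> + norm L'))))"
  proof -
    have "norm \<delta> * 1 \<le> norm \<delta> * (1 + norm \<delta> + norm L')" by (intro mult_left_mono) auto
    then show ?thesis by (intro add_mono mult_left_mono) auto
  qed
  finally show ?thesis by (simp add: \<delta>_def algebra_simps power2_eq_square)
qed

lemma P_bounded:
  obtains A where "A > 0" "\<And>t. t \<in> chart_dom \<Longrightarrow> 2 * \<bar>P0 (X t 0)\<bar> + \<bar>P1 (X t 0)\<bar> + 2 * \<bar>P0 (X t 0)\<bar>\<^sup>2 \<le> A"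
    "\<And>t. t \<in> chart_dom \<Longrightarrow> \<bar>P0 (X t 0)\<bar> \<le> A" "\<And>t. t \<in> chart_dom \<Longrightarrow> \<bar>Xd t 0\<bar> \<le> A * \<bar>t\<bar> ^ (2 * q)"
proof -
  have z: "(0::real) \<in> speeds" using eta by simp
  have c: "Ck_param 0 chart_dom speeds (\<lambda>t d. P0 (X t d))" "Ck_param 0 chart_dom speeds (\<lambda>t d. P1 (X t d))" "Ck_param 0 chart_dom speeds k0"
    by (rule Ck_param_P0 Ck_param_P1 Ck_param_k0, use l_ge in simp)+
  obtain A0 where A0: "A0 > 0" "\<And>t. t \<in> chart_dom \<Longrightarrow> norm (P0 (X t 0)) \<le> A0"
    by (rule Ck_param_bounded[OF compact_Icc z c(1)], rule that)
  obtain A1 where A1: "A1 > 0" "\<And>t. t \<in> chart_dom \<Longrightarrow> norm (P1 (X t 0)) \<le> A1"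
    by (rule Ck_param_bounded[OF compact_Icc z c(2)], rule that)
  obtain A2 where A2: "A2 > 0" "\<And>t. t \<in> chart_dom \<Longrightarrow> norm (k0 t 0) \<le> A2"
    by (rule Ck_param_bounded[OF compact_Icc z c(3)], rule that)
  define A where "A = 2 * A0 + A1 + 2 * A0\<^sup>2 + A2"
  show ?thesis
  proof (rule that[of A])
    show "A > 0" using A0 A1 A2 by (simp add: A_def add_pos_nonneg)
    fix t assume t: "t \<in> chart_dom"
    have "\<bar>P0 (X t 0)\<bar>\<^sup>2 \<le> A0\<^sup>2" using A0(2)[OF t] by (intro power_mono) auto
    then show "2 * \<bar>P0 (X t 0)\<bar> + \<bar>P1 (X t 0)\<bar> + 2 * \<bar>P0 (X t 0)\<bar>\<^sup>2 \<le> A"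
      using A0(2)[OF t] A1(2)[OF t] A2(1) unfolding A_def real_norm_def by linarith
    have "0 \<le> A0\<^sup>2" by simp
    then show "\<bar>P0 (X t 0)\<bar> \<le> A"
      using A0(2)[OF t] A0(1) A1(1) A2(1) unfolding A_def real_norm_def by linarith
    have "\<bar>k0 t 0\<bar> \<le> A"
      using A2(2)[OF t] A0(1) A1(1) \<open>0 \<le> A0\<^sup>2\<close> unfolding A_def real_norm_def by linarith
    then show "\<bar>Xd t 0\<bar> \<le> A * \<bar>t\<bar> ^ (2 * q)"
      unfolding Xd_def abs_mult power_abs mult.commute[of A] by (rule mult_left_mono) simp
  qed
qed

text \<open>The exponent condition makes the order \<open>2 q\<close> of the zero of \<open>dX/dt\<close> dominate the singularity
  \<open>(\<bar>e\<bar> / \<bar>t\<bar> ^ (2 q + 1)) powr \<alpha>\<close> of the difference of the logarithms, with room for a further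
  logarithm.\<close>

lemma chart_mat_complex_diff:
  assumes a: "0 < \<alpha>" "\<alpha> < 1" and qa: "real (2 * q + 1) * ((1 + \<alpha>) / 2) \<le> real (2 * q)"
  obtains C where "C > 0" "\<And>k e t. t \<in> chart_dom - {0} \<Longrightarrow> 0 < \<bar>e\<bar> \<Longrightarrow> \<bar>e\<bar> < 1 \<Longrightarrow>
     norm (chart_mat_complex k e t - chart_mat (sgn e) k t 0) \<le> C * \<bar>e\<bar> powr \<alpha>"
proof -
  have z: "(0::real) \<in> speeds" using eta by simp
  obtain A where A: "A > 0" "\<And>t. t \<in> chart_dom \<Longrightarrow> 2 * \<bar>P0 (X t 0)\<bar> + \<bar>P1 (X t 0)\<bar> + 2 * \<bar>P0 (X t 0)\<bar>\<^sup>2 \<le> A"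
    "\<And>t. t \<in> chart_dom \<Longrightarrow> \<bar>Xd t 0\<bar> \<le> A * \<bar>t\<bar> ^ (2 * q)"
    by (rule P_bounded, rule that)
  define p where "p = real (2 * q + 1)"
  have p: "p > 0" by (simp add: p_def)
  \<comment> \<open>A second, small exponent: \<open>\<alpha>\<close> gives the rate in
    \<open>e\<close>, while \<open>\<beta>\<close> controls the remaining power of the logarithm
    without using that \<open>e\<close> is small. Their sum is the \<open>(1 + \<alpha>) / 2\<close>
    of the hypothesis.\<close>
  define \<beta> where "\<beta> = (1 - \<alpha>) / 2"
  have b: "0 < \<beta>" "\<beta> < 1" using a by (auto simp: \<beta>_def)
  define c1 where "c1 = (5 + 1 / \<alpha>) * eta powr (- \<alpha>)"
  define c2 where "c2 = (5 + 1 / \<beta>) * eta powr (- \<beta>)"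
  define c3 where "c3 = 1 / \<beta> + \<bar>ln eta\<bar> + pi"
  have c: "c1 > 0" "c2 > 0" "c3 > 0" using a b eta by (auto simp: c1_def c2_def c3_def add_pos_nonneg add_pos_pos)
  show ?thesis
  proof (rule that[of "A * A * (c1 * (1 + c2 + c3))"])
    show "0 < A * A * (c1 * (1 + c2 + c3))" using A c by simp
    fix k e t :: real assume t: "t \<in> chart_dom - {0}" and e: "0 < \<bar>e\<bar>" "\<bar>e\<bar> < 1"
    then have t': "t \<in> chart_dom" "t \<noteq> 0" by auto
    define r where "r = \<bar>t\<bar>"
    have r: "0 < r" "r \<le> 1" using t' by (auto simp: r_def)
    define w where "w = U (X t 0) - cs"
    have w: "\<bar>w\<bar> = eta * r powr p" "w \<noteq> 0"
    proof -
      have "w = rho * t ^ (2 * q + 1) * eta" using U_X_minus_rho[OF t'(1) z] by (simp add: w_def)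
      then have "\<bar>w\<bar> = eta * r ^ (2 * q + 1)"
        using rho eta unfolding r_def by (auto simp: abs_mult power_abs)
      also have "r ^ (2 * q + 1) = r powr p" unfolding p_def by (rule powr_realpow[OF r(1), symmetric])
      finally show "\<bar>w\<bar> = eta * r powr p" .
      then show "w \<noteq> 0" using eta r by auto
    qed
    define L' where "L' = log_branch (sgn e) w"
    define L where "L = Ln (of_real w - \<i> * of_real e)"
    have pw: "(\<bar>e\<bar> / \<bar>w\<bar>) powr g = \<bar>e\<bar> powr g * (eta powr (- g) * r powr (- (p * g)))" for g
      unfolding w(1) using eta r e
      by (simp add: powr_mult powr_powr powr_minus divide_inverse inverse_powr)
    have e': "e \<noteq> 0" using e by auto
    have d1: "norm (L - L') \<le> c1 * \<bar>e\<bar> powr \<alpha> * r powr (- (p * \<alpha>))"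
      using Ln_log_branch_diff[OF a w(2) e'] unfolding pw L_def L'_def c1_def by (simp add: mult_ac)
    have "\<bar>e\<bar> powr \<beta> \<le> 1" using e b by (intro powr_le1) auto
    then have "\<bar>e\<bar> powr \<beta> * (eta powr (- \<beta>) * r powr (- (p * \<beta>))) \<le> 1 * (eta powr (- \<beta>) * r powr (- (p * \<beta>)))"
      by (intro mult_right_mono) auto
    then have "(5 + 1 / \<beta>) * (\<bar>e\<bar> powr \<beta> * (eta powr (- \<beta>) * r powr (- (p * \<beta>)))) \<le>
        (5 + 1 / \<beta>) * (1 * (eta powr (- \<beta>) * r powr (- (p * \<beta>))))"
      using b by (intro mult_left_mono) auto
    then have d2: "norm (L - L') \<le> c2 * r powr (- (p * \<beta>))"
      using Ln_log_branch_diff[OF b w(2) e'] unfolding pw L_def L'_def c2_def by (simp add: mult_ac)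
    have ge1: "1 \<le> r powr (- (p * \<beta>))"
      using powr_mono'[of "- (p * \<beta>)" 0 r] r p b by simp
    have "ln (1 / r) \<le> (1 / r) powr (p * \<beta>) / (p * \<beta>)"
      by (rule ln_powr_bound) (use r p b in auto)
    also have "(1 / r) powr (p * \<beta>) = r powr (- (p * \<beta>))"
      using r by (simp add: powr_minus divide_inverse inverse_powr)
    finally have "p * \<bar>ln r\<bar> \<le> r powr (- (p * \<beta>)) / \<beta>"
      using r p b by (simp add: ln_div field_simps)
    moreover have "\<bar>ln \<bar>w\<bar>\<bar> \<le> \<bar>ln eta\<bar> + p * \<bar>ln r\<bar>"
      unfolding w(1) using eta r p by (simp add: ln_mult ln_powr abs_mult abs_triangle_ineq[THEN order_trans])
    moreover have "norm L' \<le> \<bar>ln \<bar>w\<bar>\<bar> + pi" unfolding L'_def by (rule norm_log_branch) (use e' in \<open>auto simp: sgn_if\<close>)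
    ultimately have "norm L' \<le> r powr (- (p * \<beta>)) / \<beta> + (\<bar>ln eta\<bar> + pi) * 1" by simp
    also have "\<dots> \<le> r powr (- (p * \<beta>)) / \<beta> + (\<bar>ln eta\<bar> + pi) * r powr (- (p * \<beta>))"
      using ge1 by (intro add_left_mono mult_left_mono) auto
    finally have d3: "norm L' \<le> c3 * r powr (- (p * \<beta>))" by (simp add: c3_def algebra_simps)
    have S: "1 + norm (L - L') + norm L' \<le> (1 + c2 + c3) * r powr (- (p * \<beta>))"
      using d2 d3 ge1 by (simp add: algebra_simps)
    have "norm (chart_mat_complex k e t - chart_mat (sgn e) k t 0) = \<bar>Xd t 0\<bar> * norm (sysmat k (X t 0) L - sysmat k (X t 0) L')"
      unfolding chart_mat_complex_def chart_mat_eq[OF t'(1) z t'(2)] L_def L'_def w_def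
      by (simp flip: scaleR_diff_right)
    also have "\<dots> \<le> (A * r ^ (2 * q)) * (A * ((c1 * \<bar>e\<bar> powr \<alpha> * r powr (- (p * \<alpha>))) * ((1 + c2 + c3) * r powr (- (p * \<beta>)))))"
    proof (rule mult_mono)
      show "\<bar>Xd t 0\<bar> \<le> A * r ^ (2 * q)" using A(3)[OF t'(1)] by (simp add: r_def)
      have "norm (L - L') * (1 + norm (L - L') + norm L') \<le>
          (c1 * \<bar>e\<bar> powr \<alpha> * r powr (- (p * \<alpha>))) * ((1 + c2 + c3) * r powr (- (p * \<beta>)))"
        using d1 S c by (intro mult_mono) auto
      then show "norm (sysmat k (X t 0) L - sysmat k (X t 0) L') \<le>
          A * ((c1 * \<bar>e\<bar> powr \<alpha> * r powr (- (p * \<alpha>))) * ((1 + c2 + c3) * r powr (- (p * \<beta>))))"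
        using A(2)[OF t'(1)] A(1) by (intro order_trans[OF norm_sysmat_diff]) (rule mult_mono, auto)
    qed (use A(1) r in auto)
    also have "\<dots> = A * A * (c1 * (1 + c2 + c3)) * \<bar>e\<bar> powr \<alpha> * (r ^ (2 * q) * (r powr (- (p * \<alpha>)) * r powr (- (p * \<beta>))))"
      by (simp add: mult_ac)
    also have "r ^ (2 * q) * (r powr (- (p * \<alpha>)) * r powr (- (p * \<beta>))) = r powr (real (2 * q) - p * (\<alpha> + \<beta>))"
      using r by (simp add: powr_realpow[symmetric] powr_add[symmetric] algebra_simps)
    also have "A * A * (c1 * (1 + c2 + c3)) * \<bar>e\<bar> powr \<alpha> * \<dots> \<le> A * A * (c1 * (1 + c2 + c3)) * \<bar>e\<bar> powr \<alpha> * 1"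
    proof (rule mult_left_mono)
      \<comment> \<open>The zero of order \<open>2 q\<close> of \<open>Xd\<close> outweighs the
        total singularity, so the exponent of \<open>r\<close> is nonnegative.\<close>
      have "p * (\<alpha> + \<beta>) \<le> real (2 * q)" using qa by (simp add: p_def \<beta>_def field_simps)
      then show "r powr (real (2 * q) - p * (\<alpha> + \<beta>)) \<le> 1" using r by (intro powr_le1) auto
    qed (use A(1) c in auto)
    finally show "norm (chart_mat_complex k e t - chart_mat (sgn e) k t 0) \<le> A * A * (c1 * (1 + c2 + c3)) * \<bar>e\<bar> powr \<alpha>" by simp
  qed
qed

end

section \<open>The logarithmic bound on the derivative at a layer\<close>

context profile
begin

text \<open>Inside the chart \<open>f\<close> and \<open>v\<close> are bounded uniformly in
  \<open>k\<close>, so \<open>g = v + P0 L f\<close> is at most of the size of \<open>L\<close>; and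
  \<open>U (s + t) - c\<close> is comparable to \<open>t\<close> because \<open>U'\<close> does not
  vanish at \<open>s\<close>.\<close>

lemma layer_log_bound:
  assumes c: "regular_speed c" and \<sigma>: "\<bar>\<sigma>\<bar> \<le> 1" and s: "s \<in> {0..h}" "U s = c"
  shows "\<exists>C r. 0 < r \<and> (\<forall>k f g t. \<bar>k\<bar> \<le> \<kappa> \<longrightarrow> limit_sys k c \<sigma> f g \<longrightarrow> f h = 0 \<longrightarrow> g h = 1 \<longrightarrow>
    0 < \<bar>t\<bar> \<and> \<bar>t\<bar> < r \<longrightarrow> norm (g (s + t)) \<le> C * \<bar>ln \<bar>t\<bar>\<bar>)"
proof -
  obtain q :: nat where q: "1 \<le> q" by blast
  obtain rho eta lo hi V where L: "layer h U l c rho eta lo hi V q" "s \<in> {lo<..<hi}"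
    "layer.X c rho eta V q 0 0 = s"
    by (rule layer_at[OF c s q], rule that)
  interpret L: layer h U l c rho eta lo hi V q by (rule L(1))
  define a b where "a = L.X (-1) 0" and "b = L.X 1 0"
  have z: "(0::real) \<in> L.speeds" using L.eta by simp
  have ab: "a < s" "s < b" "b \<in> {lo<..<hi}" "U b \<noteq> c"
    using L.X_mono[OF z, of "-1" 0] L.X_mono[OF z, of 0 1] L.X_in[of 1 0] z L.U_X_ne[OF _ z, of 1]
    by (auto simp: a_def b_def L(3))
  have bh: "b \<in> {0..h}" using ab L.lo_pos L.hi_less by auto
  obtain M where M: "M \<ge> 0" "\<And>k f g. \<bar>k\<bar> \<le> \<kappa> \<Longrightarrow> limit_sys k c \<sigma> f g \<Longrightarrow>
    (\<forall>y\<in>{b..h}. norm (f y) \<le> M * (norm (f h) + norm (g h))) \<and> norm (g b) \<le> M * (norm (f h) + norm (g h))"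
    using lim_bound[OF c \<sigma> bh ab(4), of \<kappa>] by blast
  obtain C where C: "C > 0" "\<And>t k. t \<in> L.chart_dom \<Longrightarrow> \<bar>k\<bar> \<le> \<kappa> \<Longrightarrow> norm (L.chart_mat \<sigma> k t 0) \<le> C"
    using L.chart_mat_bounded_uniform[OF \<sigma> z] by metis
  obtain A where A: "A > 0" "\<And>t. t \<in> L.chart_dom \<Longrightarrow> \<bar>P0 (L.X t 0)\<bar> \<le> A"
    by (rule L.P_bounded, rule that)
  define K where "K = 4 * exp (2 * (C + 1) * (1 - (-1))) * (M + (M + norm (of_real (P0 b) * log_branch \<sigma> (U b - c)) * M))"
  have K: "K \<ge> 0" using M by (simp add: K_def)
  define D where "D = \<bar>DU 1 s\<bar>"
  have D: "D > 0" using L.DU1_nz[OF L(2)] by (simp add: D_def)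
  have "((\<lambda>h. (U (s + h) - U s) / h) \<longlongrightarrow> DU 1 s) (at 0)"
    using L.U_deriv[of s] L(2) by (simp add: DERIV_def)
  then have "((\<lambda>h. \<bar>(U (s + h) - U s) / h\<bar>) \<longlongrightarrow> D) (at 0)" unfolding D_def by (rule tendsto_rabs)
  from tendstoD[OF this, of "D / 2"] D obtain r1 where r1: "r1 > 0"
    "\<And>t. t \<noteq> 0 \<Longrightarrow> \<bar>t\<bar> < r1 \<Longrightarrow> \<bar>\<bar>(U (s + t) - U s) / t\<bar> - D\<bar> < D / 2"
    unfolding eventually_at by (auto simp: dist_real_def)
  define C0 where "C0 = \<bar>ln (D / 2)\<bar> + \<bar>ln (2 * D)\<bar>"
  \<comment> \<open>\<open>|t| < exp (-1)\<close> gives \<open>|ln |t|| \<ge> 1\<close>, which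
    absorbs additive constants; \<open>r1\<close> gives the comparison of
    \<open>U (s + t) - c\<close> with \<open>t\<close>, and the rest keeps \<open>s + t\<close> in
    the chart.\<close>
  define r where "r = min (min r1 (exp (-1))) (min (s - a) (b - s))"
  have r: "r > 0" using r1 ab by (simp add: r_def)
  show ?thesis
  proof (rule exI[of _ "K + A * (1 + (C0 + pi)) * K"], rule exI[of _ r], intro conjI allI impI r)
    fix k f g t assume k: "\<bar>k\<bar> \<le> \<kappa>" and fg: "limit_sys k c \<sigma> f g" "f h = 0" "g h = 1" and t: "0 < \<bar>t\<bar> \<and> \<bar>t\<bar> < r"
    define x where "x = s + t"
    have x: "x \<in> {a..b}" "x \<noteq> s" using t by (auto simp: x_def r_def)
    obtain u where u: "u \<in> L.chart_dom" "L.X u 0 = x"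
      by (rule L.chart_cover[OF z x(1)[unfolded a_def b_def]], rule that)
    have u0: "u \<noteq> 0" using x u L(3) by auto
    obtain Y where Y: "continuous_on L.chart_dom Y"
      "\<And>t. t \<in> L.chart_dom - {0} \<Longrightarrow> (Y has_vector_derivative L.chart_mat \<sigma> k t 0 (Y t)) (at t)"
      "\<And>t. t \<in> L.chart_dom \<Longrightarrow> fst (Y t) = f (L.X t 0)"
      "\<And>t. t \<in> L.chart_dom - {0} \<Longrightarrow> snd (Y t) = g (L.X t 0) - of_real (P0 (L.X t 0)) * log_branch \<sigma> (U (L.X t 0) - c) * f (L.X t 0)"
      by (rule L.sys_chart[OF z, unfolded add_0_right, OF fg(1)], rule that)
    have fb: "norm (f b) \<le> M" "norm (g b) \<le> M" using M(2)[OF k fg(1)] fg bh by auto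
    have "norm (Y 1) \<le> norm (fst (Y 1)) + norm (snd (Y 1))"
      using norm_Pair_le[of "fst (Y 1)" "snd (Y 1)"] by simp
    also have "\<dots> \<le> norm (f b) + (norm (g b) + norm (of_real (P0 b) * log_branch \<sigma> (U b - c)) * norm (f b))"
      using Y(3)[of 1] Y(4)[of 1] norm_triangle_ineq4[of "g b" "of_real (P0 b) * log_branch \<sigma> (U b - c) * f b"]
      by (auto simp: b_def[symmetric] norm_mult)
    also have "\<dots> \<le> M + (M + norm (of_real (P0 b) * log_branch \<sigma> (U b - c)) * M)"
      using fb by (intro add_mono mult_left_mono) auto
    finally have n1: "norm (Y 1) \<le> M + (M + norm (of_real (P0 b) * log_branch \<sigma> (U b - c)) * M)" .
    have "norm (Y u) \<le> 4 * exp (2 * (C + 1) * (1 - (-1))) * norm (Y 1)"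
      by (rule gronwall_linear[OF Y(1) u(1), where z = 0 and B = "\<lambda>t. L.chart_mat \<sigma> k t 0"])
        (use Y(2) C k in auto)
    also have "\<dots> \<le> K" unfolding K_def by (intro mult_left_mono n1) auto
    finally have nY: "norm (fst (Y u)) \<le> K" "norm (snd (Y u)) \<le> K"
      using norm_fst_le[of "fst (Y u)" "snd (Y u)"] norm_snd_le[of "snd (Y u)" "fst (Y u)"]
      unfolding prod.collapse by linarith+
    have t0: "t \<noteq> 0" "\<bar>t\<bar> < r1" "\<bar>t\<bar> < exp (-1)" using t by (auto simp: r_def)
    define R where "R = \<bar>(U (s + t) - U s) / t\<bar>"
    have R: "D / 2 < R" "R < 2 * D" using r1(2)[OF t0(1,2)] D unfolding R_def[symmetric] by linarith+
    have "ln (D / 2) \<le> ln R" "ln R \<le> ln (2 * D)" using R D by auto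
    then have lnR: "\<bar>ln R\<bar> \<le> C0" unfolding C0_def by linarith
    have "\<bar>U x - c\<bar> = R * \<bar>t\<bar>" using t0(1) s by (simp add: R_def x_def abs_divide)
    then have "ln \<bar>U x - c\<bar> = ln R + ln \<bar>t\<bar>" using R D t0(1) by (simp add: ln_mult)
    then have lw: "\<bar>ln \<bar>U x - c\<bar>\<bar> \<le> C0 + \<bar>ln \<bar>t\<bar>\<bar>" using lnR by linarith
    have "ln \<bar>t\<bar> < ln (exp (-1))" using t0 by (subst ln_less_cancel_iff) auto
    then have l1: "1 \<le> \<bar>ln \<bar>t\<bar>\<bar>" by simp
    have "g x = snd (Y u) + of_real (P0 x) * log_branch \<sigma> (U x - c) * fst (Y u)"
      using Y(3,4)[of u] u u0 by auto
    then have "norm (g x) \<le> norm (snd (Y u)) + \<bar>P0 x\<bar> * norm (log_branch \<sigma> (U x - c)) * norm (fst (Y u))"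
      using norm_triangle_ineq[of "snd (Y u)" "of_real (P0 x) * log_branch \<sigma> (U x - c) * fst (Y u)"] by (simp add: norm_mult)
    also have "\<dots> \<le> K + A * ((C0 + \<bar>ln \<bar>t\<bar>\<bar>) + pi) * K"
      using nY A(1) A(2)[OF u(1)] u(2) lw norm_log_branch[OF \<sigma>, of "U x - c"] K
      by (intro add_mono mult_mono mult_nonneg_nonneg) auto
    also have "\<dots> \<le> K * \<bar>ln \<bar>t\<bar>\<bar> + A * ((1 + (C0 + pi)) * \<bar>ln \<bar>t\<bar>\<bar>) * K"
    proof -
      have "K * 1 \<le> K * \<bar>ln \<bar>t\<bar>\<bar>" using l1 K by (intro mult_left_mono)
      moreover have "0 \<le> C0 + pi" by (simp add: C0_def)
      then have "(C0 + pi) * 1 \<le> (C0 + pi) * \<bar>ln \<bar>t\<bar>\<bar>" using l1 by (intro mult_left_mono)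
      then have "A * ((C0 + \<bar>ln \<bar>t\<bar>\<bar>) + pi) * K \<le> A * ((1 + (C0 + pi)) * \<bar>ln \<bar>t\<bar>\<bar>) * K"
        using A K by (intro mult_right_mono mult_left_mono) (auto simp: algebra_simps)
      ultimately show ?thesis by simp
    qed
    also have "\<dots> = (K + A * (1 + (C0 + pi)) * K) * \<bar>ln \<bar>t\<bar>\<bar>" by (simp add: algebra_simps)
    finally show "norm (g (s + t)) \<le> (K + A * (1 + (C0 + pi)) * K) * \<bar>ln \<bar>t\<bar>\<bar>" by (simp add: x_def)
  qed
qed

end

definition (in profile) complex_sys :: "real \<Rightarrow> real \<Rightarrow> real \<Rightarrow> (real \<Rightarrow> complex) \<Rightarrow> (real \<Rightarrow> complex) \<Rightarrow> bool" where
  "complex_sys k c e y w \<longleftrightarrow>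
     (\<forall>x\<in>{0..h}. (y has_vector_derivative w x) (at x within {0..h})) \<and> continuous_on {0..h} w \<and>
     (\<forall>x\<in>{0<..<h}. ode_at k (Complex c e) y w UNIV x)"

lemma of_real_minus_Complex: "complex_of_real u - Complex c e = of_real (u - c) - \<i> * of_real e"
  by (simp add: complex_eq_iff)

text \<open>For \<open>e \<noteq> 0\<close> the argument \<open>U - cs - i e\<close> has nonzero
  imaginary part and stays off the cut, so the principal logarithm is differentiable along the whole
  chart, \<open>t = 0\<close> included.\<close>

lemma (in layer) complex_sys_chart:
  assumes y: "complex_sys k cs e y w" and e: "e \<noteq> 0"
  defines "Y \<equiv> \<lambda>t. (y (X t 0), w (X t 0) - of_real (P0 (X t 0)) * Ln (of_real (U (X t 0) - cs) - \<i> * of_real e) * y (X t 0))"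
  shows "\<And>t. t \<in> chart_dom \<Longrightarrow> (Y has_vector_derivative chart_mat_complex k e t (Y t)) (at t)" "continuous_on chart_dom Y"
proof -
  have z: "(0::real) \<in> speeds" using eta by simp
  define L where "L x = Ln (of_real (U x - cs) - \<i> * of_real e)" for x
  show d: "(Y has_vector_derivative chart_mat_complex k e t (Y t)) (at t)" if t: "t \<in> chart_dom" for t
  proof -
    let ?x = "X t 0"
    have x: "?x \<in> {lo..hi}" "?x \<in> {0<..<h}" using X_in[OF t z] lo_pos hi_less by auto
    have ne: "Complex cs e \<noteq> complex_of_real (U ?x)" using e by (simp add: complex_eq_iff)
    have n: "of_real (U ?x - cs) - \<i> * of_real e \<notin> \<real>\<^sub>\<le>\<^sub>0"
      using e by (simp add: complex_nonpos_Reals_iff)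
    have "((\<lambda>x. complex_of_real (U x)) has_vector_derivative of_real (DU 1 ?x)) (at ?x)"
      by (rule has_vector_derivative_of_real[OF U_deriv[OF x(1)]])
    then have "((\<lambda>x. complex_of_real (U x) - (of_real cs + \<i> * of_real e)) has_vector_derivative of_real (DU 1 ?x) - 0) (at ?x)"
      by (rule has_vector_derivative_diff[OF _ has_vector_derivative_const])
    then have "((\<lambda>x. complex_of_real (U x - cs) - \<i> * of_real e) has_vector_derivative of_real (DU 1 ?x)) (at ?x)"
      by (simp add: algebra_simps)
    from field_vector_diff_chain_at[OF this has_field_derivative_Ln[OF n]]
    have L: "(L has_vector_derivative of_real (DU 1 ?x) / (of_real (U ?x) - Complex cs e)) (at ?x)"
      unfolding of_real_minus_Complex by (simp add: o_def L_def[abs_def] divide_inverse)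
    have ode: "ode_at k (Complex cs e) y w UNIV ?x" using y x by (auto simp: complex_sys_def)
    show ?thesis
      using layer_deriv[OF t z ne ode L] unfolding Y_def L_def chart_mat_complex_def .
  qed
  show "continuous_on chart_dom Y"
    by (rule continuous_on_vector_derivative[where f' = "\<lambda>t. chart_mat_complex k e t (Y t)"])
      (rule has_vector_derivative_at_within[OF d])
qed

section \<open>Convergence as the imaginary part tends to zero\<close>

context profile
begin

lemma complex_sys_regular_speed:
  assumes y: "complex_sys k c e y w" and ab: "0 \<le> a" "b \<le> h"
  shows "continuous_on {a..b} (\<lambda>x. (y x, w x))"
    "\<And>x. x \<in> {a<..<b} \<Longrightarrow> ((\<lambda>x. (y x, w x)) has_vector_derivative rayleigh_mat k (Complex c e) x (y x, w x)) (at x)"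
proof -
  have "continuous_on {0..h} y"
    by (rule continuous_on_vector_derivative[where f' = w]) (use y in \<open>auto simp: complex_sys_def\<close>)
  then show "continuous_on {a..b} (\<lambda>x. (y x, w x))"
    using y ab unfolding complex_sys_def by (intro continuous_intros) (auto intro: continuous_on_subset)
  show "((\<lambda>x. (y x, w x)) has_vector_derivative rayleigh_mat k (Complex c e) x (y x, w x)) (at x)" if "x \<in> {a<..<b}" for x
    using y that ab ode_at_rayleigh_mat[of k "Complex c e" y w UNIV x] by (auto simp: complex_sys_def)
qed

text \<open>\<open>|U - c - i e| \<ge> |U - c|\<close>, and the latter is bounded below on a
  layer-free interval, so the error is of first order in \<open>e\<close>.\<close>

lemma rayleigh_mat_diff:
  assumes ab: "0 \<le> a" "b \<le> h" "\<And>x. x \<in> {a..b} \<Longrightarrow> U x \<noteq> c"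
  obtains A where "A > 0" "\<And>x k e. x \<in> {a..b} \<Longrightarrow> norm (rayleigh_mat k (Complex c e) x - rayleigh_mat k (of_real c) x) \<le> A * \<bar>e\<bar>"
proof -
  have "continuous_on {a..b} (\<lambda>x. DU 2 x / (U x - c)\<^sup>2)"
    using DU_cont[of 2] U_cont l_ge ab
    by (intro continuous_intros) (auto intro: continuous_on_subset)
  then have "bounded ((\<lambda>x. DU 2 x / (U x - c)\<^sup>2) ` {a..b})"
    by (intro compact_imp_bounded compact_continuous_image) auto
  then obtain A where A: "A > 0" "\<And>x. x \<in> {a..b} \<Longrightarrow> \<bar>DU 2 x / (U x - c)\<^sup>2\<bar> \<le> A"
    by (auto simp: bounded_pos)
  show ?thesis
  proof (rule that[OF A(1)])
    fix x k e assume x: "x \<in> {a..b}"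
    define u where "u = U x - c"
    have u: "u \<noteq> 0" using ab(3)[OF x] by (simp add: u_def)
    define z where "z = complex_of_real u - \<i> * of_real e"
    have z: "z \<noteq> 0" using u by (auto simp: z_def complex_eq_iff)
    have nz: "\<bar>u\<bar> \<le> norm z" using abs_Re_le_cmod[of z] by (simp add: z_def)
    have "rayleigh_mat k (Complex c e) x - rayleigh_mat k (of_real c) x = mat2 0 0 (of_real (DU 2 x) / z - of_real (DU 2 x) / of_real u) 0"
      unfolding rayleigh_mat_def mat2_diff of_real_minus_Complex by (simp add: z_def u_def)
    also have "of_real (DU 2 x) / z - of_real (DU 2 x) / of_real u = of_real (DU 2 x) * (\<i> * of_real e) / (z * of_real u)"
      using z u by (simp add: field_simps z_def)
    also have "norm (mat2 0 0 (of_real (DU 2 x) * (\<i> * of_real e) / (z * of_real u)) 0)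
        \<le> norm (of_real (DU 2 x) * (\<i> * of_real e) / (z * of_real u))"
      using norm_mat2[of 0 0 _ 0] by (rule order_trans) simp
    also have "\<dots> = \<bar>DU 2 x\<bar> * \<bar>e\<bar> / (norm z * \<bar>u\<bar>)" by (simp add: norm_divide norm_mult)
    also have "\<dots> \<le> \<bar>DU 2 x\<bar> * \<bar>e\<bar> / (\<bar>u\<bar> * \<bar>u\<bar>)"
      using nz u by (intro divide_left_mono mult_right_mono mult_pos_pos) auto
    also have "\<dots> = \<bar>DU 2 x / (U x - c)\<^sup>2\<bar> * \<bar>e\<bar>" by (simp add: u_def abs_divide power2_eq_square abs_mult)
    also have "\<dots> \<le> A * \<bar>e\<bar>" by (intro mult_right_mono A(2)[OF x]) auto
    finally show "norm (rayleigh_mat k (Complex c e) x - rayleigh_mat k (of_real c) x) \<le> A * \<bar>e\<bar>" .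
  qed
qed

text \<open>Bundled so that constants can be chosen before \<open>k\<close>, \<open>e\<close> and
  the solutions. The sign of \<open>e\<close> selects the limiting problem, and
  \<open>|e| < 1\<close> makes \<open>|e|\<close> at most \<open>|e| powr \<alpha>\<close>.\<close>

definition perturbed_pair :: "real \<Rightarrow> real \<Rightarrow> real \<Rightarrow> real \<Rightarrow> (real \<Rightarrow> complex) \<Rightarrow> (real \<Rightarrow> complex) \<Rightarrow>
    (real \<Rightarrow> complex) \<Rightarrow> (real \<Rightarrow> complex) \<Rightarrow> bool" where
  "perturbed_pair \<kappa> c k e f g y w \<longleftrightarrow> \<bar>k\<bar> \<le> \<kappa> \<and> 0 < \<bar>e\<bar> \<and> \<bar>e\<bar> < 1 \<and> limit_sys k c (sgn e) f g \<and> f h = 0 \<and> g h = 1 \<and>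
     complex_sys k c e y w \<and> y h = 0 \<and> w h = 1"

text \<open>The limiting problem sees \<open>e\<close> through its sign, so the sum of the constants
  for the two signs serves every \<open>e\<close>.\<close>

lemma perturbed_pair_bound:
  assumes c: "regular_speed c" and x: "x \<in> {0..h}" "U x \<noteq> c"
  obtains N where "N \<ge> 0" "\<And>k e f g y w z. perturbed_pair \<kappa> c k e f g y w \<Longrightarrow> z \<in> {x..h} \<Longrightarrow> norm (f z) \<le> N"
    "\<And>k e f g y w. perturbed_pair \<kappa> c k e f g y w \<Longrightarrow> norm (g x) \<le> N"
proof -
  have "\<exists>M\<ge>0. \<forall>k f g. \<bar>k\<bar> \<le> \<kappa> \<longrightarrow> limit_sys k c \<sigma> f g \<longrightarrow>
    (\<forall>y\<in>{x..h}. norm (f y) \<le> M * (norm (f h) + norm (g h))) \<and> norm (g x) \<le> M * (norm (f h) + norm (g h))"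
    if "\<bar>\<sigma>\<bar> \<le> 1" for \<sigma> by (rule lim_bound[OF c that x])
  from this[of 1] this[of "-1"] obtain M1 M2 where M: "M1 \<ge> 0" "M2 \<ge> 0"
    "\<forall>k f g. \<bar>k\<bar> \<le> \<kappa> \<longrightarrow> limit_sys k c 1 f g \<longrightarrow>
    (\<forall>y\<in>{x..h}. norm (f y) \<le> M1 * (norm (f h) + norm (g h))) \<and> norm (g x) \<le> M1 * (norm (f h) + norm (g h))"
    "\<forall>k f g. \<bar>k\<bar> \<le> \<kappa> \<longrightarrow> limit_sys k c (-1) f g \<longrightarrow>
    (\<forall>y\<in>{x..h}. norm (f y) \<le> M2 * (norm (f h) + norm (g h))) \<and> norm (g x) \<le> M2 * (norm (f h) + norm (g h))"
    by auto
  have "norm (f z) \<le> M1 + M2 \<and> norm (g x) \<le> M1 + M2" if p: "perturbed_pair \<kappa> c k e f g y w" and z: "z \<in> {x..h}" for k e f g y w z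
  proof (cases "0 < e")
    case True
    have kk: "\<bar>k\<bar> \<le> \<kappa>" and ll: "limit_sys k c 1 f g" using p True by (auto simp: perturbed_pair_def)
    have "(\<forall>y\<in>{x..h}. norm (f y) \<le> M1 * (norm (f h) + norm (g h))) \<and> norm (g x) \<le> M1 * (norm (f h) + norm (g h))"
      using M(3) kk ll by blast
    then have "norm (f z) \<le> M1 \<and> norm (g x) \<le> M1" using p z unfolding perturbed_pair_def by auto
    then show ?thesis using M(2) by linarith
  next
    case False
    have kk: "\<bar>k\<bar> \<le> \<kappa>" and ll: "limit_sys k c (-1) f g" using p False by (auto simp: perturbed_pair_def)
    have "(\<forall>y\<in>{x..h}. norm (f y) \<le> M2 * (norm (f h) + norm (g h))) \<and> norm (g x) \<le> M2 * (norm (f h) + norm (g h))"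
      using M(4) kk ll by blast
    then have "norm (f z) \<le> M2 \<and> norm (g x) \<le> M2" using p z unfolding perturbed_pair_def by auto
    then show ?thesis using M(1) by linarith
  qed
  note b = this
  show ?thesis
  proof (rule that[of "M1 + M2"])
    show "0 \<le> M1 + M2" using M by simp
    show "norm (f z) \<le> M1 + M2" if "perturbed_pair \<kappa> c k e f g y w" "z \<in> {x..h}" for k e f g y w z
      using b[OF that] by blast
    show "norm (g x) \<le> M1 + M2" if "perturbed_pair \<kappa> c k e f g y w" for k e f g y w
      using b[OF that, of x] x by auto
  qed
qed

text \<open>At a chart end the exchange between the derivative and \<open>v\<close> uses
  \<open>Ln\<close> for the complex speed and \<open>log_branch\<close> for the real one; this
  controls the error that the exchange adds.\<close>

lemma log_coeff_diff:
  assumes a: "0 < \<alpha>" "\<alpha> < 1" and x: "U x \<noteq> c"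
  obtains Q where "Q \<ge> 0" "\<And>e y f. 0 < \<bar>e\<bar> \<Longrightarrow> \<bar>e\<bar> < 1 \<Longrightarrow>
    norm (of_real (P0 x) * Ln (of_real (U x - c) - \<i> * of_real e) * y - of_real (P0 x) * log_branch (sgn e) (U x - c) * f)
      \<le> Q * (\<bar>e\<bar> powr \<alpha> * norm y + norm (y - f))"
proof -
  define w where "w = U x - c"
  have w: "w \<noteq> 0" using x by (simp add: w_def)
  define D where "D = (5 + 1 / \<alpha>) * (1 / \<bar>w\<bar>) powr \<alpha>"
  define l where "l = \<bar>ln \<bar>w\<bar>\<bar> + pi"
  have D: "D \<ge> 0" using a by (simp add: D_def)
  have l: "l \<ge> 0" by (simp add: l_def)
  show ?thesis
  proof (rule that[of "\<bar>P0 x\<bar> * (D + l)"])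
    show "0 \<le> \<bar>P0 x\<bar> * (D + l)" using D l by simp
    fix e :: real and y f :: complex assume e: "0 < \<bar>e\<bar>" "\<bar>e\<bar> < 1"
    define L where "L = Ln (of_real w - \<i> * of_real e)"
    define L' where "L' = log_branch (sgn e) w"
    have "norm (L - L') \<le> (5 + 1 / \<alpha>) * (\<bar>e\<bar> / \<bar>w\<bar>) powr \<alpha>"
      unfolding L_def L'_def by (rule Ln_log_branch_diff) (use a w e in auto)
    also have "\<dots> = D * \<bar>e\<bar> powr \<alpha>"
      using e w by (simp add: D_def powr_mult divide_inverse mult_ac)
    finally have d: "norm (L - L') \<le> D * \<bar>e\<bar> powr \<alpha>" .
    have nl: "norm L' \<le> l" unfolding L'_def l_def by (rule norm_log_branch) (use e in \<open>auto simp: sgn_if\<close>)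
    have in': "norm ((L - L') * y + L' * (y - f)) \<le> (D + l) * (\<bar>e\<bar> powr \<alpha> * norm y + norm (y - f))"
    proof -
      have "norm ((L - L') * y + L' * (y - f)) \<le> D * \<bar>e\<bar> powr \<alpha> * norm y + l * norm (y - f)"
        by (intro order_trans[OF norm_triangle_ineq] add_mono) (auto simp: norm_mult intro!: mult_right_mono d nl)
      also have "\<dots> \<le> (D + l) * (\<bar>e\<bar> powr \<alpha> * norm y) + (D + l) * norm (y - f)"
        using D l by (intro add_mono) (auto simp: mult.assoc intro!: mult_right_mono)
      finally show ?thesis by (simp add: algebra_simps)
    qed
    have "of_real (P0 x) * L * y - of_real (P0 x) * L' * f = of_real (P0 x) * ((L - L') * y + L' * (y - f))"
      by (simp add: algebra_simps)
    then have "norm (of_real (P0 x) * L * y - of_real (P0 x) * L' * f) = \<bar>P0 x\<bar> * norm ((L - L') * y + L' * (y - f))"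
      by (simp only: norm_mult norm_of_real)
    also have "\<dots> \<le> \<bar>P0 x\<bar> * ((D + l) * (\<bar>e\<bar> powr \<alpha> * norm y + norm (y - f)))"
      by (rule mult_left_mono[OF in']) simp
    finally show "norm (of_real (P0 x) * Ln (of_real (U x - c) - \<i> * of_real e) * y - of_real (P0 x) * log_branch (sgn e) (U x - c) * f)
      \<le> \<bar>P0 x\<bar> * (D + l) * (\<bar>e\<bar> powr \<alpha> * norm y + norm (y - f))"
      unfolding w_def[symmetric] L_def[symmetric] L'_def[symmetric] by (simp only: mult.assoc)
  qed
qed

text \<open>As in \<open>lim_bound\<close>, the functions are compared on all of
  \<open>{x..h}\<close> but the derivatives only at the point \<open>x\<close> itself, which is not
  a layer; this is just what the next step to the left needs as data.\<close>

lemma convergence: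
  assumes c: "regular_speed c" and \<alpha>: "0 < \<alpha>" "\<alpha> < 1" and x: "x \<in> {0..h}" "U x \<noteq> c"
  shows "\<exists>M\<ge>0. \<forall>k e f g y w. perturbed_pair \<kappa> c k e f g y w \<longrightarrow>
    (\<forall>z\<in>{x..h}. norm (y z - f z) \<le> M * \<bar>e\<bar> powr \<alpha>) \<and> norm (w x - g x) \<le> M * \<bar>e\<bar> powr \<alpha>"
proof -
  \<comment> \<open>\<open>q (1 - \<alpha>) \<ge> 1\<close> gives
    \<open>\<alpha> q \<le> q - 1\<close>, hence \<open>(2 q + 1) (1 + \<alpha>) / 2 = q + \<alpha>
    q + (1 + \<alpha>) / 2 \<le> 2 q\<close>, the exponent condition of
    \<open>chart_mat_complex_diff\<close>.\<close>
  define q where "q = nat \<lceil>1 / (1 - \<alpha>)\<rceil>"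
  have qr: "1 / (1 - \<alpha>) \<le> real q" unfolding q_def by linarith
  moreover have "1 < 1 / (1 - \<alpha>)" using \<alpha> by simp
  ultimately have "1 < real q" by linarith
  then have q: "1 \<le> q" by simp
  have "1 \<le> real q * (1 - \<alpha>)" using qr \<alpha> by (simp add: divide_le_eq)
  then have q1: "\<alpha> * real q \<le> real q - 1" by (simp add: algebra_simps)
  have q2: "real (2 * q + 1) * ((1 + \<alpha>) / 2) = real q + \<alpha> * real q + (1 + \<alpha>) / 2"
    by (simp add: field_simps)
  have qa: "real (2 * q + 1) * ((1 + \<alpha>) / 2) \<le> real (2 * q)"
  proof -
    have "(1 + \<alpha>) / 2 \<le> 1" "real (2 * q) = 2 * real q" using \<alpha> by simp_all
    then show ?thesis using q1 q2 by linarith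
  qed
  have small: "\<bar>e\<bar> \<le> \<bar>e\<bar> powr \<alpha> \<and> \<bar>e\<bar> powr \<alpha> \<le> 1" if "perturbed_pair \<kappa> c k e f g y w" for k e f g y w
  proof -
    have e: "0 < \<bar>e\<bar>" "\<bar>e\<bar> < 1" using that by (auto simp: perturbed_pair_def)
    have "\<bar>e\<bar> powr 1 \<le> \<bar>e\<bar> powr \<alpha>" using e \<alpha> by (intro powr_mono') auto
    moreover have "\<bar>e\<bar> powr \<alpha> \<le> 1" using e \<alpha> by (intro powr_le1) auto
    ultimately show ?thesis using e by simp
  qed
  show ?thesis
  proof (rule layer_induct[OF c _ _ _ q x, where P = "\<lambda>x. \<exists>M\<ge>0. \<forall>k e f g y w. perturbed_pair \<kappa> c k e f g y w \<longrightarrow>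
    (\<forall>z\<in>{x..h}. norm (y z - f z) \<le> M * \<bar>e\<bar> powr \<alpha>) \<and> norm (w x - g x) \<le> M * \<bar>e\<bar> powr \<alpha>"])
    show "\<exists>M\<ge>0. \<forall>k e f g y w. perturbed_pair \<kappa> c k e f g y w \<longrightarrow>
    (\<forall>z\<in>{h..h}. norm (y z - f z) \<le> M * \<bar>e\<bar> powr \<alpha>) \<and> norm (w h - g h) \<le> M * \<bar>e\<bar> powr \<alpha>"
      by (intro exI[of _ 0]) (auto simp: perturbed_pair_def)
  next
    fix a b assume ab: "0 \<le> a" "a \<le> b" "b \<le> h" "\<And>x. x \<in> {a..b} \<Longrightarrow> U x \<noteq> c"
      and "\<exists>M\<ge>0. \<forall>k e f g y w. perturbed_pair \<kappa> c k e f g y w \<longrightarrow>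
    (\<forall>z\<in>{b..h}. norm (y z - f z) \<le> M * \<bar>e\<bar> powr \<alpha>) \<and> norm (w b - g b) \<le> M * \<bar>e\<bar> powr \<alpha>"
    then obtain M where M: "M \<ge> 0" "\<forall>k e f g y w. perturbed_pair \<kappa> c k e f g y w \<longrightarrow>
    (\<forall>z\<in>{b..h}. norm (y z - f z) \<le> M * \<bar>e\<bar> powr \<alpha>) \<and> norm (w b - g b) \<le> M * \<bar>e\<bar> powr \<alpha>"
      by blast
    have b: "b \<in> {0..h}" "U b \<noteq> c" using ab by auto
    obtain N where N: "N \<ge> 0" "\<And>k e f g y w z. perturbed_pair \<kappa> c k e f g y w \<Longrightarrow> z \<in> {b..h} \<Longrightarrow> norm (f z) \<le> N"
      "\<And>k e f g y w. perturbed_pair \<kappa> c k e f g y w \<Longrightarrow> norm (g b) \<le> N"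
      by (rule perturbed_pair_bound[OF c b], rule that)
    obtain C where C: "C > 0" "\<And>x k. x \<in> {a..b} \<Longrightarrow> \<bar>k\<bar> \<le> \<kappa> \<Longrightarrow> norm (rayleigh_mat k (of_real c) x) \<le> C"
      by (rule rayleigh_mat_bounded[OF ab(1,3,4)], assumption, rule that)
    obtain A where A: "A > 0" "\<And>x k e. x \<in> {a..b} \<Longrightarrow> norm (rayleigh_mat k (Complex c e) x - rayleigh_mat k (of_real c) x) \<le> A * \<bar>e\<bar>"
      by (rule rayleigh_mat_diff[OF ab(1,3,4)], assumption, rule that)
    define K where "K = 4 * exp (2 * (C + A + 1) * (b - a))"
    have K: "K \<ge> 0" by (simp add: K_def)
    \<comment> \<open>\<open>2 M\<close> stands for the inherited errors of \<open>y\<close> and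
      \<open>w\<close> at \<open>b\<close>, \<open>2 N\<close> for the size of the limiting pair,
      which the coefficient error multiplies.\<close>
    define M' where "M' = K * (2 * M + A * (K * (2 * N)))"
    have M': "M' \<ge> 0" using M N A K by (simp add: M'_def)
    show "\<exists>M\<ge>0. \<forall>k e f g y w. perturbed_pair \<kappa> c k e f g y w \<longrightarrow>
    (\<forall>z\<in>{a..h}. norm (y z - f z) \<le> M * \<bar>e\<bar> powr \<alpha>) \<and> norm (w a - g a) \<le> M * \<bar>e\<bar> powr \<alpha>"
    proof (rule exI[of _ "M + M'"], intro conjI allI impI)
      show "M + M' \<ge> 0" using M M' by simp
      fix k e f g y w assume p: "perturbed_pair \<kappa> c k e f g y w"
      then have fg: "limit_sys k c (sgn e) f g" and yw: "complex_sys k c e y w" and k: "\<bar>k\<bar> \<le> \<kappa>"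
        by (auto simp: perturbed_pair_def)
      define E where "E = \<bar>e\<bar> powr \<alpha>"
      have E: "0 \<le> E" "\<bar>e\<bar> \<le> E" "E \<le> 1" using small[OF p] by (auto simp: E_def)
      have Mz: "norm (y z - f z) \<le> M * E" if "z \<in> {b..h}" for z using M(2) p that unfolding E_def by blast
      have Mb: "norm (y b - f b) \<le> M * E" "norm (w b - g b) \<le> M * E"
        using M(2) p b unfolding E_def by auto
      have Nb: "norm (f b, g b) \<le> 2 * N"
        using norm_Pair_le[of "f b" "g b"] N(2)[OF p, of b] N(3)[OF p] b by simp
      have nb: "norm ((y b, w b) - (f b, g b)) \<le> 2 * M * E"
        using norm_Pair_le[of "y b - f b" "w b - g b"] Mb by simp
      have Y: "norm ((y z, w z) - (f z, g z)) \<le> M' * E" if z: "z \<in> {a..b}" for z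
      proof -
        have "norm ((y z, w z) - (f z, g z)) \<le> K * (norm ((y b, w b) - (f b, g b)) + (A * E) * (K * norm (f b, g b)))"
        proof (rule gronwall_diff[OF complex_sys_regular_speed(1)[OF yw ab(1,3)] limit_sys_regular_speed(1)[OF fg ab(1,3,4)] z,
              where z = a and C = C and E = A and ?B1.0 = "rayleigh_mat k (Complex c e)" and ?B2.0 = "rayleigh_mat k (of_real c)"])
          show "norm (rayleigh_mat k (Complex c e) x - rayleigh_mat k (of_real c) x) \<le> A * E" if "x \<in> {a<..<b} - {a}" for x
          proof -
            have "A * \<bar>e\<bar> \<le> A * E" using A(1) E by (intro mult_left_mono) auto
            then show ?thesis using A(2)[of x k e] that by auto
          qed
          show "A * E \<le> A" using A(1) E by (simp add: mult_left_le)
        qed (use complex_sys_regular_speed(2)[OF yw ab(1,3)] limit_sys_regular_speed(2)[OF fg ab(1,3,4)] C k A E K_def in auto)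
        also have "\<dots> \<le> K * (2 * M * E + (A * E) * (K * (2 * N)))"
          using nb Nb K A E by (intro mult_left_mono add_mono) auto
        also have "\<dots> = M' * E" by (simp add: M'_def algebra_simps)
        finally show ?thesis .
      qed
      have le: "M' * E \<le> (M + M') * E" "M * E \<le> (M + M') * E"
        using M M' E by (auto intro!: mult_right_mono)
      show "\<forall>z\<in>{a..h}. norm (y z - f z) \<le> (M + M') * \<bar>e\<bar> powr \<alpha>"
      proof
        fix z assume z: "z \<in> {a..h}"
        show "norm (y z - f z) \<le> (M + M') * \<bar>e\<bar> powr \<alpha>"
          using Y[of z] norm_fst_le[of "y z - f z" "w z - g z"] Mz[of z] le z unfolding E_def[symmetric]
          by (cases "z \<le> b") auto
      qed
      show "norm (w a - g a) \<le> (M + M') * \<bar>e\<bar> powr \<alpha>"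
        using Y[of a] norm_snd_le[of "w a - g a" "y a - f a"] le ab unfolding E_def[symmetric] by auto
    qed
  next
    fix rho eta lo hi V assume L: "layer h U l c rho eta lo hi V q"
    interpret L: layer h U l c rho eta lo hi V q by (rule L)
    define a b where "a = L.X (-1) 0" and "b = L.X 1 0"
    assume "\<exists>M\<ge>0. \<forall>k e f g y w. perturbed_pair \<kappa> c k e f g y w \<longrightarrow>
      (\<forall>z\<in>{L.X 1 0..h}. norm (y z - f z) \<le> M * \<bar>e\<bar> powr \<alpha>) \<and> norm (w (L.X 1 0) - g (L.X 1 0)) \<le> M * \<bar>e\<bar> powr \<alpha>"
    then obtain M where M: "M \<ge> 0" "\<forall>k e f g y w. perturbed_pair \<kappa> c k e f g y w \<longrightarrow>
      (\<forall>z\<in>{b..h}. norm (y z - f z) \<le> M * \<bar>e\<bar> powr \<alpha>) \<and> norm (w b - g b) \<le> M * \<bar>e\<bar> powr \<alpha>"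
      unfolding b_def by blast
    have z0: "(0::real) \<in> L.speeds" using L.eta by simp
    have ab: "a \<in> {0..h}" "b \<in> {0..h}" "a < b" "U a \<noteq> c" "U b \<noteq> c"
      using L.X_in[of "-1" 0] L.X_in[of 1 0] z0 L.X_mono[OF z0, of "-1" 1] L.lo_pos L.hi_less
        L.U_X_ne[OF _ z0, of 1] L.U_X_ne[OF _ z0, of "-1"] by (auto simp: a_def b_def)
    obtain N1 where N1: "N1 \<ge> 0" "\<And>k e f g y w z. perturbed_pair \<kappa> c k e f g y w \<Longrightarrow> z \<in> {b..h} \<Longrightarrow> norm (f z) \<le> N1"
      "\<And>k e f g y w. perturbed_pair \<kappa> c k e f g y w \<Longrightarrow> norm (g b) \<le> N1"
      by (rule perturbed_pair_bound[OF c ab(2,5)], rule that)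
    obtain N2 where N2: "N2 \<ge> 0" "\<And>k e f g y w z. perturbed_pair \<kappa> c k e f g y w \<Longrightarrow> z \<in> {a..h} \<Longrightarrow> norm (f z) \<le> N2"
      "\<And>k e f g y w. perturbed_pair \<kappa> c k e f g y w \<Longrightarrow> norm (g a) \<le> N2"
      by (rule perturbed_pair_bound[OF c ab(1,4)], rule that)
    obtain Qa where Qa: "Qa \<ge> 0" "\<And>e y f. 0 < \<bar>e\<bar> \<Longrightarrow> \<bar>e\<bar> < 1 \<Longrightarrow>
      norm (of_real (P0 a) * Ln (of_real (U a - c) - \<i> * of_real e) * y - of_real (P0 a) * log_branch (sgn e) (U a - c) * f)
        \<le> Qa * (\<bar>e\<bar> powr \<alpha> * norm y + norm (y - f))"
      by (rule log_coeff_diff[OF \<alpha> ab(4)], rule that)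
    obtain Qb where Qb: "Qb \<ge> 0" "\<And>e y f. 0 < \<bar>e\<bar> \<Longrightarrow> \<bar>e\<bar> < 1 \<Longrightarrow>
      norm (of_real (P0 b) * Ln (of_real (U b - c) - \<i> * of_real e) * y - of_real (P0 b) * log_branch (sgn e) (U b - c) * f)
        \<le> Qb * (\<bar>e\<bar> powr \<alpha> * norm y + norm (y - f))"
      by (rule log_coeff_diff[OF \<alpha> ab(5)], rule that)
    obtain C1 where C1: "C1 > 0" "\<And>t k. t \<in> L.chart_dom \<Longrightarrow> \<bar>k\<bar> \<le> \<kappa> \<Longrightarrow> norm (L.chart_mat 1 k t 0) \<le> C1"
      by (rule L.chart_mat_bounded_uniform[OF _ z0, of 1], simp, rule that)
    obtain C2 where C2: "C2 > 0" "\<And>t k. t \<in> L.chart_dom \<Longrightarrow> \<bar>k\<bar> \<le> \<kappa> \<Longrightarrow> norm (L.chart_mat (-1) k t 0) \<le> C2"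
      by (rule L.chart_mat_bounded_uniform[OF _ z0, of "-1"], simp, rule that)
    define C where "C = C1 + C2"
    have C: "C > 0" using C1 C2 by (simp add: C_def)
    obtain A where A: "A > 0" "\<And>k e t. t \<in> L.chart_dom - {0} \<Longrightarrow> 0 < \<bar>e\<bar> \<Longrightarrow> \<bar>e\<bar> < 1 \<Longrightarrow>
      norm (L.chart_mat_complex k e t - L.chart_mat (sgn e) k t 0) \<le> A * \<bar>e\<bar> powr \<alpha>"
      by (rule L.chart_mat_complex_diff[OF \<alpha> qa], rule that)
    define K where "K = 4 * exp (2 * (C + A + 1) * (1 - (-1)))"
    have K: "K \<ge> 0" by (simp add: K_def)
    define Lb where "Lb = \<bar>P0 b\<bar> * (\<bar>ln \<bar>U b - c\<bar>\<bar> + pi)"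
    have Lb: "Lb \<ge> 0" by (simp add: Lb_def)
    \<comment> \<open>As on a layer-free interval, with two additions from passing to
      \<open>v\<close> at \<open>b\<close>: the \<open>Qb\<close> term for the difference of the
      logarithms, and \<open>Lb N1\<close> for the logarithm in \<open>Y 1\<close>.\<close>
    define M' where "M' = K * ((2 * M + Qb * ((N1 + M) + M)) + A * (K * (2 * N1 + Lb * N1)))"
    have M': "M' \<ge> 0" using M N1 A K Qb Lb by (simp add: M'_def)
    \<comment> \<open>Returning from \<open>v\<close> to the derivative at \<open>a\<close> costs
      one more logarithm error.\<close>
    define M2 where "M2 = M' + Qa * ((N2 + M') + M')"
    have M2: "M' \<le> M2" using Qa N2 M' by (simp add: M2_def)
    show "\<exists>M\<ge>0. \<forall>k e f g y w. perturbed_pair \<kappa> c k e f g y w \<longrightarrow>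
      (\<forall>z\<in>{L.X (-1) 0..h}. norm (y z - f z) \<le> M * \<bar>e\<bar> powr \<alpha>) \<and> norm (w (L.X (-1) 0) - g (L.X (-1) 0)) \<le> M * \<bar>e\<bar> powr \<alpha>"
      unfolding a_def[symmetric]
    proof (rule exI[of _ "M + M2"], intro conjI allI impI)
      show "M + M2 \<ge> 0" using M M' M2 by simp
      fix k e f g y w assume p: "perturbed_pair \<kappa> c k e f g y w"
      then have fg: "limit_sys k c (sgn e) f g" and yw: "complex_sys k c e y w" and k: "\<bar>k\<bar> \<le> \<kappa>"
        and e: "0 < \<bar>e\<bar>" "\<bar>e\<bar> < 1" "e \<noteq> 0"
        by (auto simp: perturbed_pair_def)
      have sg: "sgn e = 1 \<or> sgn e = -1" using e by (auto simp: sgn_if)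
      define E where "E = \<bar>e\<bar> powr \<alpha>"
      have E: "0 \<le> E" "E \<le> 1" using small[OF p] by (auto simp: E_def)
      have Mz: "norm (y z - f z) \<le> M * E" if "z \<in> {b..h}" for z using M(2) p that unfolding E_def by blast
      have Mb: "norm (y b - f b) \<le> M * E" "norm (w b - g b) \<le> M * E"
        using M(2) p ab unfolding E_def by auto
      \<comment> \<open>A crude size bound for the perturbed solution: the limiting one plus the
        error, with \<open>E \<le> 1\<close>.\<close>
      have yE: "norm u \<le> n + m" if "norm v \<le> n" "norm (u - v) \<le> m * E" "m \<ge> 0" for u v :: complex and n m
        using norm_triangle_ineq[of v "u - v"] that mult_left_le[OF E(2) that(3)] by simp
      obtain Y where Y: "continuous_on L.chart_dom Y"
        "\<And>t. t \<in> L.chart_dom - {0} \<Longrightarrow> (Y has_vector_derivative L.chart_mat (sgn e) k t 0 (Y t)) (at t)"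
        "\<And>t. t \<in> L.chart_dom \<Longrightarrow> fst (Y t) = f (L.X t 0)"
        "\<And>t. t \<in> L.chart_dom - {0} \<Longrightarrow> snd (Y t) = g (L.X t 0) - of_real (P0 (L.X t 0)) * log_branch (sgn e) (U (L.X t 0) - c) * f (L.X t 0)"
        by (rule L.sys_chart[OF z0, unfolded add_0_right, OF fg], rule that)
      define Z where "Z = (\<lambda>t. (y (L.X t 0), w (L.X t 0) -
        of_real (P0 (L.X t 0)) * Ln (of_real (U (L.X t 0) - c) - \<i> * of_real e) * y (L.X t 0)))"
      have Z: "(Z has_vector_derivative L.chart_mat_complex k e t (Z t)) (at t)" if "t \<in> L.chart_dom" for t
        unfolding Z_def by (rule L.complex_sys_chart(1)[OF yw e(3) that])
      have cZ: "continuous_on L.chart_dom Z" unfolding Z_def by (rule L.complex_sys_chart(2)[OF yw e(3)])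
      have Yv: "Y 1 = (f b, g b - of_real (P0 b) * log_branch (sgn e) (U b - c) * f b)"
        "Y (-1) = (f a, g a - of_real (P0 a) * log_branch (sgn e) (U a - c) * f a)"
        using Y(3,4)[of 1] Y(3,4)[of "-1"] unfolding a_def b_def
        by (auto intro!: prod_eqI)
      have Zv: "Z 1 = (y b, w b - of_real (P0 b) * Ln (of_real (U b - c) - \<i> * of_real e) * y b)"
        "Z (-1) = (y a, w a - of_real (P0 a) * Ln (of_real (U a - c) - \<i> * of_real e) * y a)"
        unfolding Z_def a_def b_def by auto
      have "norm (Y 1) \<le> norm (f b) + (norm (g b) + norm (of_real (P0 b) * log_branch (sgn e) (U b - c) * f b))"
        unfolding Yv by (rule order_trans[OF norm_Pair_le]) (intro add_left_mono norm_triangle_ineq4)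
      also have "\<dots> \<le> N1 + (N1 + Lb * N1)"
        using N1(2)[OF p, of b] N1(3)[OF p] ab norm_log_branch[of "sgn e" "U b - c"] sg N1(1)
        unfolding norm_mult norm_of_real Lb_def by (intro add_mono mult_mono) auto
      finally have nY: "norm (Y 1) \<le> 2 * N1 + Lb * N1" by simp
      have "norm (Z 1 - Y 1) \<le> norm (y b - f b) + norm ((w b - g b) -
          (of_real (P0 b) * Ln (of_real (U b - c) - \<i> * of_real e) * y b - of_real (P0 b) * log_branch (sgn e) (U b - c) * f b))"
        unfolding Yv Zv using norm_Pair_le by (simp add: algebra_simps)
      also have "\<dots> \<le> M * E + (M * E + Qb * (E * (N1 + M) + M * E))"
      proof (rule add_mono[OF Mb(1) order_trans[OF norm_triangle_ineq4 add_mono[OF Mb(2)]]])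
        have "norm (y b) \<le> N1 + M" by (rule yE[OF _ Mb(1) M(1)]) (use N1(2)[OF p, of b] ab in auto)
        then have "Qb * (E * norm (y b) + norm (y b - f b)) \<le> Qb * (E * (N1 + M) + M * E)"
          using Qb(1) E Mb by (intro mult_left_mono add_mono) auto
        then show "norm (of_real (P0 b) * Ln (of_real (U b - c) - \<i> * of_real e) * y b - of_real (P0 b) * log_branch (sgn e) (U b - c) * f b)
            \<le> Qb * (E * (N1 + M) + M * E)"
          using Qb(2)[OF e(1,2), of "y b" "f b"] unfolding E_def[symmetric] by linarith
      qed
      also have "\<dots> = (2 * M + Qb * ((N1 + M) + M)) * E" by (simp add: algebra_simps)
      finally have nZ: "norm (Z 1 - Y 1) \<le> (2 * M + Qb * ((N1 + M) + M)) * E" .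
      have ZY: "norm (Z t - Y t) \<le> M' * E" if t: "t \<in> L.chart_dom" for t
      proof -
        have "norm (Z t - Y t) \<le> K * (norm (Z 1 - Y 1) + (A * E) * (K * norm (Y 1)))"
        proof (rule gronwall_diff[OF cZ Y(1) t, where z = 0 and C = C and E = A and ?B1.0 = "L.chart_mat_complex k e"
              and ?B2.0 = "\<lambda>t. L.chart_mat (sgn e) k t 0"])
          show "norm (L.chart_mat_complex k e x - L.chart_mat (sgn e) k x 0) \<le> A * E" if "x \<in> {-1<..<1} - {0}" for x
            unfolding E_def by (rule A(2)[OF _ e(1,2)]) (use that in auto)
          show "norm (L.chart_mat (sgn e) k x 0) \<le> C" if "x \<in> {-1<..<1}" for x
            using C1(2)[of x k] C2(2)[of x k] C1(1) C2(1) sg that k by (auto simp: C_def)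
          show "A * E \<le> A" using A(1) E by (simp add: mult_left_le)
        qed (use Z Y(2) C A E K_def in auto)
        also have "\<dots> \<le> K * ((2 * M + Qb * ((N1 + M) + M)) * E + (A * E) * (K * (2 * N1 + Lb * N1)))"
          using nZ nY K A E by (intro mult_left_mono add_mono) auto
        also have "\<dots> = M' * E" by (simp add: M'_def algebra_simps)
        finally show ?thesis .
      qed
      have yf: "norm (y (L.X t 0) - f (L.X t 0)) \<le> M' * E" if "t \<in> L.chart_dom" for t
      proof -
        have "fst (Z t - Y t) = y (L.X t 0) - f (L.X t 0)" using Y(3)[OF that] by (simp add: Z_def)
        then show ?thesis
          using ZY[OF that] norm_fst_le[of "fst (Z t - Y t)" "snd (Z t - Y t)"] unfolding prod.collapse by simp
      qed
      have le: "M' * E \<le> (M + M2) * E" "M * E \<le> (M + M2) * E" "M2 * E \<le> (M + M2) * E"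
        using M M' M2 E by (auto intro!: mult_right_mono)
      show "\<forall>z\<in>{a..h}. norm (y z - f z) \<le> (M + M2) * \<bar>e\<bar> powr \<alpha>"
      proof
        fix z assume z: "z \<in> {a..h}"
        show "norm (y z - f z) \<le> (M + M2) * \<bar>e\<bar> powr \<alpha>"
          unfolding E_def[symmetric]
        proof (cases "z \<le> b")
          case True
          have zz: "z \<in> {L.X (-1) 0..L.X 1 0}" using z True by (simp add: a_def b_def)
          obtain t where "t \<in> L.chart_dom" "L.X t 0 = z" by (rule L.chart_cover[OF z0 zz], rule that)
          then show "norm (y z - f z) \<le> (M + M2) * E" using yf[of t] le by auto
        next
          case False
          then show "norm (y z - f z) \<le> (M + M2) * E" using Mz[of z] le z by auto
        qed
      qed
      have ya: "norm (y a - f a) \<le> M' * E" using yf[of "-1"] by (simp add: a_def)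
      have "snd (Z (-1) - Y (-1)) = (w a - g a) -
          (of_real (P0 a) * Ln (of_real (U a - c) - \<i> * of_real e) * y a - of_real (P0 a) * log_branch (sgn e) (U a - c) * f a)"
        unfolding Yv Zv by simp
      then have "w a - g a = snd (Z (-1) - Y (-1)) +
          (of_real (P0 a) * Ln (of_real (U a - c) - \<i> * of_real e) * y a - of_real (P0 a) * log_branch (sgn e) (U a - c) * f a)"
        by simp
      then have "norm (w a - g a) \<le> norm (snd (Z (-1) - Y (-1))) +
          norm (of_real (P0 a) * Ln (of_real (U a - c) - \<i> * of_real e) * y a - of_real (P0 a) * log_branch (sgn e) (U a - c) * f a)"
        by (metis norm_triangle_ineq)
      also have "\<dots> \<le> M' * E + Qa * (E * (N2 + M') + M' * E)"
      proof (rule add_mono)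
        show "norm (snd (Z (-1) - Y (-1))) \<le> M' * E"
          using ZY[of "-1"] norm_snd_le[of "snd (Z (-1) - Y (-1))" "fst (Z (-1) - Y (-1))"]
          unfolding prod.collapse by simp
        have "norm (y a) \<le> N2 + M'" by (rule yE[OF _ ya M']) (use N2(2)[OF p, of a] ab in auto)
        then have "Qa * (E * norm (y a) + norm (y a - f a)) \<le> Qa * (E * (N2 + M') + M' * E)"
          using Qa(1) E ya by (intro mult_left_mono add_mono) auto
        then show "norm (of_real (P0 a) * Ln (of_real (U a - c) - \<i> * of_real e) * y a - of_real (P0 a) * log_branch (sgn e) (U a - c) * f a)
            \<le> Qa * (E * (N2 + M') + M' * E)"
          using Qa(2)[OF e(1,2), of "y a" "f a"] unfolding E_def[symmetric] by linarith
      qed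
      also have "\<dots> = M2 * E" by (simp add: M2_def algebra_simps)
      finally show "norm (w a - g a) \<le> (M + M2) * \<bar>e\<bar> powr \<alpha>" using le unfolding E_def[symmetric] by linarith
    qed
  qed
qed

text \<open>The irregular speeds are the image under \<open>U\<close> of a compact set, the critical
  points together with the two ends, so the regular ones form an open set.\<close>

lemma regular_speed_near:
  assumes "regular_speed c"
  obtains \<epsilon> where "\<epsilon> > 0" "\<And>c'. \<bar>c' - c\<bar> < \<epsilon> \<Longrightarrow> regular_speed c'"
proof -
  define K where "K = {x \<in> {0..h}. DU 1 x = 0} \<union> {0, h}"
  have regular_speed_iff: "regular_speed c' \<longleftrightarrow> c' \<notin> U ` K" for c' by (auto simp: regular_speed_def K_def)
  have "closed {x \<in> {0..h}. DU 1 x = 0}"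
    using continuous_closed_preimage[OF DU_cont, of 1 "{0}"] l_ge by (simp add: vimage_def Int_def)
  then have "closed K" by (auto simp: K_def)
  moreover have K: "K \<subseteq> {0..h}" using h_pos by (auto simp: K_def)
  ultimately have "compact K" using compact_Int_closed[OF compact_Icc, of K 0 h] by (simp add: Int_absorb1)
  then have "compact (U ` K)"
    by (intro compact_continuous_image continuous_on_subset[OF U_cont K])
  then have "open (- (U ` K))" by (simp add: compact_imp_closed open_Compl)
  moreover have "c \<in> - (U ` K)" using assms regular_speed_iff by simp
  ultimately obtain \<epsilon> where e: "\<epsilon> > 0" "\<And>y. dist y c < \<epsilon> \<Longrightarrow> y \<in> - (U ` K)"
    unfolding open_dist by blast
  show ?thesis by (rule that[OF e(1)]) (use e(2) regular_speed_iff in \<open>auto simp: dist_real_def\<close>)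
qed

lemma Ck_param_rayleigh_mat:
  assumes "n + 2 \<le> l" and ab: "0 \<le> a" "b \<le> h" and ne: "\<And>x d. x \<in> {a..b} \<Longrightarrow> d \<in> D \<Longrightarrow> U x \<noteq> c + d"
  shows "Ck_param n {a..b} D (\<lambda>x d. rayleigh_mat k (of_real (c + d)) x)"
proof -
  have cont: "continuous_on {a..b} (DU 2)" "continuous_on {a..b} U"
    using DU_cont[of 2] U_cont l_ge ab by (auto intro: continuous_on_subset)
  have "Ck_param n {a..b} D (\<lambda>x d. DU 2 x / (U x - (c + d)))"
    by (rule Ck_param_divide[OF Ck_param_fst[OF cont(1)] Ck_param_diff[OF Ck_param_fst[OF cont(2)] Ck_param_add[OF Ck_param_const Ck_param_snd]]])
      (use ne in auto)
  then have "Ck_param n {a..b} D (\<lambda>x d. mat2 0 1 (of_real (DU 2 x / (U x - (c + d))) + of_real (k\<^sup>2)) 0)"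
    by (intro Ck_param_mat2 Ck_param_add Ck_param_of_real Ck_param_const)
  then show ?thesis by (simp add: rayleigh_mat_def)
qed

end

text \<open>The ends \<open>X 1 d\<close> and \<open>X (-1) d\<close> are the same points for every
  \<open>d\<close>, so the values of \<open>F d\<close> and \<open>G d\<close> there are input and
  output of one family of systems on the chart, to which \<open>Ck_param_linear_ode\<close> applies.
  At the ends the logarithm is a constant plus \<open>ln (eta - rho d t)\<close>, hence smooth in
  \<open>d\<close>, and the passage between \<open>G\<close> and \<open>v\<close> preserves
  smoothness.\<close>

lemma (in layer) Ck_param_layer_step:
  assumes n: "n + 3 \<le> l" and \<sigma>: "\<bar>\<sigma>\<bar> \<le> 1" and D: "open D" "D \<subseteq> speeds"
    and sys: "\<And>d. d \<in> D \<Longrightarrow> limit_sys k (cs + d) \<sigma> (F d) (G d)"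
    and b: "Ck_param n {X 1 0} D (\<lambda>t d. (F d t, G d t))"
  shows "Ck_param n {X (-1) 0} D (\<lambda>t d. (F d t, G d t))"
proof -
  define a' b' where "a' = X (-1) 0" and "b' = X 1 0"
  have X1: "X 1 d = b'" "X (-1) d = a'" for d by (simp_all only: a'_def b'_def X_1 X_m1)
  define Lc where "Lc t d = ell \<sigma> t + of_real (ln (eta - rho * d * t))" for t d
  have CL: "Ck_param n {t} D (\<lambda>_ d. Lc t d)" if "t \<in> chart_dom" for t
  proof -
    have "Ck_param n {t} D (\<lambda>t d. ln (eta - rho * d * t))"
      by (rule Ck_param_subset[OF Ck_param_lnr _ D(2)]) (use that in auto)
    from Ck_param_add[OF Ck_param_const Ck_param_of_real[OF Ck_param_reparam[OF _ _ this, of "{t}" "\<lambda>_. t"]]]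
    show ?thesis unfolding Lc_def by simp
  qed
  have Lc: "log_branch \<sigma> (U (X t d) - (cs + d)) = Lc t d" if "t \<in> chart_dom - {0}" "d \<in> D" for t d
    unfolding Lc_def by (rule log_branch_X) (use that D in auto)
  define YP where "YP d Y \<longleftrightarrow> continuous_on chart_dom Y \<and>
    (\<forall>t\<in>chart_dom - {0}. (Y has_vector_derivative chart_mat \<sigma> k t d (Y t)) (at t)) \<and>
    (\<forall>t\<in>chart_dom. fst (Y t) = F d (X t d)) \<and>
    (\<forall>t\<in>chart_dom - {0}. snd (Y t) = G d (X t d) - of_real (P0 (X t d)) * Lc t d * F d (X t d))" for d Y
  have ex: "\<exists>Y. YP d Y" if d: "d \<in> D" for d
  proof (rule sys_chart[OF _ sys[OF d]])
    show "d \<in> speeds" using d D by auto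
    fix Y assume "continuous_on chart_dom Y"
      "\<And>t. t \<in> chart_dom - {0} \<Longrightarrow> (Y has_vector_derivative chart_mat \<sigma> k t d (Y t)) (at t)"
      "\<And>t. t \<in> chart_dom \<Longrightarrow> fst (Y t) = F d (X t d)"
      "\<And>t. t \<in> chart_dom - {0} \<Longrightarrow> snd (Y t) = G d (X t d) - of_real (P0 (X t d)) * log_branch \<sigma> (U (X t d) - (cs + d)) * F d (X t d)"
    then show ?thesis unfolding YP_def using Lc[OF _ d] by (intro exI[of _ Y]) auto
  qed
  define Y where "Y t d = (SOME Y. YP d Y) t" for t d
  have Y: "YP d (\<lambda>t. Y t d)" if "d \<in> D" for d
    unfolding Y_def using someI_ex[OF ex[OF that]] by simp
  note Y = this[unfolded YP_def]
  have "Ck_param n chart_dom D Y"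
  proof (rule Ck_param_linear_ode[where F = "\<lambda>_ _. 0" and B = "chart_mat \<sigma> k" and z = 0])
    show "Ck_param n chart_dom D (chart_mat \<sigma> k)" by (rule Ck_param_subset[OF Ck_param_chart_mat[OF n \<sigma>] _ D(2)]) auto
    have FG: "Ck_param n {1} D (\<lambda>_ d. (F d b', G d b'))"
      using Ck_param_reparam[OF _ _ b, of "{1}" "\<lambda>_. X 1 0"] by (simp add: b'_def)
    note FG' = Ck_param_linear[OF bounded_linear_fst FG, simplified] Ck_param_linear[OF bounded_linear_snd FG, simplified]
    have "Ck_param n {1} D (\<lambda>_ d. (F d b', G d b' - of_real (P0 b') * Lc 1 d * F d b'))"
      by (intro Ck_param_Pair Ck_param_diff Ck_param_mult Ck_param_const FG' CL) simp
    then show "Ck_param n {1} D Y"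
    proof (rule Ck_param_cong[OF D(1), rotated])
      fix t d assume t: "t \<in> {1::real}" and d: "d \<in> D"
      have "fst (Y 1 d) = F d b'" "snd (Y 1 d) = G d b' - of_real (P0 b') * Lc 1 d * F d b'"
        using Y[OF d] X1(1)[of d] by auto
      then show "(F d b', G d b' - of_real (P0 b') * Lc 1 d * F d b') = Y t d"
        using t by (auto intro: prod_eqI)
    qed
    show "((\<lambda>t. Y t d) has_vector_derivative chart_mat \<sigma> k t d (Y t d) + 0) (at t)"
      if "t \<in> {-1<..<1} - {0}" "d \<in> D" for t d
      using Y[OF that(2)] that by auto
    show "continuous_on chart_dom (\<lambda>t. Y t d)" if "d \<in> D" for d using Y[OF that] by blast
  qed (use D Ck_param_const in auto)
  from Ck_param_reparam[OF _ _ this, of "{a'}" "\<lambda>_. -1"]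
  have CY: "Ck_param n {a'} D (\<lambda>_ d. Y (-1) d)" by simp
  have CL': "Ck_param n {a'} D (\<lambda>_ d. Lc (-1) d)"
    using Ck_param_reparam[OF _ _ CL[of "-1"], of "{a'}" "\<lambda>_. -1"] by simp
  have "Ck_param n {a'} D (\<lambda>_ d. (fst (Y (-1) d), snd (Y (-1) d) + of_real (P0 a') * Lc (-1) d * fst (Y (-1) d)))"
    by (intro Ck_param_Pair Ck_param_add Ck_param_mult Ck_param_const CL' Ck_param_linear[OF bounded_linear_fst CY] Ck_param_linear[OF bounded_linear_snd CY])
  then show ?thesis
    unfolding a'_def[symmetric]
  proof (rule Ck_param_cong[OF D(1), rotated])
    fix t d assume t: "t \<in> {a'}" and d: "d \<in> D"
    have "fst (Y (-1) d) = F d a'" "snd (Y (-1) d) = G d a' - of_real (P0 a') * Lc (-1) d * F d a'"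
      using Y[OF d] X1(2)[of d] by auto
    then show "(fst (Y (-1) d), snd (Y (-1) d) + of_real (P0 a') * Lc (-1) d * fst (Y (-1) d)) = (F d t, G d t)"
      using t by auto
  qed
qed

lemma deriv_within_cong:
  assumes "\<And>y. y \<in> A \<Longrightarrow> f y = g y" "x \<in> A"
  shows "deriv_within A f x = deriv_within A g x"
proof -
  have "(f has_vector_derivative D) (at x within A) \<longleftrightarrow> (g has_vector_derivative D) (at x within A)" for D
    using has_vector_derivative_transform[of x A g f D] has_vector_derivative_transform[of x A f g D] assms by auto
  then show ?thesis by (simp add: deriv_within_def vector_derivative_def)
qed

lemma Ck_on_cong:
  assumes eq: "\<And>y. y \<in> A \<Longrightarrow> f y = g y" and g: "Ck_on n A g"
  shows "Ck_on n A f"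
proof -
  have it: "(deriv_within A ^^ j) f x = (deriv_within A ^^ j) g x" if "x \<in> A" for j x
    using that
  proof (induction j arbitrary: x)
    case (Suc j)
    then show ?case using deriv_within_cong[of A "(deriv_within A ^^ j) f" "(deriv_within A ^^ j) g" x] by simp
  qed (simp add: eq)
  show ?thesis
    unfolding Ck_on_def
  proof (intro conjI allI impI ballI)
    show "continuous_on A ((deriv_within A ^^ n) f)"
      using g it by (auto simp: Ck_on_def intro: continuous_on_eq)
    fix j x assume j: "j < n" and x: "x \<in> A"
    then have "(deriv_within A ^^ j) g differentiable (at x within A)" using g by (auto simp: Ck_on_def)
    then obtain L where "((deriv_within A ^^ j) g has_derivative L) (at x within A)"
      unfolding differentiable_def by blast
    then have "((deriv_within A ^^ j) f has_derivative L) (at x within A)"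
      by (rule has_derivative_transform[OF x it, rotated])
    then show "(deriv_within A ^^ j) f differentiable (at x within A)"
      unfolding differentiable_def by blast
  qed
qed

lemma Ck_on_Suc:
  assumes "\<And>x. x \<in> A \<Longrightarrow> f differentiable (at x within A)" "Ck_on n A (deriv_within A f)"
  shows "Ck_on (Suc n) A f"
  unfolding Ck_on_def
proof (intro conjI allI impI ballI)
  have it: "(deriv_within A ^^ Suc j) f = (deriv_within A ^^ j) (deriv_within A f)" for j
    by (simp add: funpow_swap1)
  show "continuous_on A ((deriv_within A ^^ Suc n) f)" unfolding it using assms(2) by (simp add: Ck_on_def)
  fix j x assume "j < Suc n" "x \<in> A"
  then show "(deriv_within A ^^ j) f differentiable (at x within A)"
    using assms it by (cases j) (auto simp: Ck_on_def simp del: funpow.simps)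
qed

text \<open>On an open set \<open>deriv_within\<close> is the ordinary derivative, so the
  derivatives provided by \<open>Ck_param\<close> are those that \<open>Ck_on\<close>
  iterates.\<close>

lemma Ck_param_imp_Ck_on:
  assumes D: "open D"
  shows "Ck_param n {0} D (\<lambda>_. G) \<Longrightarrow> Ck_on n D G"
proof (induction n arbitrary: G)
  case 0
  then have "continuous_on D (\<lambda>d. (\<lambda>(d, _). G d) (d, 0::real))"
    by (intro continuous_on_compose2[of "D \<times> {0}" "\<lambda>(d, _). G d" D "\<lambda>d. (d, 0::real)"])
      (auto intro!: continuous_intros)
  then show ?case by (simp add: Ck_on_def)
next
  case (Suc n)
  from Suc.prems obtain G' where G': "\<forall>d\<in>D. (G has_vector_derivative G' (0::real) d) (at d)" "Ck_param n {0} D G'" by auto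
  have "Ck_param n {0} D (\<lambda>_. G' 0)" by (rule Ck_param_cong[OF D _ G'(2)]) simp
  then have "Ck_on n D (G' 0)" by (rule Suc.IH)
  moreover have "deriv_within D G d = G' 0 d" if "d \<in> D" for d
    unfolding deriv_within_def at_within_open[OF that D]
    using G'(1) that by (intro vector_derivative_at) auto
  ultimately have "Ck_on n D (deriv_within D G)" by (intro Ck_on_cong[of D "deriv_within D G" "G' 0"]) auto
  moreover have "G differentiable (at d within D)" if "d \<in> D" for d
    using G'(1) that by (intro differentiableI_vector[OF has_vector_derivative_at_within]) auto
  ultimately show ?case by (rule Ck_on_Suc[rotated])
qed

section \<open>Smoothness in the speed\<close>

context profile
begin

text \<open>\<open>ystar\<close> is chosen for each speed separately. Smoothness in the speed is
  recovered from the equation: the data at \<open>h\<close> are constant in the speed, and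
  smoothness of the pair \<open>(F d, G d)\<close> is propagated leftwards.\<close>

lemma ystar_smooth:
  assumes c: "regular_speed cs" and \<sigma>: "\<bar>\<sigma>\<bar> \<le> 1" and n: "n + 3 \<le> l" and x: "x \<in> {0..h}" "U x \<noteq> cs"
  shows "\<exists>\<epsilon>>0. Ck_on n (ball cs \<epsilon>) (\<lambda>c. ystar h U k c \<sigma> x)"
proof -
  obtain e0 where e0: "e0 > 0" "\<And>c'. \<bar>c' - cs\<bar> < e0 \<Longrightarrow> regular_speed c'" by (rule regular_speed_near[OF c], rule that)
  define F where "F d = ystar h U k (cs + d) \<sigma>" for d
  define G where "G d = deriv_within {0..h} (F d)" for d
  have sys: "limit_sys k (cs + d) \<sigma> (F d) (G d)" "F d h = 0" "G d h = 1" if "\<bar>d\<bar> < e0" for d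
  proof -
    have "regular_speed (cs + d)" by (rule e0(2)) (use that in simp)
    from ystar_limit_sys[OF this \<sigma>] show "limit_sys k (cs + d) \<sigma> (F d) (G d)" "F d h = 0" "G d h = 1"
      unfolding F_def G_def by auto
  qed
  obtain q :: nat where q: "1 \<le> q" by blast
  \<comment> \<open>The interval of speeds may shrink from step to step; \<open>e \<le> e0\<close>
    keeps them regular, so that \<open>sys\<close> applies.\<close>
  have "\<exists>e>0. e \<le> e0 \<and> Ck_param n {x} {-e<..<e} (\<lambda>t d. (F d t, G d t))"
  proof (rule layer_induct[OF c _ _ _ q x, where P = "\<lambda>x. \<exists>e>0. e \<le> e0 \<and> Ck_param n {x} {-e<..<e} (\<lambda>t d. (F d t, G d t))"])
    have "Ck_param n {h} {-e0<..<e0} (\<lambda>t d. (F d t, G d t))"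
      by (rule Ck_param_cong[OF _ _ Ck_param_const[of n "{h}" "{-e0<..<e0}" "(0, 1)"]]) (use sys in \<open>auto simp: abs_less_iff\<close>)
    then show "\<exists>e>0. e \<le> e0 \<and> Ck_param n {h} {-e<..<e} (\<lambda>t d. (F d t, G d t))"
      using e0 by blast
  next
    fix a b assume ab: "0 \<le> a" "a \<le> b" "b \<le> h" "\<And>x. x \<in> {a..b} \<Longrightarrow> U x \<noteq> cs"
      and "\<exists>e>0. e \<le> e0 \<and> Ck_param n {b} {-e<..<e} (\<lambda>t d. (F d t, G d t))"
    then obtain e where e: "e > 0" "e \<le> e0" "Ck_param n {b} {-e<..<e} (\<lambda>t d. (F d t, G d t))" by blast
    have "compact (U ` {a..b})"
      by (intro compact_continuous_image continuous_on_subset[OF U_cont]) (use ab in auto)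
    then have "open (- (U ` {a..b}))" by (simp add: compact_imp_closed open_Compl)
    moreover have "cs \<in> - (U ` {a..b})"
    proof
      assume "cs \<in> U ` {a..b}"
      then obtain x where "x \<in> {a..b}" "U x = cs" by blast
      then show False using ab(4)[of x] by simp
    qed
    ultimately obtain m where m: "m > 0" "\<And>y. dist y cs < m \<Longrightarrow> y \<in> - (U ` {a..b})"
      unfolding open_dist by blast
    \<comment> \<open>Speeds within \<open>m\<close> of \<open>cs\<close> are not values of
      \<open>U\<close> on \<open>{a..b}\<close>, so the interval stays layer-free for all of
      \<open>D\<close>.\<close>
    define e' where "e' = min e m"
    define D where "D = {-e'<..<e'}"
    have e': "e' > 0" "e' \<le> e0" using e m by (auto simp: e'_def)
    have De: "D \<subseteq> {-e<..<e}" "\<And>d. d \<in> D \<Longrightarrow> \<bar>d\<bar> < e0" using e by (auto simp: D_def e'_def)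
    have ne: "U x \<noteq> cs + d" if "x \<in> {a..b}" "d \<in> D" for x d
    proof -
      have "dist (cs + d) cs < m" using that(2) by (auto simp: D_def e'_def dist_real_def)
      then have "cs + d \<notin> U ` {a..b}" using m(2)[of "cs + d"] by simp
      then show ?thesis using that(1) by (metis imageI)
    qed
    have "Ck_param n {a..b} D (\<lambda>t d. (F d t, G d t))"
    proof (rule Ck_param_linear_ode[where F = "\<lambda>_ _. 0" and B = "\<lambda>x d. rayleigh_mat k (of_real (cs + d)) x" and z = a])
      show "Ck_param n {a..b} D (\<lambda>x d. rayleigh_mat k (of_real (cs + d)) x)"
        by (rule Ck_param_rayleigh_mat) (use n ab ne in auto)
      show "Ck_param n {b} D (\<lambda>t d. (F d t, G d t))" by (rule Ck_param_subset[OF e(3) _ De(1)]) simp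
      show "continuous_on {a..b} (\<lambda>t. (F d t, G d t))" if "d \<in> D" for d
        by (rule limit_sys_regular_speed(1)[OF sys(1)[OF De(2)[OF that]] ab(1,3) ne[OF _ that]])
      show "((\<lambda>t. (F d t, G d t)) has_vector_derivative rayleigh_mat k (of_real (cs + d)) t (F d t, G d t) + 0) (at t)"
        if "t \<in> {a<..<b} - {a}" "d \<in> D" for t d
        using limit_sys_regular_speed(2)[OF sys(1)[OF De(2)[OF that(2)]] ab(1,3) ne[OF _ that(2)], of t] that by simp
    qed (use ab Ck_param_const in \<open>auto simp: D_def\<close>)
    then have "Ck_param n {a} D (\<lambda>t d. (F d t, G d t))" by (rule Ck_param_subset) (use ab in auto)
    then show "\<exists>e>0. e \<le> e0 \<and> Ck_param n {a} {-e<..<e} (\<lambda>t d. (F d t, G d t))"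
      using e' unfolding D_def by blast
  next
    fix rho eta lo hi V assume L: "layer h U l cs rho eta lo hi V q"
    interpret L: layer h U l cs rho eta lo hi V q by (rule L)
    assume "\<exists>e>0. e \<le> e0 \<and> Ck_param n {L.X 1 0} {-e<..<e} (\<lambda>t d. (F d t, G d t))"
    then obtain e where e: "e > 0" "e \<le> e0" "Ck_param n {L.X 1 0} {-e<..<e} (\<lambda>t d. (F d t, G d t))" by blast
    define e' where "e' = min e (eta / 2)"
    have e': "e' > 0" "e' \<le> e0" "e' \<le> e" "e' \<le> eta / 2" using e L.eta by (auto simp: e'_def)
    have "Ck_param n {L.X (-1) 0} {-e'<..<e'} (\<lambda>t d. (F d t, G d t))"
    proof (rule L.Ck_param_layer_step[OF n \<sigma>])
      show "limit_sys k (cs + d) \<sigma> (F d) (G d)" if "d \<in> {-e'<..<e'}" for d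
        by (rule sys(1)) (use that e' in \<open>auto simp: abs_less_iff\<close>)
      show "Ck_param n {L.X 1 0} {-e'<..<e'} (\<lambda>t d. (F d t, G d t))"
        by (rule Ck_param_subset[OF e(3)]) (use e' in auto)
    qed (use e' in auto)
    then show "\<exists>e>0. e \<le> e0 \<and> Ck_param n {L.X (-1) 0} {-e<..<e} (\<lambda>t d. (F d t, G d t))"
      using e' by blast
  qed
  then obtain e where e: "e > 0" "Ck_param n {x} {-e<..<e} (\<lambda>t d. (F d t, G d t))" by blast
  have "Ck_param n {x} {-e<..<e} (\<lambda>t d. F d t)" using Ck_param_linear[OF bounded_linear_fst e(2)] by simp
  from Ck_param_reparam[OF _ _ this, of "{0}" "\<lambda>_. x"] have "Ck_param n {0} {-e<..<e} (\<lambda>_ d. F d x)" by simp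
  \<comment> \<open>Back from the increment \<open>d\<close> to the speed
    \<open>c = cs + d\<close>.\<close>
  from Ck_param_compose[OF _ this Ck_param_diff[OF Ck_param_snd Ck_param_const], of "{0}" "ball cs e" cs]
  have "Ck_param n {0} (ball cs e) (\<lambda>_ c. F (c - cs) x)" by (auto simp: dist_real_def abs_less_iff)
  then have "Ck_on n (ball cs e) (\<lambda>c. F (c - cs) x)" by (rule Ck_param_imp_Ck_on[OF open_ball])
  then show ?thesis using e(1) by (auto simp: F_def)
qed

end

theorem proposition4p1:
  fixes h cs :: real and U :: "real \<Rightarrow> real" and l m :: nat and s :: "nat \<Rightarrow> real"
  assumes h_pos: "0 < h"
    and l_ge: "4 \<le> l"
    and U_Cl: "Ck_on l {0..h} U"
    and regular: "regular_value_on h U cs"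
    and not_end: "cs \<notin> {U 0, U h}"
    and m_ge: "1 \<le> m"
    and s_inj: "inj_on s {1..m}"
    and s_interior: "s ` {1..m} \<subseteq> {0<..<h}"
    and preimage: "critical_layers h U cs = s ` {1..m}"
  shows
    \<comment> \<open>(1)\<close>
    "(\<forall>k>0. \<forall>\<sigma>\<in>{-1, 1}.
        (\<exists>y. limit_solution h U k cs \<sigma> y \<and>
           (\<forall>z. limit_solution h U k cs \<sigma> z \<longrightarrow> (\<forall>x\<in>{0..h}. z x = y x)))) \<and>
    \<comment> \<open>(2), with the bound uniform for \<open>k\<close> in compact sets\<close>
     (\<forall>\<sigma>\<in>{-1, 1}. \<forall>K. compact K \<and> K \<subseteq> {0<..} \<longrightarrow>
        (\<forall>j\<in>{1..m}. \<exists>C r. 0 < r \<and>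
           (\<forall>k\<in>K. \<forall>t. 0 < \<bar>t\<bar> \<and> \<bar>t\<bar> < r \<longrightarrow>
              cmod (deriv_within {0..h} (ystar h U k cs \<sigma>) (s j + t)) \<le> C * \<bar>ln \<bar>t\<bar>\<bar>))) \<and>
     (\<forall>k>0. \<forall>\<sigma>\<in>{-1, 1}. \<forall>x\<in>{0..h} - critical_layers h U cs.
        \<exists>\<epsilon>>0. Ck_on (l - 3) (ball cs \<epsilon>) (\<lambda>c. ystar h U k c \<sigma> x)) \<and>
    \<comment> \<open>(3), with the bound uniform for \<open>k\<close> in compact sets\<close>
     (\<forall>\<delta>>0. \<forall>\<alpha>\<in>{0<..<1}. \<forall>K. compact K \<and> K \<subseteq> {0<..} \<longrightarrow>
        (\<exists>C \<epsilon>. 0 < \<epsilon> \<and>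
           (\<forall>k\<in>K. \<forall>cI. 0 < \<bar>cI\<bar> \<and> \<bar>cI\<bar> < \<epsilon> \<longrightarrow>
              (\<forall>y. rayleigh_solution h U k (Complex cs cI) {} y \<longrightarrow>
                 (\<forall>x\<in>{0..h} - (\<Union>j\<in>{1..m}. {s j - \<delta><..<s j + \<delta>}).
                    cmod (y x - ystar h U k cs (sgn cI) x) \<le> C * \<bar>cI\<bar> powr \<alpha>)))))"
proof -
  interpret profile h U l by (rule profile.intro[OF h_pos l_ge U_Cl])
  have c: "regular_speed cs"
    using regular not_end unfolding regular_value_on_def regular_speed_def DU_12 by auto
  have U_s: "s j \<in> {0..h}" "U (s j) = cs" if "j \<in> {1..m}" for j
    using preimage that unfolding critical_layers_def by auto
  \<comment> \<open>Uniformity over a compact \<open>K\<close> is obtained from a common bound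
    \<open>\<kappa>\<close> on its elements, on which the constants depend in place of
    \<open>k\<close>.\<close>
  have bnd: "\<exists>\<kappa>. \<forall>k\<in>K. \<bar>k\<bar> \<le> \<kappa>" if "compact K" for K :: "real set"
    using compact_imp_bounded[OF that] by (auto simp: bounded_real)
  have \<sigma>: "\<bar>\<sigma>\<bar> \<le> 1" if "\<sigma> \<in> {-1, 1}" for \<sigma> :: real using that by auto
  show ?thesis
  proof (intro conjI)
    show "\<forall>k>0. \<forall>\<sigma>\<in>{-1, 1}. (\<exists>y. limit_solution h U k cs \<sigma> y \<and>
           (\<forall>z. limit_solution h U k cs \<sigma> z \<longrightarrow> (\<forall>x\<in>{0..h}. z x = y x)))"
      using limit_solution_exists_unique[OF c \<sigma>] by blast
    show "\<forall>\<sigma>\<in>{-1, 1}. \<forall>K. compact K \<and> K \<subseteq> {0<..} \<longrightarrow>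
        (\<forall>j\<in>{1..m}. \<exists>C r. 0 < r \<and>
           (\<forall>k\<in>K. \<forall>t. 0 < \<bar>t\<bar> \<and> \<bar>t\<bar> < r \<longrightarrow>
              cmod (deriv_within {0..h} (ystar h U k cs \<sigma>) (s j + t)) \<le> C * \<bar>ln \<bar>t\<bar>\<bar>))"
    proof (intro ballI allI impI)
      fix \<sigma> :: real and K :: "real set" and j assume a: "\<sigma> \<in> {-1, 1}" "compact K \<and> K \<subseteq> {0<..}" "j \<in> {1..m}"
      obtain \<kappa> where \<kappa>: "\<forall>k\<in>K. \<bar>k\<bar> \<le> \<kappa>" using bnd a by blast
      obtain C r where "0 < r" and C: "\<forall>k f g t. \<bar>k\<bar> \<le> \<kappa> \<longrightarrow> limit_sys k cs \<sigma> f g \<longrightarrow> f h = 0 \<longrightarrow> g h = 1 \<longrightarrow>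
          0 < \<bar>t\<bar> \<and> \<bar>t\<bar> < r \<longrightarrow> norm (g (s j + t)) \<le> C * \<bar>ln \<bar>t\<bar>\<bar>"
        using layer_log_bound[OF c \<sigma>[OF a(1)] U_s[OF a(3)], of \<kappa>] by blast
      show "\<exists>C r. 0 < r \<and> (\<forall>k\<in>K. \<forall>t. 0 < \<bar>t\<bar> \<and> \<bar>t\<bar> < r \<longrightarrow>
              cmod (deriv_within {0..h} (ystar h U k cs \<sigma>) (s j + t)) \<le> C * \<bar>ln \<bar>t\<bar>\<bar>)"
      proof (rule exI[of _ C], rule exI[of _ r], intro conjI ballI allI impI)
        fix k t assume "k \<in> K" "0 < \<bar>t\<bar> \<and> \<bar>t\<bar> < r"
        then show "cmod (deriv_within {0..h} (ystar h U k cs \<sigma>) (s j + t)) \<le> C * \<bar>ln \<bar>t\<bar>\<bar>"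
          using C \<kappa> ystar_limit_sys[OF c \<sigma>[OF a(1)], of k] by blast
      qed fact
    qed
    show "\<forall>k>0. \<forall>\<sigma>\<in>{-1, 1}. \<forall>x\<in>{0..h} - critical_layers h U cs.
        \<exists>\<epsilon>>0. Ck_on (l - 3) (ball cs \<epsilon>) (\<lambda>c. ystar h U k c \<sigma> x)"
    proof (intro allI impI ballI)
      fix k \<sigma> x :: real assume a: "\<sigma> \<in> {-1, 1}" "x \<in> {0..h} - critical_layers h U cs"
      show "\<exists>\<epsilon>>0. Ck_on (l - 3) (ball cs \<epsilon>) (\<lambda>c. ystar h U k c \<sigma> x)"
        by (rule ystar_smooth[OF c \<sigma>[OF a(1)]]) (use a l_ge in \<open>auto simp: critical_layers_def\<close>)
    qed
    show "\<forall>\<delta>>0. \<forall>\<alpha>\<in>{0<..<1}. \<forall>K. compact K \<and> K \<subseteq> {0<..} \<longrightarrow>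
        (\<exists>C \<epsilon>. 0 < \<epsilon> \<and>
           (\<forall>k\<in>K. \<forall>cI. 0 < \<bar>cI\<bar> \<and> \<bar>cI\<bar> < \<epsilon> \<longrightarrow>
              (\<forall>y. rayleigh_solution h U k (Complex cs cI) {} y \<longrightarrow>
                 (\<forall>x\<in>{0..h} - (\<Union>j\<in>{1..m}. {s j - \<delta><..<s j + \<delta>}).
                    cmod (y x - ystar h U k cs (sgn cI) x) \<le> C * \<bar>cI\<bar> powr \<alpha>))))"
    proof (intro ballI allI impI)
      fix \<delta> \<alpha> :: real and K :: "real set" assume a: "0 < \<delta>" "\<alpha> \<in> {0<..<1}" "compact K \<and> K \<subseteq> {0<..}"
      obtain \<kappa> where \<kappa>: "\<forall>k\<in>K. \<bar>k\<bar> \<le> \<kappa>" using bnd a by blast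
      have \<alpha>: "0 < \<alpha>" "\<alpha> < 1" using a by auto
      have "0 \<in> {0..h}" "U 0 \<noteq> cs" using h_pos not_end by auto
      \<comment> \<open>The estimate is taken at \<open>x = 0\<close>, so that one constant covers
        all of \<open>{0..h}\<close>.\<close>
      from convergence[OF c \<alpha> this, of \<kappa>] obtain M where M: "\<forall>k e f g y w. perturbed_pair \<kappa> cs k e f g y w \<longrightarrow>
          (\<forall>z\<in>{0..h}. norm (y z - f z) \<le> M * \<bar>e\<bar> powr \<alpha>) \<and> norm (w 0 - g 0) \<le> M * \<bar>e\<bar> powr \<alpha>"
        by blast
      show "\<exists>C \<epsilon>. 0 < \<epsilon> \<and> (\<forall>k\<in>K. \<forall>cI. 0 < \<bar>cI\<bar> \<and> \<bar>cI\<bar> < \<epsilon> \<longrightarrow>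
              (\<forall>y. rayleigh_solution h U k (Complex cs cI) {} y \<longrightarrow>
                 (\<forall>x\<in>{0..h} - (\<Union>j\<in>{1..m}. {s j - \<delta><..<s j + \<delta>}).
                    cmod (y x - ystar h U k cs (sgn cI) x) \<le> C * \<bar>cI\<bar> powr \<alpha>)))"
      \<comment> \<open>The radius 1 matches the requirement \<open>|e| < 1\<close> in
        \<open>perturbed_pair\<close>.\<close>
      proof (rule exI[of _ M], rule exI[of _ 1], intro conjI ballI allI impI)
        fix k e y x assume k: "k \<in> K" and e: "0 < \<bar>e\<bar> \<and> \<bar>e\<bar> < 1"
          and y: "rayleigh_solution h U k (Complex cs e) {} y"
          and x: "x \<in> {0..h} - (\<Union>j\<in>{1..m}. {s j - \<delta><..<s j + \<delta>})"
        have "\<bar>sgn e\<bar> \<le> 1" by (simp add: sgn_if)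
        note S = ystar_limit_sys[OF c this, of k]
        note D = rayleigh_solutionD[OF y]
        have "complex_sys k cs e y (deriv_within {0..h} y)" using D by (auto simp: complex_sys_def)
        then have p: "perturbed_pair \<kappa> cs k e (ystar h U k cs (sgn e)) (deriv_within {0..h} (ystar h U k cs (sgn e))) y (deriv_within {0..h} y)"
          unfolding perturbed_pair_def using S D(4,5) k \<kappa> e by simp
        have "x \<in> {0..h}" using x by blast
        then show "cmod (y x - ystar h U k cs (sgn e) x) \<le> M * \<bar>e\<bar> powr \<alpha>"
          using M[rule_format, OF p] by blast
      qed simp
    qed
  qed
qed

end
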